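(* Let $B$ be a field, and let $A$ be a separable field extension of $B$ of degree $n$. Let $\widetilde{A}$ be a Galois closure of $A$ over $B$, and let $r=\frac{n!}{\deg(\widetilde{A}/B)}$. Then $$G(A/B)\cong \widetilde{A}^{\,r}$$ as $B$-algebras (where $\widetilde{A}^{\,r}$ is the product of $r$ copies of $\widetilde A$).
   Context: All rings are commutative with unity. Let $A$ be a $B$-algebra that is free of rank $n$ as a $B$-module. For $a\in A$ let $P_a(x)=x^n-s_1(a)x^{n-1}+s_2(a)x^{n-2}-\cdots+(-1)^n s_n(a)$ be the characteristic polynomial of the $B$-linear map $A\to A$ given by multiplication by $a$; this defines $s_j(a)\in B$ for $1\le j\le n$. All tensor powers are over $B$. For $a\in A$ and $1\le i\le n$ let $a^{(i)}=1\otimes\cdots\otimes a\otimes\cdots\otimes 1\in A^{\otimes n}$, with $a$ in the $i$-th tensor factor. Let $I(A,B)\subset A^{\otimes n}$ be the ideal generated by all elements $$s_j(a)-\sum_{1\le i_1<\cdots<i_j\le n}a^{(i_1)}a^{(i_2)}\cdots a^{(i_j)},\qquad a\in A,\ 1\le j\le n.$$ The $S_n$-closure of $A$ over $B$ is the $B$-algebra $G(A/B)=A^{\otimes n}/I(A,B)$. *)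

theory Defs
  imports
    "HOL-Algebra.Algebraic_Closure_Type"
    "HOL-Library.FuncSet"
    "HOL-Library.Poly_Mapping"
    "Jordan_Normal_Form.Char_Poly"
begin

section \<open>Algebras over a commutative ring\<close>

text \<open>
  An algebra over \<open>'b\<close> is given by its structure map, a ring homomorphism out of \<open>'b\<close>.
  When the algebra is all of a type \<open>'a\<close> the structure map \<open>\<phi> :: 'b \<Rightarrow> 'a\<close> alone is the
  algebra; otherwise it accompanies a ring record.
\<close>

definition alg_scale :: "('b \<Rightarrow> 'a::comm_ring_1) \<Rightarrow> 'b \<Rightarrow> 'a \<Rightarrow> 'a" where
  "alg_scale \<phi> = (\<lambda>b x. \<phi> b * x)"

definition alg_isomorphic ::
    "('x, 'p) ring_scheme \<Rightarrow> ('b \<Rightarrow> 'x) \<Rightarrow> ('y, 'q) ring_scheme \<Rightarrow> ('b \<Rightarrow> 'y) \<Rightarrow> bool" where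
  "alg_isomorphic R \<iota> S \<kappa> \<longleftrightarrow> (\<exists>h \<in> ring_iso R S. \<forall>b. h (\<iota> b) = \<kappa> b)"

definition power_ring :: "('x, 'p) ring_scheme \<Rightarrow> nat \<Rightarrow> (nat \<Rightarrow> 'x) ring" where
  "power_ring R r =
    \<lparr> carrier = {..<r} \<rightarrow>\<^sub>E carrier R,
      monoid.mult = (\<lambda>f g. \<lambda>i\<in>{..<r}. f i \<otimes>\<^bsub>R\<^esub> g i),
      one = (\<lambda>i\<in>{..<r}. \<one>\<^bsub>R\<^esub>),
      ring.zero = (\<lambda>i\<in>{..<r}. \<zero>\<^bsub>R\<^esub>),
      add = (\<lambda>f g. \<lambda>i\<in>{..<r}. f i \<oplus>\<^bsub>R\<^esub> g i) \<rparr>"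

definition power_scalar :: "('b \<Rightarrow> 'x) \<Rightarrow> nat \<Rightarrow> 'b \<Rightarrow> (nat \<Rightarrow> 'x)" where
  "power_scalar \<kappa> r b = (\<lambda>i\<in>{..<r}. \<kappa> b)"


section \<open>The characteristic polynomial of multiplication by an element\<close>

definition algebra_basis :: "('b::comm_ring_1 \<Rightarrow> 'a::comm_ring_1) \<Rightarrow> 'a list \<Rightarrow> bool" where
  "algebra_basis \<phi> es \<longleftrightarrow>
     distinct es \<and> \<not> Modules.module.dependent (alg_scale \<phi>) (set es) \<and>
     Modules.module.span (alg_scale \<phi>) (set es) = UNIV"

definition mult_matrix ::
    "('b::comm_ring_1 \<Rightarrow> 'a::comm_ring_1) \<Rightarrow> 'a list \<Rightarrow> 'a \<Rightarrow> 'b mat" where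
  "mult_matrix \<phi> es a = mat (length es) (length es)
     (\<lambda>(i, j). Modules.module.representation (alg_scale \<phi>) (set es) (a * es ! j) (es ! i))"

text \<open>The polynomial does not depend on the basis that is chosen.\<close>

definition mult_char_poly ::
    "('b::comm_ring_1 \<Rightarrow> 'a::comm_ring_1) \<Rightarrow> nat \<Rightarrow> 'a \<Rightarrow> 'b poly" where
  "mult_char_poly \<phi> n a =
     char_poly (mult_matrix \<phi> (SOME es. length es = n \<and> algebra_basis \<phi> es) a)"

definition s_coeff ::
    "('b::comm_ring_1 \<Rightarrow> 'a::comm_ring_1) \<Rightarrow> nat \<Rightarrow> nat \<Rightarrow> 'a \<Rightarrow> 'b" where
  "s_coeff \<phi> n j a = (-1) ^ j * coeff (mult_char_poly \<phi> n a) (n - j)"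


section \<open>Tensor powers\<close>

text \<open>
  The free module on the set \<open>A\<^sup>n\<close> of \<open>n\<close>-tuples, with the product that is bilinear and
  multiplies basis tuples componentwise.
\<close>

definition tuple_times ::
    "('a::comm_ring_1 list \<Rightarrow>\<^sub>0 'b::comm_ring_1) \<Rightarrow> ('a list \<Rightarrow>\<^sub>0 'b) \<Rightarrow> ('a list \<Rightarrow>\<^sub>0 'b)" where
  "tuple_times f g =
     (\<Sum>u\<in>Poly_Mapping.keys f. \<Sum>v\<in>Poly_Mapping.keys g.
        Poly_Mapping.single (map2 (*) u v) (Poly_Mapping.lookup f u * Poly_Mapping.lookup g v))"

definition tuple_algebra :: "nat \<Rightarrow> ('a::comm_ring_1 list \<Rightarrow>\<^sub>0 'b::comm_ring_1) ring" where
  "tuple_algebra n =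
    \<lparr> carrier = {f. \<forall>xs\<in>Poly_Mapping.keys f. length xs = n},
      monoid.mult = tuple_times,
      one = Poly_Mapping.single (replicate n 1) 1,
      ring.zero = 0,
      add = (+) \<rparr>"

text \<open>
  The relations of multilinearity. Since the product of a relation and a tuple is again a
  relation, the ideal they generate is the submodule they generate.
\<close>

definition tensor_relations ::
    "('b::comm_ring_1 \<Rightarrow> 'a::comm_ring_1) \<Rightarrow> nat \<Rightarrow> ('a list \<Rightarrow>\<^sub>0 'b) set" where
  "tensor_relations \<phi> n =
     {Poly_Mapping.single (xs[i := a + a']) 1
        - Poly_Mapping.single (xs[i := a]) 1 - Poly_Mapping.single (xs[i := a']) 1
        | xs i a a'. length xs = n \<and> i < n} \<union>
     {Poly_Mapping.single (xs[i := \<phi> b * a]) 1 - Poly_Mapping.single (xs[i := a]) b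
        | xs i b a. length xs = n \<and> i < n}"

definition tensor_ideal ::
    "('b::comm_ring_1 \<Rightarrow> 'a::comm_ring_1) \<Rightarrow> nat \<Rightarrow> ('a list \<Rightarrow>\<^sub>0 'b) set" where
  "tensor_ideal \<phi> n = Idl\<^bsub>tuple_algebra n\<^esub> (tensor_relations \<phi> n)"

definition tensor_power ::
    "('b::comm_ring_1 \<Rightarrow> 'a::comm_ring_1) \<Rightarrow> nat \<Rightarrow> ('a list \<Rightarrow>\<^sub>0 'b) set ring" where
  "tensor_power \<phi> n = tuple_algebra n Quot tensor_ideal \<phi> n"

definition pure_tensor ::
    "('b::comm_ring_1 \<Rightarrow> 'a::comm_ring_1) \<Rightarrow> nat \<Rightarrow> 'a list \<Rightarrow> ('a list \<Rightarrow>\<^sub>0 'b) set" where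
  "pure_tensor \<phi> n xs = tensor_ideal \<phi> n +>\<^bsub>tuple_algebra n\<^esub> Poly_Mapping.single xs 1"

definition tensor_scalar ::
    "('b::comm_ring_1 \<Rightarrow> 'a::comm_ring_1) \<Rightarrow> nat \<Rightarrow> 'b \<Rightarrow> ('a list \<Rightarrow>\<^sub>0 'b) set" where
  "tensor_scalar \<phi> n b =
     tensor_ideal \<phi> n +>\<^bsub>tuple_algebra n\<^esub> Poly_Mapping.single (replicate n 1) b"

text \<open>Tensor factors are numbered from \<open>0\<close> to \<open>n - 1\<close>.\<close>

definition tensor_embed ::
    "('b::comm_ring_1 \<Rightarrow> 'a::comm_ring_1) \<Rightarrow> nat \<Rightarrow> nat \<Rightarrow> 'a \<Rightarrow> ('a list \<Rightarrow>\<^sub>0 'b) set" where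
  "tensor_embed \<phi> n i a = pure_tensor \<phi> n ((replicate n 1)[i := a])"


section \<open>The \<open>S\<^sub>n\<close>-closure\<close>

text \<open>Strictly increasing sequences of indices are encoded as the sets of their entries.\<close>

definition tensor_esym ::
    "('b::comm_ring_1 \<Rightarrow> 'a::comm_ring_1) \<Rightarrow> nat \<Rightarrow> nat \<Rightarrow> 'a \<Rightarrow> ('a list \<Rightarrow>\<^sub>0 'b) set" where
  "tensor_esym \<phi> n j a =
     (\<Oplus>\<^bsub>tensor_power \<phi> n\<^esub> S \<in> {S. S \<subseteq> {..<n} \<and> card S = j}.
        \<Otimes>\<^bsub>tensor_power \<phi> n\<^esub> i \<in> S. tensor_embed \<phi> n i a)"

definition Sn_ideal ::
    "('b::comm_ring_1 \<Rightarrow> 'a::comm_ring_1) \<Rightarrow> nat \<Rightarrow> ('a list \<Rightarrow>\<^sub>0 'b) set set" where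
  "Sn_ideal \<phi> n = Idl\<^bsub>tensor_power \<phi> n\<^esub>
     {tensor_scalar \<phi> n (s_coeff \<phi> n j a) \<ominus>\<^bsub>tensor_power \<phi> n\<^esub> tensor_esym \<phi> n j a
        | a j. 1 \<le> j \<and> j \<le> n}"

definition Sn_closure ::
    "('b::comm_ring_1 \<Rightarrow> 'a::comm_ring_1) \<Rightarrow> nat \<Rightarrow> ('a list \<Rightarrow>\<^sub>0 'b) set set ring" where
  "Sn_closure \<phi> n = tensor_power \<phi> n Quot Sn_ideal \<phi> n"

definition Sn_scalar ::
    "('b::comm_ring_1 \<Rightarrow> 'a::comm_ring_1) \<Rightarrow> nat \<Rightarrow> 'b \<Rightarrow> ('a list \<Rightarrow>\<^sub>0 'b) set set" where
  "Sn_scalar \<phi> n b = Sn_ideal \<phi> n +>\<^bsub>tensor_power \<phi> n\<^esub> tensor_scalar \<phi> n b"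


section \<open>Field extensions\<close>

text \<open>
  A field extension is a ring homomorphism \<open>\<chi>\<close> between fields. Intermediate fields are
  subsets \<open>E\<close> of the larger field.
\<close>

definition finite_extension :: "('b::field \<Rightarrow> 'c::field) \<Rightarrow> bool" where
  "finite_extension \<chi> \<longleftrightarrow> (\<exists>S. finite S \<and> Modules.module.span (alg_scale \<chi>) S = UNIV)"

text \<open>As usual for \<open>dim\<close>, the value is \<open>0\<close> if the extension is infinite.\<close>

definition extension_degree :: "('b::field \<Rightarrow> 'c::field) \<Rightarrow> nat" where
  "extension_degree \<chi> = vector_space.dim (alg_scale \<chi>) UNIV"

definition intermediate_field :: "('b::field \<Rightarrow> 'c::field) \<Rightarrow> 'c set \<Rightarrow> bool" where
  "intermediate_field \<chi> E \<longleftrightarrow> subfield E (ring_of_type_algebra :: 'c ring) \<and> range \<chi> \<subseteq> E"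

text \<open>
  An irreducible polynomial is separable if it is coprime to its derivative. Separable
  extensions are in particular algebraic.
\<close>

definition separable_over :: "('b::field \<Rightarrow> 'c::field) \<Rightarrow> 'c set \<Rightarrow> bool" where
  "separable_over \<chi> E \<longleftrightarrow>
     (\<forall>x\<in>E. \<exists>p. irreducible p \<and> poly (map_poly \<chi> p) x = 0 \<and> coprime p (pderiv p))"

definition normal_over :: "('b::field \<Rightarrow> 'c::field) \<Rightarrow> 'c set \<Rightarrow> bool" where
  "normal_over \<chi> E \<longleftrightarrow>
     (\<forall>x\<in>E. \<exists>p. p \<noteq> 0 \<and> poly (map_poly \<chi> p) x = 0) \<and>
     (\<forall>p. irreducible p \<and> (\<exists>x\<in>E. poly (map_poly \<chi> p) x = 0) \<longrightarrow>
        (\<exists>c xs. set xs \<subseteq> E \<and> map_poly \<chi> p = smult c (\<Prod>x\<leftarrow>xs. [:- x, 1:])))"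

definition galois_over :: "('b::field \<Rightarrow> 'c::field) \<Rightarrow> 'c set \<Rightarrow> bool" where
  "galois_over \<chi> E \<longleftrightarrow> intermediate_field \<chi> E \<and> normal_over \<chi> E \<and> separable_over \<chi> E"

text \<open>
  For extensions \<open>\<phi> : B \<rightarrow> A\<close> and \<open>\<psi> : A \<rightarrow> C\<close>: the field \<open>C\<close> is Galois over \<open>B\<close>, and no proper
  subfield of \<open>C\<close> containing \<open>A\<close> is.
\<close>

definition galois_closure ::
    "('b::field \<Rightarrow> 'a::field) \<Rightarrow> ('a \<Rightarrow> 'c::field) \<Rightarrow> bool" where
  "galois_closure \<phi> \<psi> \<longleftrightarrow>
     comm_ring_hom \<psi> \<and> galois_over (\<psi> \<circ> \<phi>) UNIV \<and>
     (\<forall>E. galois_over (\<psi> \<circ> \<phi>) E \<and> range \<psi> \<subseteq> E \<longrightarrow> E = UNIV)"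


section \<open>The tuple algebra, the tensor power and the \<open>S\<^sub>n\<close>-closure are commutative rings\<close>

lemma tuple_times_eq:
  assumes "finite U" "finite V" "Poly_Mapping.keys f \<subseteq> U" "Poly_Mapping.keys g \<subseteq> V"
  shows "tuple_times f g = (\<Sum>u\<in>U. \<Sum>v\<in>V. Poly_Mapping.single (map2 (*) u v) (Poly_Mapping.lookup f u * Poly_Mapping.lookup g v))"
proof -
  let ?t = "\<lambda>u v. Poly_Mapping.single (map2 (*) u v) (Poly_Mapping.lookup f u * Poly_Mapping.lookup g v)"
  have "tuple_times f g = (\<Sum>u\<in>Poly_Mapping.keys f. \<Sum>v\<in>V. ?t u v)"
    unfolding tuple_times_def using assms
    by (intro sum.cong refl sum.mono_neutral_left) (auto simp: in_keys_iff)
  also have "\<dots> = (\<Sum>u\<in>U. \<Sum>v\<in>V. ?t u v)"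
    using assms by (intro sum.mono_neutral_left) (auto simp: in_keys_iff)
  finally show ?thesis .
qed

lemma tuple_times_add_left: "tuple_times (f + f') g = tuple_times f g + tuple_times f' g"
proof -
  let ?U = "Poly_Mapping.keys f \<union> Poly_Mapping.keys f'"
  have k: "Poly_Mapping.keys (f + f') \<subseteq> ?U" by (rule Poly_Mapping.keys_add)
  show ?thesis
    by (subst (1 2 3) tuple_times_eq[where U = ?U and V = "Poly_Mapping.keys g"])
       (use k in \<open>auto simp: lookup_add distrib_right single_add sum.distrib\<close>)
qed

lemma tuple_times_add_right: "tuple_times f (g + g') = tuple_times f g + tuple_times f g'"
proof -
  let ?V = "Poly_Mapping.keys g \<union> Poly_Mapping.keys g'"
  have k: "Poly_Mapping.keys (g + g') \<subseteq> ?V" by (rule Poly_Mapping.keys_add)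
  show ?thesis
    by (subst (1 2 3) tuple_times_eq[where V = ?V and U = "Poly_Mapping.keys f"])
       (use k in \<open>auto simp: lookup_add distrib_left single_add sum.distrib\<close>)
qed

lemma tuple_times_single [simp]:
  "tuple_times (Poly_Mapping.single u a) (Poly_Mapping.single v b) =
     Poly_Mapping.single (map2 (*) u v) (a * b)"
  by (subst tuple_times_eq[where U = "{u}" and V = "{v}"]) auto

lemma tuple_times_zero [simp]: "tuple_times 0 g = 0" "tuple_times f 0 = 0"
  by (simp_all add: tuple_times_def)

lemma tuple_times_commute: "tuple_times f g = tuple_times g f"
proof -
  have "map2 (*) u v = map2 (*) v u" for u v :: "'a list"
    by (intro nth_equalityI) (auto simp: mult.commute)
  then show ?thesis
    unfolding tuple_times_def by (subst sum.swap) (simp add: mult.commute)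
qed

lemma map2_times_assoc:
  "map2 (*) (map2 (*) u v) w = map2 (*) u (map2 (*) v (w :: 'a::comm_ring_1 list))"
  by (intro nth_equalityI) (auto simp: mult.assoc)

lemma sum_single_lookup:
  fixes f :: "'k \<Rightarrow>\<^sub>0 'v::comm_monoid_add"
  shows "(\<Sum>v\<in>Poly_Mapping.keys f. Poly_Mapping.single v (Poly_Mapping.lookup f v)) = f"
  by (rule poly_mapping_eqI)
     (auto simp: lookup_sum lookup_single when_def in_keys_iff)

lemma poly_mapping_additive_induct [case_names zero single add]:
  fixes f :: "'k \<Rightarrow>\<^sub>0 'v::comm_monoid_add"
  assumes "P 0" "\<And>u a. P (Poly_Mapping.single u a)" "\<And>f g. P f \<Longrightarrow> P g \<Longrightarrow> P (f + g)"
  shows "P f"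
proof -
  have "P (\<Sum>v\<in>S. Poly_Mapping.single v (Poly_Mapping.lookup f v))" if "finite S" for S
    using that by (induction rule: finite_induct) (use assms in auto)
  from this[of "Poly_Mapping.keys f"] show ?thesis by (simp add: sum_single_lookup)
qed

lemma tuple_times_assoc:
  "tuple_times (tuple_times f g) h = tuple_times f (tuple_times g h)"
proof (induction f rule: poly_mapping_additive_induct)
  case (single u a)
  show ?case
  proof (induction g rule: poly_mapping_additive_induct)
    case (single v b)
    show ?case
      by (induction h rule: poly_mapping_additive_induct)
         (simp_all add: tuple_times_add_right map2_times_assoc mult.assoc)
  qed (simp_all add: tuple_times_add_right tuple_times_add_left)
qed (simp_all add: tuple_times_add_left)

lemma cring_tuple_algebra: "cring (tuple_algebra n :: ('a::comm_ring_1 list \<Rightarrow>\<^sub>0 'b::comm_ring_1) ring)"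
proof (rule cringI)
  let ?R = "tuple_algebra n :: ('a list \<Rightarrow>\<^sub>0 'b) ring"
  have closed: "tuple_times f g \<in> carrier ?R" if "f \<in> carrier ?R" "g \<in> carrier ?R" for f g
  proof -
    have "Poly_Mapping.keys (tuple_times f g) \<subseteq>
            (\<Union>u\<in>Poly_Mapping.keys f. \<Union>v\<in>Poly_Mapping.keys g. {map2 (*) u v})"
      unfolding tuple_times_def
      by (intro order_trans[OF keys_sum] UN_mono subset_refl) auto
    with that show ?thesis by (fastforce simp: tuple_algebra_def)
  qed
  have one: "tuple_times (Poly_Mapping.single (replicate n 1) 1) f = f" if "f \<in> carrier ?R" for f
  proof -
    have "map2 (*) (replicate n 1) v = v" if "length v = n" for v :: "'a list"
      using that by (intro nth_equalityI) auto
    then have "tuple_times (Poly_Mapping.single (replicate n 1) 1) f =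
        (\<Sum>v\<in>Poly_Mapping.keys f. Poly_Mapping.single v (Poly_Mapping.lookup f v))"
      using that
      by (subst tuple_times_eq[where U = "{replicate n 1}" and V = "Poly_Mapping.keys f"])
         (auto simp: tuple_algebra_def intro!: sum.cong)
    then show ?thesis by (simp add: sum_single_lookup)
  qed
  show "abelian_group ?R"
  proof (rule abelian_groupI)
    show "\<exists>g\<in>carrier ?R. g \<oplus>\<^bsub>?R\<^esub> f = \<zero>\<^bsub>?R\<^esub>" if "f \<in> carrier ?R" for f
      using that by (intro bexI[of _ "- f"]) (auto simp: tuple_algebra_def)
    show "f \<oplus>\<^bsub>?R\<^esub> g \<in> carrier ?R" if "f \<in> carrier ?R" "g \<in> carrier ?R" for f g
      using that Poly_Mapping.keys_add[of f g] by (auto simp: tuple_algebra_def)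
  qed (simp_all add: tuple_algebra_def ac_simps)
  show "Group.comm_monoid ?R"
  proof (rule Group.comm_monoidI)
    show "f \<otimes>\<^bsub>?R\<^esub> g \<in> carrier ?R" if "f \<in> carrier ?R" "g \<in> carrier ?R" for f g
      using closed[OF that] by (simp add: tuple_algebra_def)
    show "\<one>\<^bsub>?R\<^esub> \<in> carrier ?R"
      by (simp add: tuple_algebra_def)
    show "\<one>\<^bsub>?R\<^esub> \<otimes>\<^bsub>?R\<^esub> f = f" if "f \<in> carrier ?R" for f
      using one[OF that] by (simp add: tuple_algebra_def)
    show "f \<otimes>\<^bsub>?R\<^esub> g \<otimes>\<^bsub>?R\<^esub> h = f \<otimes>\<^bsub>?R\<^esub> (g \<otimes>\<^bsub>?R\<^esub> h)" for f g h
      by (simp add: tuple_algebra_def tuple_times_assoc)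
    show "f \<otimes>\<^bsub>?R\<^esub> g = g \<otimes>\<^bsub>?R\<^esub> f" for f g
      by (simp add: tuple_algebra_def tuple_times_commute[of f g])
  qed
  show "(x \<oplus>\<^bsub>?R\<^esub> y) \<otimes>\<^bsub>?R\<^esub> z = x \<otimes>\<^bsub>?R\<^esub> z \<oplus>\<^bsub>?R\<^esub> y \<otimes>\<^bsub>?R\<^esub> z" for x y z
    by (simp add: tuple_algebra_def tuple_times_add_left)
qed

lemma tensor_relations_carrier:
  fixes \<phi> :: "'b::comm_ring_1 \<Rightarrow> 'a::comm_ring_1"
  shows "tensor_relations \<phi> n \<subseteq> carrier (tuple_algebra n)"
proof -
  have "Poly_Mapping.single u a \<in> carrier (tuple_algebra n)" if "length u = n"
    for u :: "'a list" and a :: 'b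
    using that by (auto simp: tuple_algebra_def)
  moreover have "f - g \<in> carrier (tuple_algebra n)"
    if "f \<in> carrier (tuple_algebra n)" "g \<in> carrier (tuple_algebra n)" for f g :: "'a list \<Rightarrow>\<^sub>0 'b"
    using that keys_diff[of f g] by (auto simp: tuple_algebra_def)
  ultimately show ?thesis
    unfolding tensor_relations_def by auto
qed

lemma ideal_tensor_ideal: "ideal (tensor_ideal \<phi> n) (tuple_algebra n)"
  unfolding tensor_ideal_def
  by (intro ring.genideal_ideal cring.axioms cring_tuple_algebra tensor_relations_carrier)

lemma cring_tensor_power: "cring (tensor_power \<phi> n)"
  unfolding tensor_power_def
  by (intro ideal.quotient_is_cring ideal_tensor_ideal cring_tuple_algebra)

lemma tensor_coset_closed:
  "f \<in> carrier (tuple_algebra n) \<Longrightarrow>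
     tensor_ideal \<phi> n +>\<^bsub>tuple_algebra n\<^esub> f \<in> carrier (tensor_power \<phi> n)"
  using ideal.rcos_ring_hom[OF ideal_tensor_ideal[of \<phi> n]]
  by (auto simp: tensor_power_def dest: ring_hom_closed)

lemma tensor_scalar_closed: "tensor_scalar \<phi> n b \<in> carrier (tensor_power \<phi> n)"
  unfolding tensor_scalar_def by (rule tensor_coset_closed) (auto simp: tuple_algebra_def)

lemma tensor_embed_closed: "tensor_embed \<phi> n i a \<in> carrier (tensor_power \<phi> n)"
  unfolding tensor_embed_def pure_tensor_def
  by (rule tensor_coset_closed) (auto simp: tuple_algebra_def)

lemma ideal_Sn_ideal: "ideal (Sn_ideal \<phi> n) (tensor_power \<phi> n)"
proof -
  interpret P: cring "tensor_power \<phi> n" by (rule cring_tensor_power)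
  have "tensor_esym \<phi> n j a \<in> carrier (tensor_power \<phi> n)" for j a
    unfolding tensor_esym_def
    by (intro P.finsum_closed funcsetI P.finprod_closed) (auto simp: tensor_embed_closed)
  then show ?thesis
    unfolding Sn_ideal_def by (intro P.genideal_ideal) (auto simp: tensor_scalar_closed)
qed

lemma cring_Sn_closure: "cring (Sn_closure \<phi> n)"
  unfolding Sn_closure_def
  by (intro ideal.quotient_is_cring ideal_Sn_ideal cring_tensor_power)

end

theory Submission
  imports Defs "HOL-Library.Function_Algebras"
begin

text \<open>
  Let \<open>\<chi> = \<psi> \<circ> \<phi>\<close>, and let \<open>Q\<close> be the \<open>S\<^sub>n\<close>-closure. The proof compares the dimension of \<open>Q\<close> with
  its number of points in the Galois closure.

  The dimension of \<open>Q\<close> is at most \<open>n!\<close>. Indeed, by the primitive element theorem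
  (\<open>primitive_element\<close>), \<open>A\<close> is generated by one element \<open>\<theta>\<close>. In \<open>Q\<close> the conjugates \<open>\<theta>\<^sub>i = 1 \<otimes> \<dots> \<otimes> \<theta> \<otimes> \<dots> \<otimes> 1\<close> generate, and the defining
  relations for \<open>a = \<theta>\<close> say that \<open>\<Prod> (Y - \<theta>\<^sub>i)\<close> has coefficients in \<open>B\<close>. Hence \<open>\<theta>\<^sub>k\<close> is a root of a
  monic polynomial of degree \<open>n - k\<close> over \<open>B[\<theta>\<^sub>0, \<dots>, \<theta>\<^sub>k\<^sub>-\<^sub>1]\<close>, and \<open>n!\<close> elements span \<open>Q\<close>
  (\<open>splitting_algebra_span\<close>, \<open>Sn_closure_span\<close>).

  There are \<open>n!\<close> points. The minimal polynomial of \<open>\<theta>\<close> has \<open>n\<close> distinct roots in the Galois closure, which gives \<open>n\<close>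
  embeddings \<open>\<sigma>\<^sub>i\<close> of \<open>A\<close> (\<open>conjugate_embeddings\<close>), and \<open>P\<^sub>a\<close> is \<open>\<Prod> (Y - \<sigma>\<^sub>i a)\<close>
  (\<open>char_poly_mult_matrix\<close>). So each permutation \<open>\<pi>\<close> yields a homomorphism from \<open>Q\<close> that sends
  \<open>a\<^sub>0 \<otimes> \<dots> \<otimes> a\<^sub>n\<^sub>-\<^sub>1\<close> to \<open>\<Prod> \<sigma>\<^bsub>\<pi> i\<^esub> a\<^sub>i\<close>. These \<open>n!\<close> homomorphisms are distinct.

  An algebra that is spanned by as many elements as it has points over a field is rigid: the matrix of
  values of the spanning elements at the points is invertible. This is the content of the locale
  \<open>separated_algebra\<close>, and it is used three times. For \<open>Q\<close> it shows that the points have zero joint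
  kernel. For \<open>A\<close> it diagonalizes multiplication by \<open>a\<close>. For the algebra generated by independent
  roots of several separable polynomials it gives the primitive element.

  All points have the same image \<open>E\<close>. For \<open>y \<in> Q\<close>, the characteristic polynomial of
  multiplication by \<open>y\<close> has coefficients in \<open>B\<close> and as roots the values of \<open>y\<close> at the points, all of
  which lie in \<open>E\<close>. Therefore \<open>E\<close> is normal over \<open>B\<close>; as it contains \<open>A\<close>, minimality of the Galois
  closure makes it the whole field (\<open>closure_field_galois\<close>). Choose one point for each kernel, \<open>r\<close> in
  total. Distinct kernels are distinct maximal ideals, so the Chinese remainder theorem maps \<open>Q\<close> onto
  the \<open>r\<close>-th power of the Galois closure, with kernel zero since every kernel is represented. Comparing
  dimensions gives \<open>n! = r * d\<close>, where \<open>d\<close> is the degree of the Galois closure.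
\<close>

section \<open>Subalgebras and spanning sets modulo an ideal\<close>

text \<open>
  The quotients of interest depend on parameters, so they are no types. Computations in a quotient are
  carried out in a ring that is a type, modulo an ideal \<open>K\<close>.
\<close>

definition ring_ideal :: "'r::comm_ring_1 set \<Rightarrow> bool" where
  "ring_ideal K \<longleftrightarrow> 0 \<in> K \<and> (\<forall>x\<in>K. \<forall>y\<in>K. x + y \<in> K) \<and> (\<forall>x. \<forall>y\<in>K. x * y \<in> K)"

definition is_subalgebra :: "('b::comm_ring_1 \<Rightarrow> 'r::comm_ring_1) \<Rightarrow> 'r set \<Rightarrow> bool" where
  "is_subalgebra \<iota> S \<longleftrightarrow> range \<iota> \<subseteq> S \<and> (\<forall>x\<in>S. \<forall>y\<in>S. x + y \<in> S) \<and> (\<forall>x\<in>S. \<forall>y\<in>S. x * y \<in> S)"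

definition spanned_mod ::
    "('b::comm_ring_1 \<Rightarrow> 'r::comm_ring_1) \<Rightarrow> 'r set \<Rightarrow> nat \<Rightarrow> (nat \<Rightarrow> 'r) \<Rightarrow> 'r set \<Rightarrow> bool" where
  "spanned_mod \<iota> K N m S \<longleftrightarrow>
     (\<forall>i<N. m i \<in> S) \<and> (\<forall>y\<in>S. \<exists>b. y - (\<Sum>i<N. \<iota> (b i) * m i) \<in> K)"

lemma ring_idealD:
  assumes "ring_ideal K"
  shows "0 \<in> K" "x \<in> K \<Longrightarrow> y \<in> K \<Longrightarrow> x + y \<in> K" "y \<in> K \<Longrightarrow> z * y \<in> K"
    "x \<in> K \<Longrightarrow> - x \<in> K" "x \<in> K \<Longrightarrow> y \<in> K \<Longrightarrow> x - y \<in> K"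
proof -
  show *: "0 \<in> K" "x \<in> K \<Longrightarrow> y \<in> K \<Longrightarrow> x + y \<in> K" "y \<in> K \<Longrightarrow> z * y \<in> K" for x y z
    using assms by (auto simp: ring_ideal_def)
  show **: "- x \<in> K" if "x \<in> K" for x using *(3)[OF that, of "-1"] by simp
  show "x \<in> K \<Longrightarrow> y \<in> K \<Longrightarrow> x - y \<in> K" using *(2)[of x "- y"] **[of y] by simp
qed

lemma ring_ideal_sum: "ring_ideal K \<Longrightarrow> (\<And>i. i \<in> I \<Longrightarrow> f i \<in> K) \<Longrightarrow> sum f I \<in> K"
  by (induction I rule: infinite_finite_induct) (auto simp: ring_idealD)

lemma ring_ideal_cong_mult:
  assumes "ring_ideal K" "x - x' \<in> K" "y - y' \<in> K"
  shows "x * y - x' * y' \<in> K"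
proof -
  have "x * y - x' * y' = y * (x - x') + x' * (y - y')" by (simp add: algebra_simps)
  then show ?thesis using assms by (simp add: ring_idealD)
qed

lemma ring_ideal_cong_sum:
  assumes "ring_ideal K" "\<And>i. i \<in> I \<Longrightarrow> f i - g i \<in> K"
  shows "sum f I - sum g I \<in> K"
  using ring_ideal_sum[OF assms(1), of I "\<lambda>i. f i - g i"] assms(2) by (simp add: sum_subtractf)

context
  fixes \<iota> :: "'b::comm_ring_1 \<Rightarrow> 'r::comm_ring_1" and S :: "'r set"
  assumes hom: "comm_ring_hom \<iota>" and S: "is_subalgebra \<iota> S"
begin

interpretation comm_ring_hom \<iota> by (fact hom)

lemma subalgebraD:
  shows "\<iota> b \<in> S" "x \<in> S \<Longrightarrow> y \<in> S \<Longrightarrow> x + y \<in> S" "x \<in> S \<Longrightarrow> y \<in> S \<Longrightarrow> x * y \<in> S"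
    "0 \<in> S" "1 \<in> S" "x \<in> S \<Longrightarrow> - x \<in> S" "x \<in> S \<Longrightarrow> y \<in> S \<Longrightarrow> x - y \<in> S"
proof -
  show *: "\<iota> b \<in> S" "x \<in> S \<Longrightarrow> y \<in> S \<Longrightarrow> x + y \<in> S" "x \<in> S \<Longrightarrow> y \<in> S \<Longrightarrow> x * y \<in> S" for b x y
    using S by (auto simp: is_subalgebra_def)
  show "0 \<in> S" "1 \<in> S" using *(1)[of 0] *(1)[of 1] by simp_all
  show **: "- x \<in> S" if "x \<in> S" for x
    using *(3)[OF *(1)[of "-1"] that] by (simp add: hom_distribs)
  show "x \<in> S \<Longrightarrow> y \<in> S \<Longrightarrow> x - y \<in> S" using *(2)[of x "- y"] **[of y] by simp
qed

lemma subalgebra_sum: "(\<And>i. i \<in> I \<Longrightarrow> f i \<in> S) \<Longrightarrow> sum f I \<in> S"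
  by (induction I rule: infinite_finite_induct) (auto simp: subalgebraD)

lemma subalgebra_prod: "(\<And>i. i \<in> I \<Longrightarrow> f i \<in> S) \<Longrightarrow> prod f I \<in> S"
  by (induction I rule: infinite_finite_induct) (auto simp: subalgebraD)

lemma subalgebra_power: "x \<in> S \<Longrightarrow> x ^ k \<in> S"
  by (induction k) (auto simp: subalgebraD)

text \<open>
  The sums \<open>\<Sum>e<d. s e * x ^ e\<close> with coefficients in \<open>S\<close> are closed under multiplication by \<open>x\<close>,
  because the monic relation rewrites \<open>x ^ d\<close>. Hence they form a subalgebra; its spanning set consists
  of the old one multiplied by the powers \<open>x ^ e\<close> with \<open>e < d\<close>.
\<close>

lemma adjoin_root:
  fixes a :: "'r poly"
  assumes K: "ring_ideal K" "K \<subseteq> S" and span: "spanned_mod \<iota> K N m S"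
    and a: "lead_coeff a = 1" "\<And>i. coeff a i \<in> S" "poly a x \<in> K" "degree a > 0"
  shows "\<exists>S' m'. is_subalgebra \<iota> S' \<and> S \<subseteq> S' \<and> x \<in> S' \<and> spanned_mod \<iota> K (N * degree a) m' S'"
proof -
  define d where "d = degree a"
  have d: "d > 0" using a(4) by (simp add: d_def)
  define S' where "S' = {\<Sum>e<d. s e * x ^ e | s. \<forall>e. s e \<in> S}"
  have S'I: "(\<Sum>e<d. s e * x ^ e) \<in> S'" if "\<And>e. s e \<in> S" for s
    using that unfolding S'_def by blast
  have add: "u + v \<in> S'" if u: "u \<in> S'" and v: "v \<in> S'" for u v
  proof -
    from u obtain s where s: "u = (\<Sum>e<d. s e * x ^ e)" "\<forall>e. s e \<in> S" unfolding S'_def by blast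
    from v obtain t where t: "v = (\<Sum>e<d. t e * x ^ e)" "\<forall>e. t e \<in> S" unfolding S'_def by blast
    have "u + v = (\<Sum>e<d. (s e + t e) * x ^ e)" using s t by (simp add: sum.distrib distrib_right)
    also have "\<dots> \<in> S'" using s t by (intro S'I) (auto simp: subalgebraD)
    finally show ?thesis .
  qed
  have smul: "c * u \<in> S'" if c: "c \<in> S" and u: "u \<in> S'" for c u
  proof -
    from u obtain s where s: "u = (\<Sum>e<d. s e * x ^ e)" "\<forall>e. s e \<in> S" unfolding S'_def by blast
    have "c * u = (\<Sum>e<d. (c * s e) * x ^ e)" using s by (simp add: sum_distrib_left mult.assoc)
    also have "\<dots> \<in> S'" using s c by (intro S'I) (auto simp: subalgebraD)
    finally show ?thesis .
  qed
  have S_S': "c \<in> S'" if "c \<in> S" for c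
  proof -
    have "(\<Sum>e<d. (if e = 0 then c else 0) * x ^ e) = (\<Sum>e<d. if e = 0 then c else 0)"
      by (intro sum.cong) auto
    also have "\<dots> = c" using d by simp
    finally show ?thesis using S'I[of "\<lambda>e. if e = 0 then c else 0"] that
      by (auto simp: subalgebraD)
  qed
  have sumS': "(\<And>i. i \<in> I \<Longrightarrow> f i \<in> S') \<Longrightarrow> sum f I \<in> S'" for I and f :: "nat \<Rightarrow> 'r"
    by (induction I rule: infinite_finite_induct) (auto simp: add S_S' subalgebraD)
  have mulx: "x * u \<in> S'" if u: "u \<in> S'" for u
  proof -
    from u obtain s where s: "u = (\<Sum>e<d. s e * x ^ e)" "\<forall>e. s e \<in> S" unfolding S'_def by blast
    obtain d' where d': "d = Suc d'" using d by (cases d) auto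
    have "poly a x = (\<Sum>e<d. coeff a e * x ^ e) + x ^ d"
      using a(1) by (simp add: poly_altdef d_def lessThan_Suc_atMost[symmetric])
    then have xd: "x ^ d = poly a x - (\<Sum>e<d. coeff a e * x ^ e)" by simp
    have "x * u = (\<Sum>e<d. s e * x ^ Suc e)"
      using s by (simp add: sum_distrib_left ac_simps)
    also have "\<dots> = (\<Sum>e<d'. s e * x ^ Suc e) + s d' * x ^ d"
      by (simp add: d')
    also have "(\<Sum>e<d'. s e * x ^ Suc e) = (\<Sum>e<d. (if e = 0 then 0 else s (e - 1)) * x ^ e)"
      by (simp add: d' sum.lessThan_Suc_shift del: sum.lessThan_Suc)
    finally have "x * u = (\<Sum>e<d. (if e = 0 then 0 else s (e - 1)) * x ^ e)
        + (- s d') * (\<Sum>e<d. coeff a e * x ^ e) + s d' * poly a x"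
      by (simp add: xd algebra_simps)
    moreover have "\<dots> \<in> S'"
    proof (intro add smul)
      show "(\<Sum>e<d. (if e = 0 then 0 else s (e - 1)) * x ^ e) \<in> S'"
        using s by (intro S'I) (auto simp: subalgebraD)
      show "(\<Sum>e<d. coeff a e * x ^ e) \<in> S'" using a by (intro S'I) auto
      show "- s d' \<in> S" "s d' \<in> S" using s by (auto simp: subalgebraD)
      show "poly a x \<in> S'" using S_S' a(3) K(2) by auto
    qed
    ultimately show ?thesis by simp
  qed
  have mulxp: "x ^ k * u \<in> S'" if "u \<in> S'" for k u
    using that by (induction k) (auto simp: mult.assoc intro: mulx)
  have mul: "u * v \<in> S'" if u: "u \<in> S'" and v: "v \<in> S'" for u v
  proof -
    from u obtain s where s: "u = (\<Sum>e<d. s e * x ^ e)" "\<forall>e. s e \<in> S" unfolding S'_def by blast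
    have "u * v = (\<Sum>e<d. s e * (x ^ e * v))" using s by (simp add: sum_distrib_right mult.assoc)
    also have "\<dots> \<in> S'" using s v by (intro sumS' smul mulxp) auto
    finally show ?thesis .
  qed
  have xS': "x \<in> S'" using mulx[OF S_S'[OF subalgebraD(5)]] by simp
  \<comment> \<open>the pair \<open>(i mod N, i div N)\<close> runs through \<open>{..<N} \<times> {..<d}\<close>\<close>
  define m' where "m' = (\<lambda>i. m (i mod N) * x ^ (i div N))"
  have "spanned_mod \<iota> K (N * d) m' S'"
    unfolding spanned_mod_def
  proof (intro conjI allI impI ballI)
    fix i assume "i < N * d"
    then have "i mod N < N" by (cases "N = 0") auto
    then have "m (i mod N) \<in> S" using span by (auto simp: spanned_mod_def)
    then show "m' i \<in> S'" unfolding m'_def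
      using mul[OF S_S' mulxp[OF S_S'[OF subalgebraD(5)]]] by simp
  next
    fix y assume "y \<in> S'"
    then obtain s where s: "y = (\<Sum>e<d. s e * x ^ e)" "\<forall>e. s e \<in> S" unfolding S'_def by blast
    have "\<forall>e. \<exists>b. s e - (\<Sum>i<N. \<iota> (b i) * m i) \<in> K" using s span by (auto simp: spanned_mod_def)
    then obtain b where b: "\<And>e. s e - (\<Sum>i<N. \<iota> (b e i) * m i) \<in> K" by metis
    have "(\<Sum>i<N * d. \<iota> (b (i div N) (i mod N)) * m' i)
        = (\<Sum>e<d. \<Sum>i<N. \<iota> (b e i) * m i * x ^ e)"
    proof (cases "N = 0")
      case False
      have "(\<Sum>i<N * d. \<iota> (b (i div N) (i mod N)) * m' i)
        = (\<Sum>(e,i)\<in>{..<d} \<times> {..<N}. \<iota> (b e i) * m i * x ^ e)"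
      proof (rule sum.reindex_bij_witness[of _ "\<lambda>(e,i). i + N * e" "\<lambda>j. (j div N, j mod N)"])
        fix p assume "p \<in> {..<d} \<times> {..<N}"
        then obtain e i where p: "p = (e, i)" "e < d" "i < N" by auto
        have "i + N * e < N * Suc e" using p by simp
        also have "\<dots> \<le> N * d" using p by (intro mult_le_mono2) simp
        finally show "(case p of (e, i) \<Rightarrow> i + N * e) \<in> {..<N * d}" using p by simp
        show "(case case p of (e, i) \<Rightarrow> i + N * e of j \<Rightarrow> (j div N, j mod N)) = p" using p by simp
      qed (use False in \<open>auto simp: m'_def less_mult_imp_div_less mult.commute mult.assoc\<close>)
      then show ?thesis by (simp add: sum.cartesian_product)
    qed simp
    then have "y - (\<Sum>i<N * d. \<iota> (b (i div N) (i mod N)) * m' i)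
        = (\<Sum>e<d. s e * x ^ e) - (\<Sum>e<d. (\<Sum>i<N. \<iota> (b e i) * m i) * x ^ e)"
      using s by (simp add: sum_distrib_right)
    also have "\<dots> \<in> K"
      using ring_ideal_cong_mult[OF K(1) b] K(1)
      by (intro ring_ideal_cong_sum) (auto simp: ring_idealD)
    finally show "\<exists>b. y - (\<Sum>i<N * d. \<iota> (b i) * m' i) \<in> K"
      by (intro exI[of _ "\<lambda>i. b (i div N) (i mod N)"])
  qed
  moreover have "is_subalgebra \<iota> S'"
    using add mul S_S' subalgebraD(1) by (auto simp: is_subalgebra_def)
  ultimately show ?thesis using S_S' xS' by (auto simp: d_def)
qed

end

lemma subalgebra_base:
  assumes "comm_ring_hom \<iota>" "ring_ideal K"
  shows "\<exists>S. is_subalgebra \<iota> S \<and> K \<subseteq> S \<and> spanned_mod \<iota> K 1 (\<lambda>_. 1) S \<and> S = {\<iota> b + k |b k. k \<in> K}"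
proof -
  interpret comm_ring_hom \<iota> by fact
  let ?S = "{\<iota> b + k |b k. k \<in> K}"
  have "is_subalgebra \<iota> ?S"
    unfolding is_subalgebra_def
  proof (intro conjI ballI)
    show "range \<iota> \<subseteq> ?S" using ring_idealD(1)[OF assms(2)] by force
  next
    fix x y assume "x \<in> ?S" "y \<in> ?S"
    then obtain b k c l where *: "x = \<iota> b + k" "y = \<iota> c + l" "k \<in> K" "l \<in> K" by auto
    have "x + y = \<iota> (b + c) + (k + l)" using * by (simp add: hom_distribs)
    then show "x + y \<in> ?S" using * assms(2) ring_idealD(2) by blast
    have "x * y = \<iota> (b * c) + (\<iota> b * l + y * k)" using * by (simp add: hom_distribs algebra_simps)
    then show "x * y \<in> ?S" using * assms(2) ring_idealD(2,3) by blast
  qed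
  moreover have "K \<subseteq> ?S" using hom_zero by (metis (mono_tags, lifting) add_0 mem_Collect_eq subsetI)
  moreover have "1 \<in> ?S" using ring_idealD(1)[OF assms(2)] hom_one
    by (metis (mono_tags, lifting) add.right_neutral mem_Collect_eq)
  moreover have sp: "\<exists>c. y - \<iota> c \<in> K" if "y \<in> ?S" for y
  proof -
    from that obtain b k where "y = \<iota> b + k" "k \<in> K" by blast
    then have "y - \<iota> b \<in> K" by simp
    then show ?thesis by blast
  qed
  ultimately have "spanned_mod \<iota> K 1 (\<lambda>_. 1) ?S"
    unfolding spanned_mod_def
  proof (intro conjI ballI)
    fix y assume "y \<in> ?S"
    then obtain c where "y - \<iota> c \<in> K" using sp by blast
    then show "\<exists>b. y - (\<Sum>i<1::nat. \<iota> (b i) * 1) \<in> K" by (intro exI[of _ "\<lambda>_. c"]) simp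
  qed simp
  then show ?thesis using \<open>is_subalgebra \<iota> ?S\<close> \<open>K \<subseteq> ?S\<close> by blast
qed

section \<open>Algebras with as many points as generators\<close>

text \<open>
  The Chinese remainder theorem for functions: for each pair of points some function separates them in
  the sense of vanishing at exactly one of them; dividing by its value there, and passing to
  \<open>1 - f\<close> if necessary, gives a function with values \<open>1\<close> at \<open>p\<close> and \<open>0\<close> at \<open>q\<close>. The product over all
  \<open>q\<close> is the indicator of \<open>p\<close>.
\<close>

lemma separating_deltas:
  fixes W :: "('p \<Rightarrow> 'c::field) set"
  assumes fin: "finite \<Omega>" and p: "p \<in> \<Omega>"
    and one: "(\<lambda>_. 1) \<in> W"
    and diff: "\<And>f g. f \<in> W \<Longrightarrow> g \<in> W \<Longrightarrow> (\<lambda>p. f p - g p) \<in> W"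
    and mult: "\<And>f g. f \<in> W \<Longrightarrow> g \<in> W \<Longrightarrow> (\<lambda>p. f p * g p) \<in> W"
    and inv: "\<And>f p. f \<in> W \<Longrightarrow> p \<in> \<Omega> \<Longrightarrow> f p \<noteq> 0 \<Longrightarrow> \<exists>g\<in>W. g p * f p = 1"
    and sep: "\<And>p q. p \<in> \<Omega> \<Longrightarrow> q \<in> \<Omega> \<Longrightarrow> p \<noteq> q \<Longrightarrow> \<exists>f\<in>W. (f p = 0) \<noteq> (f q = 0)"
  shows "\<exists>f\<in>W. f p = 1 \<and> (\<forall>q\<in>\<Omega> - {p}. f q = 0)"
proof -
  have pair: "\<exists>f\<in>W. f p = 1 \<and> f q = 0" if q: "q \<in> \<Omega>" "q \<noteq> p" for q
  proof -
    obtain f where f: "f \<in> W" "(f p = 0) \<noteq> (f q = 0)" using sep[OF p q(1)] q by metis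
    show ?thesis
    proof (cases "f p = 0")
      case True
      then obtain g where g: "g \<in> W" "g q * f q = 1" using inv[OF f(1) q(1)] f by auto
      have "(\<lambda>x. 1 - g x * f x) \<in> W" by (intro diff[OF one] mult f g)
      then show ?thesis using True g by (intro bexI[of _ "\<lambda>x. 1 - g x * f x"]) auto
    next
      case False
      then obtain g where g: "g \<in> W" "g p * f p = 1" using inv[OF f(1) p] by auto
      have "(\<lambda>x. g x * f x) \<in> W" by (intro mult f g)
      then show ?thesis using False f g by (intro bexI[of _ "\<lambda>x. g x * f x"]) auto
    qed
  qed
  have "\<exists>f\<in>W. f p = 1 \<and> (\<forall>q\<in>Q. f q = 0)" if "finite Q" "Q \<subseteq> \<Omega> - {p}" for Q
    using that
  proof (induction Q rule: finite_induct)
    case empty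
    then show ?case using one by (intro bexI[of _ "\<lambda>_. 1"]) auto
  next
    case (insert q Q)
    then obtain f where f: "f \<in> W" "f p = 1" "\<forall>q\<in>Q. f q = 0" by auto
    obtain g where g: "g \<in> W" "g p = 1" "g q = 0" using pair[of q] insert by auto
    have "(\<lambda>x. f x * g x) \<in> W" by (intro mult f g)
    then show ?case using f g by (intro bexI[of _ "\<lambda>x. f x * g x"]) auto
  qed
  then show ?thesis using fin by simp
qed

text \<open>
  The points are homomorphisms to the field \<open>'c\<close>, indexed by \<open>\<Omega>\<close>, that vanish on \<open>K\<close> and separate \<open>S\<close>.
  The assumption that gives the locale its strength is \<open>span\<close>: \<open>S\<close> modulo \<open>K\<close> is spanned by as many
  elements as there are points.
\<close>

locale separated_algebra =
  base: field_hom \<chi> + struct: comm_ring_hom \<iota>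
  for \<chi> :: "'b::field \<Rightarrow> 'c::field" and \<iota> :: "'b \<Rightarrow> 'r::comm_ring_1" +
  fixes K S :: "'r set" and \<Omega> :: "'p set" and ev :: "'p \<Rightarrow> 'r \<Rightarrow> 'c" and m :: "nat \<Rightarrow> 'r"
  assumes fin: "finite \<Omega>" and S: "is_subalgebra \<iota> S"
    and ev_hom: "p \<in> \<Omega> \<Longrightarrow> comm_ring_hom (ev p)"
    and ev_struct: "p \<in> \<Omega> \<Longrightarrow> ev p (\<iota> b) = \<chi> b"
    and ev_K: "p \<in> \<Omega> \<Longrightarrow> k \<in> K \<Longrightarrow> ev p k = 0"
    and sep: "p \<in> \<Omega> \<Longrightarrow> q \<in> \<Omega> \<Longrightarrow> p \<noteq> q \<Longrightarrow> \<exists>y\<in>S. ev p y \<noteq> ev q y"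
    and span: "spanned_mod \<iota> K (card \<Omega>) m S"
begin

abbreviation N where "N \<equiv> card \<Omega>"

lemmas S_closed = subalgebraD[OF struct.comm_ring_hom_axioms S]

lemma m_in_S: "i < N \<Longrightarrow> m i \<in> S"
  using span by (auto simp: spanned_mod_def)

lemma ev_arith:
  assumes "p \<in> \<Omega>"
  shows "ev p 0 = 0" "ev p 1 = 1" "ev p (x + y) = ev p x + ev p y" "ev p (x * y) = ev p x * ev p y"
    "ev p (x - y) = ev p x - ev p y" "ev p (x ^ k) = ev p x ^ k"
    "ev p (sum f I) = (\<Sum>i\<in>I. ev p (f i))" "ev p (prod f I) = (\<Prod>i\<in>I. ev p (f i))"
proof -
  interpret comm_ring_hom "ev p" using ev_hom[OF assms] .
  show "ev p 0 = 0" "ev p 1 = 1" "ev p (x + y) = ev p x + ev p y" "ev p (x * y) = ev p x * ev p y"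
    "ev p (x - y) = ev p x - ev p y" "ev p (x ^ k) = ev p x ^ k"
    "ev p (sum f I) = (\<Sum>i\<in>I. ev p (f i))" "ev p (prod f I) = (\<Prod>i\<in>I. ev p (f i))"
    by (simp_all add: hom_distribs)
qed

lemma ev_coords:
  assumes "y - (\<Sum>i<N. \<iota> (b i) * m i) \<in> K" "p \<in> \<Omega>"
  shows "ev p y = (\<Sum>i<N. \<chi> (b i) * ev p (m i))"
  using ev_K[OF assms(2,1)] assms(2) by (simp add: ev_arith ev_struct)

lemma coords: "y \<in> S \<Longrightarrow> \<exists>b. y - (\<Sum>i<N. \<iota> (b i) * m i) \<in> K"
  using span by (auto simp: spanned_mod_def)

text \<open>
  The functions on \<open>\<Omega>\<close> that are combinations over \<open>'c\<close> of the values of the \<open>m i\<close> form an algebra that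
  separates points and contains the constants; so all indicator functions are among them. This is
  Dedekind's independence of characters in dual form.
\<close>

lemma delta_combination:
  assumes "p \<in> \<Omega>"
  shows "\<exists>c. \<forall>q\<in>\<Omega>. (\<Sum>i<N. c i * ev q (m i)) = (if q = p then 1 else 0)"
proof -
  define W where "W = {f. \<exists>c. \<forall>p\<in>\<Omega>. f p = (\<Sum>i<N. c i * ev p (m i))}"
  have Wadd: "(\<lambda>p. f p + g p) \<in> W" if fg: "f \<in> W" "g \<in> W" for f g
  proof -
    from fg obtain c d where "\<forall>p\<in>\<Omega>. f p = (\<Sum>i<N. c i * ev p (m i))"
      "\<forall>p\<in>\<Omega>. g p = (\<Sum>i<N. d i * ev p (m i))" unfolding W_def by blast
    then have "\<forall>p\<in>\<Omega>. f p + g p = (\<Sum>i<N. (c i + d i) * ev p (m i))"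
      by (simp add: sum.distrib distrib_right)
    then show ?thesis unfolding W_def by (intro CollectI exI)
  qed
  have Wsmult: "(\<lambda>p. a * f p) \<in> W" if f: "f \<in> W" for a f
  proof -
    from f obtain c where "\<forall>p\<in>\<Omega>. f p = (\<Sum>i<N. c i * ev p (m i))" unfolding W_def by blast
    then have "\<forall>p\<in>\<Omega>. a * f p = (\<Sum>i<N. (a * c i) * ev p (m i))"
      by (simp add: sum_distrib_left mult.assoc)
    then show ?thesis unfolding W_def by (intro CollectI exI)
  qed
  have Wev: "(\<lambda>p. ev p y) \<in> W" if y: "y \<in> S" for y
  proof -
    from coords[OF y] obtain b where b: "y - (\<Sum>i<N. \<iota> (b i) * m i) \<in> K" ..
    then have "\<forall>p\<in>\<Omega>. ev p y = (\<Sum>i<N. \<chi> (b i) * ev p (m i))" using ev_coords by blast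
    then show ?thesis unfolding W_def by (intro CollectI exI)
  qed
  have Wcong: "f \<in> W \<longleftrightarrow> g \<in> W" if "\<forall>p\<in>\<Omega>. f p = g p" for f g using that by (auto simp: W_def)
  have Wsum: "(\<lambda>p. \<Sum>i<k. f i p) \<in> W" if "\<And>i. i < k \<Longrightarrow> f i \<in> W" for f and k :: nat
    using that
  proof (induction k)
    case 0
    show ?case using Wsmult[OF Wev[OF S_closed(4)], of 0] by simp
  next
    case (Suc k)
    then show ?case by (auto intro!: Wadd)
  qed
  have Wmult: "(\<lambda>p. f p * g p) \<in> W" if fg: "f \<in> W" "g \<in> W" for f g
  proof -
    have 1: "(\<lambda>p. ev p y * g p) \<in> W" if y: "y \<in> S" for y
    proof -
      from fg obtain d where d: "\<forall>p\<in>\<Omega>. g p = (\<Sum>i<N. d i * ev p (m i))" unfolding W_def by blast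
      have "(\<lambda>p. \<Sum>i<N. d i * ev p (y * m i)) \<in> W"
        by (intro Wsum Wsmult Wev S_closed m_in_S y)
      then show ?thesis using d
        by (subst Wcong) (auto simp: ev_arith sum_distrib_left ac_simps)
    qed
    from fg obtain c where c: "\<forall>p\<in>\<Omega>. f p = (\<Sum>i<N. c i * ev p (m i))" unfolding W_def by blast
    have "(\<lambda>p. \<Sum>i<N. c i * (ev p (m i) * g p)) \<in> W" by (intro Wsum Wsmult 1 m_in_S)
    then show ?thesis using c
      by (subst Wcong) (auto simp: sum_distrib_left sum_distrib_right mult.assoc)
  qed
  have Wone: "(\<lambda>_. 1) \<in> W"
    using Wev[OF S_closed(5)] by (subst Wcong) (auto simp: ev_arith)
  have Wconst: "(\<lambda>_. c) \<in> W" for c using Wsmult[OF Wone, of c] by simp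
  have Wdiff: "(\<lambda>p. f p - g p) \<in> W" if "f \<in> W" "g \<in> W" for f g
    using Wadd[OF that(1) Wsmult[OF that(2), of "-1"]] by simp
  obtain f where f: "f \<in> W" "f p = 1" "\<forall>q\<in>\<Omega> - {p}. f q = 0"
  proof (rule bexE[OF separating_deltas[OF fin assms Wone Wdiff Wmult]])
    show "\<exists>g\<in>W. g p * f p = 1" if "f p \<noteq> 0" for f p
      using that Wconst[of "1 / f p"] by (intro bexI[of _ "\<lambda>_. 1 / f p"]) auto
    show "\<exists>f\<in>W. (f p = 0) \<noteq> (f q = 0)" if pq: "p \<in> \<Omega>" "q \<in> \<Omega>" "p \<noteq> q" for p q
    proof -
      obtain y where "y \<in> S" "ev p y \<noteq> ev q y" using sep[OF pq] by blast
      then show ?thesis using Wdiff[OF Wev[of y] Wconst[of "ev p y"]]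
        by (intro bexI[of _ "\<lambda>x. ev x y - ev p y"]) auto
    qed
  qed auto
  then obtain c where "\<forall>p\<in>\<Omega>. f p = (\<Sum>i<N. c i * ev p (m i))" unfolding W_def by blast
  then show ?thesis using f by (intro exI[of _ c]) auto
qed

definition pt :: "nat \<Rightarrow> 'p" where "pt = (SOME e. bij_betw e {..<N} \<Omega>)"

lemma pt: "bij_betw pt {..<N} \<Omega>"
  unfolding pt_def using ex_bij_betw_nat_finite[OF fin]
  by (intro someI_ex[of "\<lambda>e. bij_betw e {..<N} \<Omega>"]) (simp add: atLeast0LessThan)

lemma pt_in: "i < N \<Longrightarrow> pt i \<in> \<Omega>"
  using pt by (auto simp: bij_betw_def)

lemma pt_inj: "i < N \<Longrightarrow> j < N \<Longrightarrow> pt i = pt j \<longleftrightarrow> i = j"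
  using pt by (auto simp: bij_betw_def inj_on_def)

definition M :: "'c mat" where "M = mat N N (\<lambda>(i, j). ev (pt i) (m j))"

lemma M_carrier: "M \<in> carrier_mat N N" by (simp add: M_def)

text \<open>
  The indicator functions provide a right inverse of the square matrix of values.
\<close>

lemma M_inverse: "\<exists>Y. Y \<in> carrier_mat N N \<and> M * Y = 1\<^sub>m N \<and> Y * M = 1\<^sub>m N"
proof -
  have "\<forall>k. \<exists>c. k < N \<longrightarrow> (\<forall>q\<in>\<Omega>. (\<Sum>i<N. c i * ev q (m i)) = (if q = pt k then 1 else 0))"
    using delta_combination[OF pt_in] by blast
  then obtain c where c: "\<And>k q. k < N \<Longrightarrow> q \<in> \<Omega> \<Longrightarrow>
      (\<Sum>i<N. c k i * ev q (m i)) = (if q = pt k then 1 else 0)" by metis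
  define Y where "Y = mat N N (\<lambda>(i, k). c k i)"
  have Y: "Y \<in> carrier_mat N N" by (simp add: Y_def)
  have "M * Y = 1\<^sub>m N"
    by (rule eq_matI)
       (auto simp: M_def Y_def scalar_prod_def atLeast0LessThan c[OF _ pt_in] pt_inj mult.commute)
  then show ?thesis using mat_mult_left_right_inverse[OF M_carrier Y] Y by auto
qed

lemma m_independent:
  assumes "\<And>p. p \<in> \<Omega> \<Longrightarrow> (\<Sum>i<N. c i * ev p (m i)) = 0" "i < N"
  shows "c i = 0"
proof -
  obtain Y where Y: "Y \<in> carrier_mat N N" "Y * M = 1\<^sub>m N" using M_inverse by blast
  define v where "v = vec N c"
  have v: "v \<in> carrier_vec N" by (simp add: v_def)
  have "M *\<^sub>v v = 0\<^sub>v N"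
    by (rule eq_vecI)
       (auto simp: M_def v_def scalar_prod_def atLeast0LessThan mult.commute assms(1)[OF pt_in])
  then have "Y *\<^sub>v (M *\<^sub>v v) = 0\<^sub>v N" using Y by auto
  moreover have "Y *\<^sub>v (M *\<^sub>v v) = v"
    using assoc_mult_mat_vec[OF Y(1) M_carrier v] Y v by simp
  ultimately have "v = 0\<^sub>v N" by simp
  then have "v $ i = 0" using assms(2) by simp
  then show ?thesis using assms(2) by (simp add: v_def)
qed

text \<open>
  If \<open>y\<close> vanishes at all points, its coordinates over the base field are a relation over \<open>'c\<close> between
  the columns of \<open>M\<close>, and the columns are independent.
\<close>

lemma joint_kernel:
  assumes "y \<in> S" "\<And>p. p \<in> \<Omega> \<Longrightarrow> ev p y = 0"
  shows "y \<in> K"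
proof -
  obtain b where b: "y - (\<Sum>i<N. \<iota> (b i) * m i) \<in> K" using coords[OF assms(1)] by blast
  have "\<chi> (b i) = 0" if "i < N" for i
    using that by (intro m_independent[of "\<lambda>i. \<chi> (b i)"]) (auto simp: ev_coords[OF b, symmetric] assms(2))
  then have "b i = 0" if "i < N" for i using that base.hom_0_iff by blast
  then show ?thesis using b by (simp add: struct.hom_zero)
qed

text \<open>
  The matrix \<open>M\<close> conjugates the matrix of multiplication by \<open>y\<close> to the diagonal matrix of the values
  of \<open>y\<close> at the points.
\<close>

lemma char_poly_eq_prod:
  assumes A: "A \<in> carrier_mat N N"
    and y: "\<And>p j. p \<in> \<Omega> \<Longrightarrow> j < N \<Longrightarrow> ev p y * ev p (m j) = (\<Sum>i<N. \<chi> (A $$ (i, j)) * ev p (m i))"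
  shows "map_poly \<chi> (char_poly A) = (\<Prod>p\<in>\<Omega>. [:- ev p y, 1:])"
proof -
  obtain Y where Y: "Y \<in> carrier_mat N N" "M * Y = 1\<^sub>m N" "Y * M = 1\<^sub>m N" using M_inverse by blast
  define A' where "A' = map_mat \<chi> A"
  have A': "A' \<in> carrier_mat N N" using A by (simp add: A'_def)
  define D where "D = mat N N (\<lambda>(i, j). if i = j then ev (pt i) y else 0)"
  have D: "D \<in> carrier_mat N N" by (simp add: D_def)
  have "M * A' = D * M"
  proof (rule eq_matI)
    fix i j assume "i < dim_row (D * M)" "j < dim_col (D * M)"
    then have ij: "i < N" "j < N" using D M_carrier by auto
    have "(M * A') $$ (i, j) = (\<Sum>k<N. \<chi> (A $$ (k, j)) * ev (pt i) (m k))"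
      using ij A by (simp add: M_def A'_def scalar_prod_def atLeast0LessThan mult.commute)
    also have "\<dots> = ev (pt i) y * ev (pt i) (m j)" using y ij pt_in by simp
    also have "\<dots> = (\<Sum>k<N. if k = i then ev (pt i) y * ev (pt i) (m j) else 0)"
      using ij by simp
    also have "\<dots> = (\<Sum>k<N. (if i = k then ev (pt i) y else 0) * ev (pt k) (m j))"
      by (intro sum.cong) auto
    also have "\<dots> = (D * M) $$ (i, j)"
      using ij by (simp add: M_def D_def scalar_prod_def atLeast0LessThan)
    finally show "(M * A') $$ (i, j) = (D * M) $$ (i, j)" .
  qed (use A' D M_carrier in auto)
  then have "A' = Y * D * M"
    using Y A' D M_carrier
    by (metis assoc_mult_mat left_mult_one_mat)
  then have "similar_mat A' D"
    using Y A' D M_carrier unfolding similar_mat_def similar_mat_wit_def Let_def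
    by (intro exI[of _ Y] exI[of _ M]) auto
  then have "char_poly A' = char_poly D" by (rule char_poly_similar)
  also have "\<dots> = (\<Prod>a\<leftarrow>diag_mat D. [:- a, 1:])"
    using D by (intro char_poly_upper_triangular) (auto simp: D_def upper_triangular_def)
  also have "\<dots> = (\<Prod>i<N. [:- ev (pt i) y, 1:])"
    by (simp add: diag_mat_def D_def prod.list_conv_set_nth atLeast0LessThan)
  also have "\<dots> = (\<Prod>p\<in>\<Omega>. [:- ev p y, 1:])"
    by (rule prod.reindex_bij_betw[OF pt])
  finally show ?thesis using base.char_poly_hom[OF A] by (simp add: A'_def)
qed

lemma ex_poly_eq_prod:
  assumes "y \<in> S"
  shows "\<exists>h. map_poly \<chi> h = (\<Prod>p\<in>\<Omega>. [:- ev p y, 1:])"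
proof -
  have "\<forall>j. \<exists>b. j < N \<longrightarrow> y * m j - (\<Sum>i<N. \<iota> (b i) * m i) \<in> K"
    using coords S_closed(3)[OF assms m_in_S] by blast
  then obtain b where b: "\<And>j. j < N \<Longrightarrow> y * m j - (\<Sum>i<N. \<iota> (b j i) * m i) \<in> K" by metis
  define A where "A = mat N N (\<lambda>(i, j). b j i)"
  have "map_poly \<chi> (char_poly A) = (\<Prod>p\<in>\<Omega>. [:- ev p y, 1:])"
  proof (rule char_poly_eq_prod)
    show "ev p y * ev p (m j) = (\<Sum>i<N. \<chi> (A $$ (i, j)) * ev p (m i))" if "p \<in> \<Omega>" "j < N" for p j
      using ev_coords[OF b[OF that(2)] that(1)] that by (simp add: ev_arith A_def)
  qed (simp add: A_def)
  then show ?thesis by blast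
qed

text \<open>
  If the values of \<open>t\<close> at the points are distinct, its powers have a nonsingular Vandermonde matrix of
  values. As this matrix is \<open>M\<close> times the coordinate matrix \<open>A\<close> of the powers, \<open>A\<close> is invertible over
  the base field already.
\<close>

lemma powers_span:
  assumes t: "t \<in> S" and inj: "inj_on (\<lambda>p. ev p t) \<Omega>" and y: "y \<in> S"
  shows "\<exists>z. y - (\<Sum>k<N. \<iota> (z k) * t ^ k) \<in> K"
proof -
  have tk: "t ^ k \<in> S" for k by (rule subalgebra_power[OF struct.comm_ring_hom_axioms S t])
  have "\<forall>k. \<exists>b. t ^ k - (\<Sum>i<N. \<iota> (b i) * m i) \<in> K" using coords[OF tk] by blast
  then obtain a where a: "\<And>k. t ^ k - (\<Sum>i<N. \<iota> (a k i) * m i) \<in> K" by metis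
  obtain b where b: "y - (\<Sum>i<N. \<iota> (b i) * m i) \<in> K" using coords[OF y] by blast
  define A where "A = mat N N (\<lambda>(i, k). a k i)"
  have A: "A \<in> carrier_mat N N" by (simp add: A_def)
  \<comment> \<open>a kernel vector of \<open>A\<close> would be a polynomial of degree below \<open>N\<close> with \<open>N\<close> roots\<close>
  have "det A \<noteq> 0"
  proof
    assume "det A = 0"
    then obtain v where v: "v \<in> carrier_vec N" "v \<noteq> 0\<^sub>v N" "A *\<^sub>v v = 0\<^sub>v N"
      using det_0_iff_vec_prod_zero[OF A] by blast
    have Av: "(\<Sum>k<N. a k i * v $ k) = 0" if "i < N" for i
      using arg_cong[OF v(3), of "\<lambda>w :: _ vec. w $ i"] that v(1)
      by (simp add: A_def scalar_prod_def atLeast0LessThan)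
    define g where "g = (\<Sum>k<N. monom (\<chi> (v $ k)) k)"
    have "poly g (ev p t) = 0" if p: "p \<in> \<Omega>" for p
    proof -
      have "poly g (ev p t) = (\<Sum>k<N. \<chi> (v $ k) * ev p (t ^ k))"
        by (simp add: g_def poly_sum poly_monom ev_arith[OF p])
      also have "\<dots> = (\<Sum>k<N. \<Sum>i<N. \<chi> (a k i * v $ k) * ev p (m i))"
        by (simp add: ev_coords[OF a p] sum_distrib_left base.hom_mult ac_simps)
      also have "\<dots> = (\<Sum>i<N. \<chi> (\<Sum>k<N. a k i * v $ k) * ev p (m i))"
        by (subst sum.swap) (simp add: base.hom_sum sum_distrib_right)
      also have "\<dots> = 0" using Av by simp
      finally show ?thesis .
    qed
    then have roots: "(\<lambda>p. ev p t) ` \<Omega> \<subseteq> {x. poly g x = 0}" by auto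
    have "g = 0"
    proof (rule ccontr)
      assume g: "g \<noteq> 0"
      have "N = card ((\<lambda>p. ev p t) ` \<Omega>)" using card_image[OF inj] by simp
      also have "\<dots> \<le> card {x. poly g x = 0}" by (intro card_mono roots poly_roots_finite g)
      also have "\<dots> \<le> degree g" by (rule card_poly_roots_bound[OF g])
      finally have dg: "N \<le> degree g" .
      have "coeff g (degree g) = 0" using dg by (simp add: g_def coeff_sum)
      then show False using g by simp
    qed
    have "v $ k = 0" if "k < N" for k
    proof -
      have "coeff g k = \<chi> (v $ k)" using that by (simp add: g_def coeff_sum)
      then show ?thesis using \<open>g = 0\<close> by simp
    qed
    then have "v = 0\<^sub>v N" using v(1) by (intro eq_vecI) auto
    then show False using v(2) by simp
  qed
  then obtain Z where Z: "Z \<in> carrier_mat N N" "A * Z = 1\<^sub>m N"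
    using det_non_zero_imp_unit[OF A] A unfolding Units_def ring_mat_def by auto
  define z where "z = Z *\<^sub>v vec N b"
  have z: "z \<in> carrier_vec N" using Z by (simp add: z_def)
  have "A *\<^sub>v z = vec N b" unfolding z_def using Z A
    by (metis assoc_mult_mat_vec one_mult_mat_vec vec_carrier)
  moreover have "(A *\<^sub>v z) $ i = (\<Sum>k<N. a k i * z $ k)" if "i < N" for i
    using that z by (simp add: A_def scalar_prod_def atLeast0LessThan)
  ultimately have Az: "(\<Sum>k<N. a k i * z $ k) = b i" if "i < N" for i
    using that by simp
  have "y - (\<Sum>k<N. \<iota> (z $ k) * t ^ k) \<in> K"
  proof (rule joint_kernel)
    show "y - (\<Sum>k<N. \<iota> (z $ k) * t ^ k) \<in> S"
      by (intro S_closed y subalgebra_sum[OF struct.comm_ring_hom_axioms S] tk)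
    fix p assume p: "p \<in> \<Omega>"
    have "(\<Sum>k<N. \<chi> (z $ k) * ev p (t ^ k)) = (\<Sum>k<N. \<Sum>i<N. \<chi> (a k i * z $ k) * ev p (m i))"
      by (simp add: ev_coords[OF a p] sum_distrib_left base.hom_mult ac_simps)
    also have "\<dots> = (\<Sum>i<N. \<chi> (\<Sum>k<N. a k i * z $ k) * ev p (m i))"
      by (subst sum.swap) (simp add: base.hom_sum sum_distrib_right)
    also have "\<dots> = ev p y" using Az by (simp add: ev_coords[OF b p])
    finally show "ev p (y - (\<Sum>k<N. \<iota> (z $ k) * t ^ k)) = 0"
      by (simp only: ev_arith[OF p] ev_struct[OF p]) simp
  qed
  then show ?thesis by (rule exI[of _ "\<lambda>k. z $ k"])
qed

end

section \<open>Separable polynomials and primitive elements\<close>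

text \<open>
  Over an arbitrary field, in which no normalized greatest common divisor is chosen: a nonzero
  combination of least degree divides \<open>p\<close> and \<open>q\<close>.
\<close>

lemma poly_bezout:
  fixes p q :: "'b::field poly"
  assumes "p \<noteq> 0"
  shows "\<exists>u v. u * p + v * q dvd p \<and> u * p + v * q dvd q"
proof -
  define D where "D = {d. d \<noteq> 0 \<and> (\<exists>u v. d = u * p + v * q)}"
  have "p \<in> D" using assms by (auto simp: D_def intro: exI[of _ 1] exI[of _ 0])
  define d where "d = arg_min degree (\<lambda>d. d \<in> D)"
  have d: "d \<in> D" and min: "\<And>e. e \<in> D \<Longrightarrow> degree d \<le> degree e"
    using arg_min_nat_lemma[of "\<lambda>d. d \<in> D" p degree] \<open>p \<in> D\<close> by (auto simp: d_def)
  obtain u v where uv: "d = u * p + v * q" using d by (auto simp: D_def)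
  have "d dvd r" if r: "r = u' * p + v' * q" for r u' v'
  proof (rule ccontr)
    assume nd: "\<not> d dvd r"
    have "r mod d = r - r div d * d" by (simp add: minus_div_mult_eq_mod)
    also have "\<dots> = (u' - r div d * u) * p + (v' - r div d * v) * q"
      by (simp add: r uv algebra_simps)
    finally have "r mod d \<in> D" using nd by (auto simp: D_def dvd_eq_mod_eq_0)
    moreover have "degree (r mod d) < degree d"
      using d nd degree_mod_less'[of d r] by (auto simp: D_def dvd_eq_mod_eq_0)
    ultimately show False using min by fastforce
  qed
  from this[of p 1 0] this[of q 0 1] uv show ?thesis by auto
qed

lemma (in comm_ring_hom) poly_map_poly_arith:
  "poly (map_poly hom (p + q)) z = poly (map_poly hom p) z + poly (map_poly hom q) z"
  "poly (map_poly hom (p * q)) z = poly (map_poly hom p) z * poly (map_poly hom q) z"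
  "poly (map_poly hom (p - q)) z = poly (map_poly hom p) z - poly (map_poly hom q) z"
  "poly (map_poly hom (smult b p)) z = hom b * poly (map_poly hom p) z"
  "poly (map_poly hom (sum f I)) z = (\<Sum>i\<in>I. poly (map_poly hom (f i)) z)"
  "poly (map_poly hom (monom b k)) z = hom b * z ^ k"
proof -
  interpret P: map_poly_comm_ring_hom hom ..
  show "poly (map_poly hom (p + q)) z = poly (map_poly hom p) z + poly (map_poly hom q) z"
    "poly (map_poly hom (p * q)) z = poly (map_poly hom p) z * poly (map_poly hom q) z"
    "poly (map_poly hom (p - q)) z = poly (map_poly hom p) z - poly (map_poly hom q) z"
    "poly (map_poly hom (sum f I)) z = (\<Sum>i\<in>I. poly (map_poly hom (f i)) z)"
    "poly (map_poly hom (monom b k)) z = hom b * z ^ k"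
    by (simp_all add: P.hom_add P.hom_mult P.hom_minus P.hom_sum poly_sum poly_monom)
  show "poly (map_poly hom (smult b p)) z = hom b * poly (map_poly hom p) z"
    by (simp add: map_poly_hom_smult)
qed

context field_hom
begin

text \<open>
  A common divisor of \<open>p\<close> and \<open>h\<close> that is a combination of both vanishes at \<open>z\<close>, so it is not a unit,
  and irreducibility makes it associated to \<open>p\<close>.
\<close>

lemma root_imp_irreducible_dvd:
  assumes p: "irreducible p" "poly (map_poly hom p) z = 0" and h: "poly (map_poly hom h) z = 0"
  shows "p dvd h"
proof -
  have "p \<noteq> 0" using p(1) by (metis not_irreducible_zero)
  then obtain u v where d: "u * p + v * h dvd p" "u * p + v * h dvd h" using poly_bezout by blast
  define d where "d = u * p + v * h"
  have dz: "poly (map_poly hom d) z = 0" unfolding d_def poly_map_poly_arith(1,2) p(2) h by simp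
  obtain e where e: "p = d * e" using d(1) unfolding d_def[symmetric] by (rule dvdE)
  have "\<not> d dvd 1"
  proof
    assume "d dvd 1"
    then obtain c where c: "d = [:c:]" "c dvd 1" unfolding is_unit_poly_iff by blast
    then have "c \<noteq> 0" by auto
    then show False using dz unfolding c(1) by simp
  qed
  then have "e dvd 1" using irreducibleD[OF p(1) e] by blast
  then obtain e' where "1 = e * e'" by (rule dvdE)
  then have "p * e' = d" using e by (metis mult.assoc mult.right_neutral)
  then have "p dvd d" by (metis dvd_triv_left)
  then show ?thesis using d(2) dvd_trans unfolding d_def by blast
qed

text \<open>
  A repeated factor would give a common root of \<open>p\<close> and its derivative, which \<open>p\<close> would then divide.
\<close>

lemma separable_split_roots:
  assumes p: "irreducible p" "coprime p (pderiv p)"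
    and split: "map_poly hom p = smult c (\<Prod>x\<leftarrow>xs. [:- x, 1:])"
  shows "{z. poly (map_poly hom p) z = 0} = set xs" "distinct xs" "length xs = degree p"
proof -
  have p0: "p \<noteq> 0" using p(1) by (metis not_irreducible_zero)
  then have c: "c \<noteq> 0" using split by auto
  have root: "poly (\<Prod>x\<leftarrow>xs. [:- x, 1:]) z = 0 \<longleftrightarrow> z \<in> set xs" for z
    by (induction xs) auto
  show "{z. poly (map_poly hom p) z = 0} = set xs" using root c by (simp add: split)
  show "distinct xs"
  proof (rule ccontr)
    assume "\<not> distinct xs"
    then obtain as bs cs z where "xs = as @ [z] @ bs @ [z] @ cs" using not_distinct_decomp by blast
    then have *: "map_poly hom p = [:- z, 1:] * ([:- z, 1:] *
        smult c (\<Prod>x\<leftarrow>as @ bs @ cs. [:- x, 1:]))" (is "_ = _ * (_ * ?r)")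
      by (simp add: split algebra_simps)
    have "poly (map_poly hom p) z = 0" unfolding * by simp
    moreover have "poly (map_poly hom (pderiv p)) z = 0"
      unfolding map_poly_pderiv * by (simp only: pderiv_mult) simp
    ultimately have "p dvd pderiv p" using root_imp_irreducible_dvd p by blast
    then have "p dvd 1" using p(2) by (metis coprime_common_divisor dvd_refl)
    then show False using p(1) irreducible_not_unit by blast
  qed
  have "degree (\<Prod>x\<leftarrow>xs. [:- x, 1:]) = length xs"
    by (subst degree_prod_list_eq) (auto simp: o_def sum_list_triv)
  then show "length xs = degree p" using arg_cong[OF split, of degree] c by simp
qed

end


lemma eval_fun_poly:
  fixes p :: "'b::comm_ring_1 poly" and \<chi> :: "'b \<Rightarrow> 'c::comm_ring_1"
  assumes "comm_ring_hom \<chi>"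
  shows "poly (map_poly (\<lambda>b _. \<chi> b) p) x s = poly (map_poly \<chi> p) (x s)"
proof -
  interpret comm_ring_hom \<chi> by fact
  interpret F: comm_ring_hom "\<lambda>b _. \<chi> b" by unfold_locales (auto simp: hom_distribs fun_eq_iff)
  show ?thesis by (induction p) (simp_all only: map_poly_pCons_hom F.map_poly_pCons_hom poly_pCons
      map_poly_0 poly_0 plus_fun_apply times_fun_apply zero_fun_apply)
qed

lemma sum_fun_apply: "(\<Sum>i\<in>I. f i) s = (\<Sum>i\<in>I. f i s)" for f :: "'i \<Rightarrow> 's \<Rightarrow> 'c::comm_monoid_add"
  by (induction I rule: infinite_finite_induct) simp_all

lemma finite_field_generator:
  assumes "finite (UNIV :: 'a::field set)"
  shows "\<exists>\<theta>::'a. \<forall>a. a \<noteq> 0 \<longrightarrow> (\<exists>k::nat. a = \<theta> ^ k)"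
proof -
  let ?R = "ring_of_type_algebra :: 'a ring"
  interpret F: Ring.field ?R by (rule field_from_type_algebra)
  obtain \<theta> where \<theta>: "carrier (mult_of ?R) = {\<theta> [^]\<^bsub>?R\<^esub> i | i::nat. i \<in> UNIV}"
    using F.finite_field_mult_group_has_gen assms by (auto simp: ring_of_type_algebra_def)
  have pow: "\<theta> [^]\<^bsub>?R\<^esub> i = \<theta> ^ i" for i :: nat
    by (induction i) (auto simp: ring_of_type_algebra_def mult.commute)
  have "a \<in> carrier (mult_of ?R)" if "a \<noteq> 0" for a
    using that by (simp add: ring_of_type_algebra_def mult_of_def)
  then show ?thesis using \<theta> pow by (intro exI[of _ \<theta>]) auto
qed

text \<open>
  For a finite base field a generator of the multiplicative group will do. Over an infinite one, let
  \<open>e\<^sub>0, \<dots>, e\<^sub>k\<^sub>-\<^sub>1\<close> span \<open>A\<close>, with separable irreducible polynomials \<open>p\<^sub>i\<close>, and let \<open>\<Omega>\<close> be the set of all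
  tuples of roots of \<open>p\<^sub>0, \<dots>, p\<^sub>k\<^sub>-\<^sub>1\<close>. The algebra generated over \<open>B\<close> by the coordinate functions on
  \<open>\<Omega>\<close> is spanned by \<open>\<Prod> degree p\<^sub>i\<close> elements, which is the number of points. For all but finitely many
  \<open>c\<close>, the function \<open>t = \<Sum> c\<^sup>i x\<^sub>i\<close> is injective on \<open>\<Omega>\<close>, so by \<open>powers_span\<close> each coordinate is a
  polynomial in \<open>t\<close> over \<open>B\<close>. Evaluation at the point \<open>(\<psi> e\<^sub>0, \<dots>, \<psi> e\<^sub>k\<^sub>-\<^sub>1)\<close> expresses every \<open>e\<^sub>i\<close> as a
  polynomial in \<open>\<Sum> c\<^sup>i e\<^sub>i\<close>.
\<close>

lemma primitive_element:
  fixes \<phi> :: "'b::field \<Rightarrow> 'a::field" and \<psi> :: "'a \<Rightarrow> 'c::field" and k :: nat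
  assumes \<phi>: "field_hom \<phi>" and \<psi>: "field_hom \<psi>"
    and normal: "normal_over (\<psi> \<circ> \<phi>) UNIV" and separable: "separable_over \<phi> UNIV"
    and span: "\<And>a. \<exists>b. a = (\<Sum>i<k. \<phi> (b i) * e i)"
  shows "\<exists>\<theta>. \<forall>a. \<exists>g. a = poly (map_poly \<phi> g) \<theta>"
proof (cases "finite (UNIV :: 'b set)")
  case True
  interpret field_hom \<phi> by fact
  have "finite (UNIV :: 'a set)"
  proof (rule finite_surj)
    show "finite ({..<k} \<rightarrow>\<^sub>E (UNIV :: 'b set))" using True by (intro finite_PiE) auto
    show "UNIV \<subseteq> (\<lambda>b. \<Sum>i<k. \<phi> (b i) * e i) ` ({..<k} \<rightarrow>\<^sub>E (UNIV :: 'b set))"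
    proof
      fix a
      obtain b where "a = (\<Sum>i<k. \<phi> (b i) * e i)" using span by blast
      then have "a = (\<Sum>i<k. \<phi> (restrict b {..<k} i) * e i)" by simp
      then show "a \<in> (\<lambda>b. \<Sum>i<k. \<phi> (b i) * e i) ` ({..<k} \<rightarrow>\<^sub>E (UNIV :: 'b set))"
        by (intro image_eqI[of _ _ "restrict b {..<k}"]) simp_all
    qed
  qed
  then obtain \<theta> :: 'a where \<theta>: "\<And>a. a \<noteq> 0 \<Longrightarrow> \<exists>k::nat. a = \<theta> ^ k"
    using finite_field_generator by blast
  have "\<exists>g. a = poly (map_poly \<phi> g) \<theta>" for a
  proof (cases "a = 0")
    case True
    then show ?thesis by (intro exI[of _ 0]) simp
  next
    case False
    then obtain k where "a = \<theta> ^ k" using \<theta> by blast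
    then show ?thesis by (intro exI[of _ "monom 1 k"]) (simp add: poly_monom)
  qed
  then show ?thesis by blast
next
  case infinite: False
  interpret \<phi>: field_hom \<phi> by fact
  interpret \<psi>: field_hom \<psi> by fact
  define \<chi> where "\<chi> = \<psi> \<circ> \<phi>"
  have \<chi>_apply: "\<chi> b = \<psi> (\<phi> b)" for b by (simp add: \<chi>_def)
  interpret \<chi>: field_hom \<chi>
    by unfold_locales (simp_all add: \<chi>_apply \<phi>.hom_add \<psi>.hom_add \<phi>.hom_mult \<psi>.hom_mult)
  have \<chi>\<psi>: "poly (map_poly \<chi> g) (\<psi> a) = \<psi> (poly (map_poly \<phi> g) a)" for g a
    by (induction g)
       (simp_all add: \<chi>.map_poly_pCons_hom \<phi>.map_poly_pCons_hom \<psi>.hom_add \<psi>.hom_mult \<chi>_apply)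
  have "\<forall>i. \<exists>p. irreducible p \<and> poly (map_poly \<phi> p) (e i) = 0 \<and> coprime p (pderiv p)"
    using separable by (auto simp: separable_over_def)
  then obtain p where p: "\<And>i. irreducible (p i)" "\<And>i. poly (map_poly \<phi> (p i)) (e i) = 0"
    "\<And>i. coprime (p i) (pderiv (p i))" by metis
  define Z where "Z i = {z. poly (map_poly \<chi> (p i)) z = 0}" for i
  have eZ: "\<psi> (e i) \<in> Z i" for i by (simp add: Z_def \<chi>\<psi> p)
  have Zcard: "finite (Z i) \<and> card (Z i) = degree (p i)" for i
  proof -
    obtain c xs where xs: "map_poly \<chi> (p i) = smult c (\<Prod>x\<leftarrow>xs. [:- x, 1:])"
      using normal p(1)[of i] eZ[of i] unfolding normal_over_def \<chi>_def[symmetric] Z_def by blast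
    note roots = \<chi>.separable_split_roots[OF p(1,3) xs]
    show ?thesis unfolding Z_def roots(1) using roots(2,3) by (simp add: distinct_card)
  qed
  define \<Omega> where "\<Omega> = Pi\<^sub>E {..<k} Z"
  have differ: "\<exists>i<k. s i \<noteq> t i" if "s \<in> \<Omega>" "t \<in> \<Omega>" "s \<noteq> t" for s t
    using that PiE_ext unfolding \<Omega>_def by (metis lessThan_iff)
  have fin\<Omega>: "finite \<Omega>" unfolding \<Omega>_def using Zcard by (intro finite_PiE) auto
  have card\<Omega>: "card \<Omega> = (\<Prod>i<k. degree (p i))" unfolding \<Omega>_def by (simp add: card_PiE Zcard)
  define \<iota> where "\<iota> = (\<lambda>b (_ :: nat \<Rightarrow> 'c). \<chi> b)"
  interpret \<iota>: comm_ring_hom \<iota> unfolding \<iota>_def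
    by unfold_locales (simp_all add: \<chi>.hom_add \<chi>.hom_mult fun_eq_iff)
  define K where "K = {f :: (nat \<Rightarrow> 'c) \<Rightarrow> 'c. \<forall>s\<in>\<Omega>. f s = 0}"
  have K: "ring_ideal K" by (auto simp: ring_ideal_def K_def)
  define x where "x = (\<lambda>i (s :: nat \<Rightarrow> 'c). s i)"
  have "\<exists>S m. is_subalgebra \<iota> S \<and> K \<subseteq> S \<and> (\<forall>i<j. x i \<in> S) \<and> spanned_mod \<iota> K (\<Prod>i<j. degree (p i)) m S"
    if "j \<le> k" for j
    using that
  proof (induction j)
    case 0
    show ?case using subalgebra_base[OF \<iota>.comm_ring_hom_axioms K] by auto
  next
    case (Suc j)
    then obtain S m where S: "is_subalgebra \<iota> S" "K \<subseteq> S" "\<forall>i<j. x i \<in> S"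
      "spanned_mod \<iota> K (\<Prod>i<j. degree (p i)) m S" by auto
    define q where "q = smult (inverse (lead_coeff (p j))) (p j)"
    have pj: "p j \<noteq> 0" using p(1)[of j] by (metis not_irreducible_zero)
    have q: "lead_coeff q = 1" "degree q = degree (p j)" using pj by (auto simp: q_def)
    have deg: "degree (map_poly \<iota> q) = degree (p j)"
      unfolding q(2)[symmetric] by (rule degree_map_poly) (auto simp: \<iota>_def fun_eq_iff)
    have "\<exists>S' m'. is_subalgebra \<iota> S' \<and> S \<subseteq> S' \<and> x j \<in> S' \<and>
        spanned_mod \<iota> K ((\<Prod>i<j. degree (p i)) * degree (map_poly \<iota> q)) m' S'"
    proof (rule adjoin_root[OF \<iota>.comm_ring_hom_axioms S(1) K S(2,4)])
      show "lead_coeff (map_poly \<iota> q) = 1" using q deg by simp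
      show "coeff (map_poly \<iota> q) i \<in> S" for i
        using subalgebraD(1)[OF \<iota>.comm_ring_hom_axioms S(1)] by simp
      show "poly (map_poly \<iota> q) (x j) \<in> K"
      proof -
        have "poly (map_poly \<chi> q) (s j) = 0" if "s \<in> \<Omega>" for s
        proof -
          have "j \<in> {..<k}" using Suc.prems by simp
          with that have "s j \<in> Z j" unfolding \<Omega>_def by (rule PiE_mem)
          then have "poly (map_poly \<chi> (p j)) (s j) = 0" by (simp only: Z_def mem_Collect_eq)
          then show ?thesis unfolding q_def \<chi>.poly_map_poly_arith(4) by simp
        qed
        then show ?thesis
          unfolding K_def \<iota>_def eval_fun_poly[OF \<chi>.comm_ring_hom_axioms] x_def by simp
      qed
      show "degree (map_poly \<iota> q) > 0"
        using Zcard[of j] eZ[of j] deg by (metis card_gt_0_iff empty_iff)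
    qed
    then obtain S' m' where S': "is_subalgebra \<iota> S'" "S \<subseteq> S'" "x j \<in> S'"
        "spanned_mod \<iota> K ((\<Prod>i<j. degree (p i)) * degree (map_poly \<iota> q)) m' S'" by blast
    then show ?case using S deg by (intro exI[of _ S'] exI[of _ m']) (auto simp: less_Suc_eq)
  qed
  then obtain S m where S: "is_subalgebra \<iota> S" "K \<subseteq> S" "\<And>i. i < k \<Longrightarrow> x i \<in> S"
    "spanned_mod \<iota> K (card \<Omega>) m S" unfolding card\<Omega> by blast
  interpret sep: separated_algebra \<chi> \<iota> K S \<Omega> "\<lambda>s f. f s" m
  proof
    show "\<exists>y\<in>S. y s \<noteq> y t" if st: "s \<in> \<Omega>" "t \<in> \<Omega>" "s \<noteq> t" for s t
    proof -
      obtain i where "i < k" "s i \<noteq> t i" using differ[OF st] by blast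
      then show ?thesis using S(3)[of i] by (intro bexI[of _ "x i"]) (auto simp: x_def)
    qed
  qed (use fin\<Omega> S in \<open>auto simp: \<iota>_def K_def\<close>)
  \<comment> \<open>\<open>t\<close> takes the same value at two points of \<open>\<Omega>\<close> only if \<open>\<chi> c\<close> is a root of their difference polynomial\<close>
  define d where "d s t = (\<Sum>i<k. monom (s i - t i) i)" for s t :: "nat \<Rightarrow> 'c"
  have d: "d s t \<noteq> 0" if st: "s \<in> \<Omega>" "t \<in> \<Omega>" "s \<noteq> t" for s t
  proof -
    obtain i where i: "i < k" "s i \<noteq> t i" using differ[OF st] by blast
    then have "coeff (d s t) i \<noteq> 0" by (simp add: d_def coeff_sum)
    then show ?thesis by auto
  qed
  define bad where "bad = (\<Union>s\<in>\<Omega>. \<Union>t\<in>\<Omega> - {s}. {z. poly (d s t) z = 0})"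
  have "finite bad" unfolding bad_def using fin\<Omega> d by (intro finite_UN_I finite_Diff poly_roots_finite) auto
  then have "finite (\<chi> -` bad)" by (intro finite_vimageI) (auto simp: inj_on_def)
  then obtain c where c: "\<chi> c \<notin> bad" using infinite by (metis ex_new_if_finite vimageI)
  define t where "t = (\<Sum>i<k. \<iota> (c ^ i) * x i)"
  have t_apply: "t s = (\<Sum>i<k. \<chi> c ^ i * s i)" for s
    by (simp add: t_def \<iota>_def x_def \<chi>.hom_power sum_fun_apply)
  have tS: "t \<in> S" unfolding t_def
    by (intro subalgebra_sum[OF \<iota>.comm_ring_hom_axioms S(1)] subalgebraD[OF \<iota>.comm_ring_hom_axioms S(1)] S(3)) auto
  have inj: "inj_on (\<lambda>s. t s) \<Omega>"
  proof (rule inj_onI, rule ccontr)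
    fix s u assume su: "s \<in> \<Omega>" "u \<in> \<Omega>" "t s = t u" "s \<noteq> u"
    have "poly (d s u) (\<chi> c) = t s - t u"
      by (simp add: d_def poly_sum poly_monom t_apply sum_subtractf[symmetric] algebra_simps)
    then show False using su c by (auto simp: bad_def)
  qed
  have "\<forall>i. \<exists>z. i < k \<longrightarrow> x i - (\<Sum>j<card \<Omega>. \<iota> (z j) * t ^ j) \<in> K"
    using sep.powers_span[OF tS inj S(3)] by blast
  then obtain z where z: "\<And>i. i < k \<Longrightarrow> x i - (\<Sum>j<card \<Omega>. \<iota> (z i j) * t ^ j) \<in> K" by metis
  define s where "s = (\<lambda>i\<in>{..<k}. \<psi> (e i))"
  have s: "s \<in> \<Omega>" using eZ by (auto simp: \<Omega>_def s_def)
  define \<theta> where "\<theta> = (\<Sum>i<k. \<phi> (c ^ i) * e i)"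
  have ts: "t s = \<psi> \<theta>"
    by (simp add: t_apply \<theta>_def s_def \<psi>.hom_sum \<psi>.hom_mult \<psi>.hom_power \<phi>.hom_power \<chi>_apply)
  define g where "g i = (\<Sum>j<card \<Omega>. monom (z i j) j)" for i
  have "e i = poly (map_poly \<phi> (g i)) \<theta>" if "i < k" for i
  proof -
    have pow: "(t ^ j) s = t s ^ j" for j by (induction j) auto
    have si: "s i = \<psi> (e i)" using that by (simp add: s_def)
    have "(x i - (\<Sum>j<card \<Omega>. \<iota> (z i j) * t ^ j)) s = 0" using z[OF that] s by (simp add: K_def)
    then have "\<psi> (e i) = (\<Sum>j<card \<Omega>. \<chi> (z i j) * \<psi> \<theta> ^ j)"
      by (simp add: x_def \<iota>_def sum_fun_apply pow ts si)
    also have "\<dots> = \<psi> (poly (map_poly \<phi> (g i)) \<theta>)"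
      by (simp add: g_def \<phi>.poly_map_poly_arith(5) poly_monom \<chi>_apply \<psi>.hom_sum \<psi>.hom_mult \<psi>.hom_power)
    finally show ?thesis by simp
  qed
  then have e: "\<phi> b * e i = poly (map_poly \<phi> (smult b (g i))) \<theta>" if "i < k" for i b
    using that unfolding \<phi>.poly_map_poly_arith(4) by simp
  have "\<exists>g. a = poly (map_poly \<phi> g) \<theta>" for a
  proof -
    obtain b where "a = (\<Sum>i<k. \<phi> (b i) * e i)" using span by blast
    also have "\<dots> = poly (map_poly \<phi> (\<Sum>i<k. smult (b i) (g i))) \<theta>"
      by (simp add: e \<phi>.poly_map_poly_arith(5))
    finally show ?thesis by blast
  qed
  then show ?thesis by blast
qed

section \<open>Conjugate embeddings and characteristic polynomials\<close>

lemma (in field_hom) vector_space_alg_scale: "vector_space (alg_scale hom)"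
  by unfold_locales (simp_all add: alg_scale_def algebra_simps hom_add hom_mult)

lemma coeff_prod_linear:
  fixes x :: "'i \<Rightarrow> 'c::comm_ring_1"
  assumes A: "finite A" and j: "j \<le> card A"
  shows "coeff (\<Prod>i\<in>A. [:- x i, 1:]) (card A - j) = (-1) ^ j * (\<Sum>S\<in>{S. S \<subseteq> A \<and> card S = j}. \<Prod>i\<in>S. x i)"
proof -
  have "(\<Prod>i\<in>A. [:- x i, 1:]) = (\<Prod>i\<in>A. [:- x i:] + monom 1 1)"
    by (intro prod.cong) (simp_all add: monom_altdef)
  also have "\<dots> = (\<Sum>S\<in>Pow A. (\<Prod>i\<in>S. [:- x i:]) * (\<Prod>i\<in>A - S. monom 1 1))"
    by (rule prod_add[OF A])
  also have "\<dots> = (\<Sum>S\<in>Pow A. monom ((-1) ^ card S * (\<Prod>i\<in>S. x i)) (card A - card S))"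
  proof (intro sum.cong refl)
    fix S assume S: "S \<in> Pow A"
    then have fS: "finite S" using A by (auto intro: finite_subset)
    have 1: "(\<Prod>i\<in>S. [:- x i:]) = [:(-1) ^ card S * (\<Prod>i\<in>S. x i):]"
      using fS by (induction S rule: finite_induct) (auto simp: algebra_simps)
    have "(\<Prod>i\<in>A - S. monom 1 1 :: 'c poly) = monom 1 (card (A - S))"
      by (simp add: monom_altdef)
    also have "card (A - S) = card A - card S" using S fS by (intro card_Diff_subset) auto
    finally show "(\<Prod>i\<in>S. [:- x i:]) * (\<Prod>i\<in>A - S. monom 1 1) =
        monom ((-1) ^ card S * (\<Prod>i\<in>S. x i)) (card A - card S)"
      by (simp add: 1 smult_monom)
  qed
  finally have "coeff (\<Prod>i\<in>A. [:- x i, 1:]) (card A - j)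
      = (\<Sum>S\<in>Pow A. if card A - card S = card A - j then (-1) ^ card S * (\<Prod>i\<in>S. x i) else 0)"
    by (simp add: coeff_sum)
  also have "\<dots> = (\<Sum>S\<in>Pow A. if card S = j then (-1) ^ card S * (\<Prod>i\<in>S. x i) else 0)"
  proof (intro sum.cong refl if_cong)
    fix S assume "S \<in> Pow A"
    then have "card S \<le> card A" using A by (auto intro: card_mono)
    then show "(card A - card S = card A - j) = (card S = j)" using j by auto
  qed
  also have "\<dots> = (\<Sum>S\<in>{S \<in> Pow A. card S = j}. (-1) ^ card S * (\<Prod>i\<in>S. x i))"
    using A by (subst sum.inter_filter) auto
  also have "\<dots> = (\<Sum>S\<in>{S. S \<subseteq> A \<and> card S = j}. (-1) ^ j * (\<Prod>i\<in>S. x i))"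
    by (intro sum.cong) auto
  finally show ?thesis by (simp add: sum_distrib_left)
qed

lemma power_basis:
  fixes \<phi> :: "'b::field \<Rightarrow> 'a::field"
  assumes \<phi>: "field_hom \<phi>" and p: "irreducible p" "poly (map_poly \<phi> p) \<theta> = 0"
    and gen: "\<And>a. \<exists>g. a = poly (map_poly \<phi> g) \<theta>"
  shows "algebra_basis \<phi> (map (\<lambda>k. \<theta> ^ k) [0..<degree p])" "extension_degree \<phi> = degree p"
proof -
  interpret \<phi>: field_hom \<phi> by fact
  interpret V: vector_space "alg_scale \<phi>" by (rule \<phi>.vector_space_alg_scale)
  define m where "m = degree p"
  define B where "B = (\<lambda>k. \<theta> ^ k) ` {..<m}"
  have p0: "p \<noteq> 0" using p(1) by (metis not_irreducible_zero)
  have small: "g = 0" if g: "poly (map_poly \<phi> g) \<theta> = 0" "\<forall>k\<ge>m. coeff g k = 0" for g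
  proof (rule ccontr)
    assume "g \<noteq> 0"
    moreover have "p dvd g" using \<phi>.root_imp_irreducible_dvd[OF p g(1)] .
    ultimately have "degree p \<le> degree g" by (intro dvd_imp_degree_le)
    then have "coeff g (degree g) = 0" using g(2) by (simp add: m_def)
    then show False using \<open>g \<noteq> 0\<close> by simp
  qed
  have indep: "c k = 0" if c: "(\<Sum>k<m. \<phi> (c k) * \<theta> ^ k) = 0" and k: "k < m" for c k
  proof -
    define g where "g = (\<Sum>k<m. monom (c k) k)"
    have "poly (map_poly \<phi> g) \<theta> = (\<Sum>k<m. \<phi> (c k) * \<theta> ^ k)"
      unfolding g_def by (simp only: \<phi>.poly_map_poly_arith(5,6))
    then have "g = 0" using c by (intro small) (simp_all add: g_def coeff_sum)
    moreover have "coeff g k = c k" using k by (simp add: g_def coeff_sum)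
    ultimately show ?thesis by simp
  qed
  have inj: "inj_on (\<lambda>k. \<theta> ^ k) {..<m}"
  proof (rule inj_onI, rule ccontr)
    fix i j assume ij: "i \<in> {..<m}" "j \<in> {..<m}" "\<theta> ^ i = \<theta> ^ j" "i \<noteq> j"
    have "(\<Sum>k<m. \<phi> (if k = i then 1 else if k = j then -1 else 0) * \<theta> ^ k)
        = (\<Sum>k<m. (if k = i then \<theta> ^ i else 0) - (if k = j then \<theta> ^ j else 0))"
      using ij by (intro sum.cong) (auto simp: \<phi>.hom_uminus)
    also have "\<dots> = 0" using ij by (simp add: sum_subtractf)
    finally show False using indep[of "\<lambda>k. if k = i then 1 else if k = j then -1 else 0" i] ij by auto
  qed
  have "\<not> V.dependent B"
  proof (rule V.independent_if_scalars_zero)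
    fix f x assume f: "(\<Sum>x\<in>B. alg_scale \<phi> (f x) x) = 0" and "x \<in> B"
    then obtain k where k: "k < m" "x = \<theta> ^ k" by (auto simp: B_def)
    have "(\<Sum>k<m. \<phi> (f (\<theta> ^ k)) * \<theta> ^ k) = 0"
      using f inj by (simp add: B_def sum.reindex alg_scale_def)
    then show "f x = 0" using indep[of "\<lambda>k. f (\<theta> ^ k)" k] k by simp
  qed (simp add: B_def)
  moreover have "a \<in> V.span B" for a
  proof -
    obtain g where g: "a = poly (map_poly \<phi> g) \<theta>" using gen by blast
    define h where "h = g mod p"
    have "g = g div p * p + h" by (simp add: h_def)
    then have "a = poly (map_poly \<phi> (g div p * p + h)) \<theta>" using g by simp
    also have "\<dots> = poly (map_poly \<phi> h) \<theta>"
      unfolding \<phi>.poly_map_poly_arith(1,2) p(2) by simp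
    also have "h = (\<Sum>k<m. monom (coeff h k) k)"
    proof (rule poly_eqI)
      fix k
      have "coeff h k = 0" if "k \<ge> m"
      proof (cases "h = 0")
        case False
        then have "degree h < m" using degree_mod_less[OF p0, of g] by (auto simp: h_def m_def)
        then show ?thesis using that by (intro coeff_eq_0) simp
      qed simp
      then show "coeff h k = coeff (\<Sum>k<m. monom (coeff h k) k) k" by (simp add: coeff_sum)
    qed
    also have "poly (map_poly \<phi> (\<Sum>k<m. monom (coeff h k) k)) \<theta> = (\<Sum>k<m. alg_scale \<phi> (coeff h k) (\<theta> ^ k))"
      by (simp only: \<phi>.poly_map_poly_arith(5,6) alg_scale_def)
    also have "\<dots> \<in> V.span B"
      by (intro V.span_sum V.span_scale V.span_base) (auto simp: B_def)
    finally show ?thesis .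
  qed
  then have "V.span B = UNIV" by blast
  ultimately show "algebra_basis \<phi> (map (\<lambda>k. \<theta> ^ k) [0..<degree p])"
    using inj by (simp add: algebra_basis_def B_def m_def atLeast0LessThan distinct_map)
  have "card B = V.dim UNIV"
    using \<open>V.span B = UNIV\<close> \<open>\<not> V.dependent B\<close> by (intro V.basis_card_eq_dim) auto
  then show "extension_degree \<phi> = degree p"
    using inj by (simp add: extension_degree_def B_def card_image m_def)
qed

text \<open>
  The \<open>n\<close> embeddings are the points of the \<open>n\<close>-dimensional algebra \<open>A\<close>, so \<open>char_poly_eq_prod\<close> applies.
\<close>

lemma char_poly_mult_matrix:
  fixes \<phi> :: "'b::field \<Rightarrow> 'a::field" and \<chi> :: "'b \<Rightarrow> 'c::field"
  assumes \<phi>: "field_hom \<phi>" and \<chi>: "field_hom \<chi>" and es: "algebra_basis \<phi> es" "length es = n"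
    and \<sigma>: "\<And>i. i < n \<Longrightarrow> comm_ring_hom (\<sigma> i)" "\<And>i b. i < n \<Longrightarrow> \<sigma> i (\<phi> b) = \<chi> b"
    and distinct: "\<And>i j. i < n \<Longrightarrow> j < n \<Longrightarrow> i \<noteq> j \<Longrightarrow> \<exists>a. \<sigma> i a \<noteq> \<sigma> j a"
  shows "map_poly \<chi> (char_poly (mult_matrix \<phi> es a)) = (\<Prod>i<n. [:- \<sigma> i a, 1:])"
proof -
  interpret \<phi>: field_hom \<phi> by fact
  interpret \<chi>: field_hom \<chi> by fact
  interpret V: vector_space "alg_scale \<phi>" by (rule \<phi>.vector_space_alg_scale)
  have bij: "bij_betw (\<lambda>i. es ! i) {..<n} (set es)"
    using es by (intro bij_betw_nth) (auto simp: algebra_basis_def)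
  have rep: "y = (\<Sum>i<n. \<phi> (V.representation (set es) y (es ! i)) * es ! i)" for y
  proof -
    have "y = (\<Sum>e\<in>set es. alg_scale \<phi> (V.representation (set es) y e) e)"
      using es by (intro V.sum_representation_eq[symmetric]) (auto simp: algebra_basis_def)
    also have "\<dots> = (\<Sum>i<n. alg_scale \<phi> (V.representation (set es) y (es ! i)) (es ! i))"
      by (rule sum.reindex_bij_betw[OF bij, symmetric])
    finally show ?thesis by (simp add: alg_scale_def)
  qed
  interpret sep: separated_algebra \<chi> \<phi> "{0}" UNIV "{..<n}" \<sigma> "\<lambda>i. es ! i"
  proof (intro separated_algebra.intro separated_algebra_axioms.intro)
    show "\<sigma> i k = 0" if "i \<in> {..<n}" "k \<in> {0}" for i k
    proof -
      interpret comm_ring_hom "\<sigma> i" using \<sigma>(1) that by simp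
      show ?thesis using that by simp
    qed
    show "spanned_mod \<phi> {0} (card {..<n}) (\<lambda>i. es ! i) UNIV"
      unfolding spanned_mod_def
    proof (intro conjI allI impI ballI)
      show "\<exists>b. y - (\<Sum>i<card {..<n}. \<phi> (b i) * es ! i) \<in> {0}" for y
        using rep[of y] by (intro exI[of _ "\<lambda>i. V.representation (set es) y (es ! i)"]) simp
    qed simp
  qed (use \<sigma> distinct \<phi>.comm_ring_hom_axioms \<chi> in \<open>auto simp: is_subalgebra_def\<close>)
  define A where "A = mult_matrix \<phi> es a"
  have A: "A \<in> carrier_mat n n" by (simp add: A_def mult_matrix_def es)
  have "map_poly \<chi> (char_poly A) = (\<Prod>i\<in>{..<n}. [:- \<sigma> i a, 1:])"
  proof (rule sep.char_poly_eq_prod)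
    show "A \<in> carrier_mat (card {..<n}) (card {..<n})" using A by simp
    fix p j assume p: "p \<in> {..<n}" and "j < card {..<n}"
    then have j: "j < n" by simp
    have "\<sigma> p a * \<sigma> p (es ! j) = \<sigma> p (a * es ! j)" by (simp add: sep.ev_arith[OF p])
    also have "\<dots> = \<sigma> p (\<Sum>i<n. \<phi> (V.representation (set es) (a * es ! j) (es ! i)) * es ! i)"
      by (rule arg_cong[OF rep])
    also have "\<dots> = (\<Sum>i<n. \<chi> (V.representation (set es) (a * es ! j) (es ! i)) * \<sigma> p (es ! i))"
      by (simp add: sep.ev_arith[OF p] sep.ev_struct[OF p])
    also have "\<dots> = (\<Sum>i<card {..<n}. \<chi> (A $$ (i, j)) * \<sigma> p (es ! i))"
      using j es by (simp add: A_def mult_matrix_def)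
    finally show "\<sigma> p a * \<sigma> p (es ! j) = \<dots>" .
  qed
  then show ?thesis by (simp add: A_def)
qed

lemma mult_char_poly_conjugates:
  fixes \<phi> :: "'b::field \<Rightarrow> 'a::field" and \<chi> :: "'b \<Rightarrow> 'c::field"
  assumes "field_hom \<phi>" "field_hom \<chi>" "\<exists>es. length es = n \<and> algebra_basis \<phi> es"
    and "\<And>i. i < n \<Longrightarrow> comm_ring_hom (\<sigma> i)" "\<And>i b. i < n \<Longrightarrow> \<sigma> i (\<phi> b) = \<chi> b"
    and "\<And>i j. i < n \<Longrightarrow> j < n \<Longrightarrow> i \<noteq> j \<Longrightarrow> \<exists>a. \<sigma> i a \<noteq> \<sigma> j a"
  shows "map_poly \<chi> (mult_char_poly \<phi> n a) = (\<Prod>i<n. [:- \<sigma> i a, 1:])"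
    and "degree (mult_char_poly \<phi> n a) = n" and "lead_coeff (mult_char_poly \<phi> n a) = 1"
proof -
  define es where "es = (SOME es. length es = n \<and> algebra_basis \<phi> es)"
  have es: "length es = n" "algebra_basis \<phi> es"
    using someI_ex[OF assms(3)] by (simp_all add: es_def)
  have eq: "mult_char_poly \<phi> n a = char_poly (mult_matrix \<phi> es a)"
    by (simp add: mult_char_poly_def es_def)
  show "map_poly \<chi> (mult_char_poly \<phi> n a) = (\<Prod>i<n. [:- \<sigma> i a, 1:])"
    unfolding eq by (rule char_poly_mult_matrix[OF assms(1,2) es(2,1) assms(4-6)])
  have "mult_matrix \<phi> es a \<in> carrier_mat n n" by (simp add: mult_matrix_def es)
  from degree_monic_char_poly[OF this]
  show "degree (mult_char_poly \<phi> n a) = n" "lead_coeff (mult_char_poly \<phi> n a) = 1"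
    unfolding eq by simp_all
qed

text \<open>
  Since \<open>A\<close> is the algebra of polynomials modulo the irreducible polynomial of \<open>\<theta>\<close>, sending \<open>\<theta>\<close> to a
  root of that polynomial is well defined. The polynomial splits with distinct roots by normality and
  separability; \<open>\<psi>\<close> itself belongs to the root \<open>\<psi> \<theta>\<close>.
\<close>

lemma conjugate_embeddings:
  fixes \<phi> :: "'b::field \<Rightarrow> 'a::field" and \<psi> :: "'a \<Rightarrow> 'c::field"
  assumes \<phi>: "field_hom \<phi>" and \<psi>: "field_hom \<psi>" and fin: "finite_extension \<phi>"
    and normal: "normal_over (\<psi> \<circ> \<phi>) UNIV" and separable: "separable_over \<phi> UNIV"
  defines "n \<equiv> extension_degree \<phi>"
  obtains \<theta> \<sigma> where "\<And>a. \<exists>g. a = poly (map_poly \<phi> g) \<theta>" "\<exists>es. length es = n \<and> algebra_basis \<phi> es"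
    "\<And>i. i < n \<Longrightarrow> comm_ring_hom (\<sigma> i)" "\<And>i b. i < n \<Longrightarrow> \<sigma> i (\<phi> b) = (\<psi> \<circ> \<phi>) b"
    "inj_on (\<lambda>i. \<sigma> i \<theta>) {..<n}" "\<exists>i<n. \<sigma> i = \<psi>"
proof -
  interpret \<phi>: field_hom \<phi> by fact
  interpret \<psi>: field_hom \<psi> by fact
  interpret V: vector_space "alg_scale \<phi>" by (rule \<phi>.vector_space_alg_scale)
  define \<chi> where "\<chi> = \<psi> \<circ> \<phi>"
  have \<chi>_apply: "\<chi> b = \<psi> (\<phi> b)" for b by (simp add: \<chi>_def)
  interpret \<chi>: field_hom \<chi>
    by unfold_locales (simp_all add: \<chi>_apply \<phi>.hom_add \<psi>.hom_add \<phi>.hom_mult \<psi>.hom_mult)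
  have \<chi>\<psi>: "poly (map_poly \<chi> g) (\<psi> a) = \<psi> (poly (map_poly \<phi> g) a)" for g a
    by (induction g)
       (simp_all add: \<chi>.map_poly_pCons_hom \<phi>.map_poly_pCons_hom \<psi>.hom_add \<psi>.hom_mult \<chi>_apply)
  obtain E where E: "finite E" "V.span E = UNIV" using fin by (auto simp: finite_extension_def)
  obtain e where e: "bij_betw e {..<card E} E"
    using ex_bij_betw_nat_finite[OF E(1)] by (auto simp: atLeast0LessThan)
  have span: "\<exists>b. a = (\<Sum>i<card E. \<phi> (b i) * e i)" for a
  proof -
    have "a \<in> range (\<lambda>u. \<Sum>v\<in>E. alg_scale \<phi> (u v) v)"
      using E V.span_finite[OF E(1)] by (metis UNIV_I)
    then obtain u where "a = (\<Sum>v\<in>E. alg_scale \<phi> (u v) v)" by blast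
    also have "\<dots> = (\<Sum>i<card E. alg_scale \<phi> (u (e i)) (e i))"
      by (rule sum.reindex_bij_betw[OF e, symmetric])
    finally show ?thesis by (intro exI[of _ "\<lambda>i. u (e i)"]) (simp add: alg_scale_def)
  qed
  obtain \<theta> where \<theta>: "\<And>a. \<exists>g. a = poly (map_poly \<phi> g) \<theta>"
    using primitive_element[OF \<phi> \<psi> normal separable span] by blast
  obtain p where p: "irreducible p" "poly (map_poly \<phi> p) \<theta> = 0" "coprime p (pderiv p)"
    using separable unfolding separable_over_def by blast
  have n: "n = degree p" unfolding n_def by (rule power_basis[OF \<phi> p(1,2) \<theta>])
  have es: "\<exists>es. length es = n \<and> algebra_basis \<phi> es"
    using power_basis(1)[OF \<phi> p(1,2) \<theta>] n by (intro exI[of _ "map (\<lambda>k. \<theta> ^ k) [0..<degree p]"]) simp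
  have root: "poly (map_poly \<chi> p) (\<psi> \<theta>) = 0" unfolding \<chi>\<psi> p(2) by simp
  then obtain c xs where xs: "map_poly \<chi> p = smult c (\<Prod>x\<leftarrow>xs. [:- x, 1:])"
    using normal p(1) unfolding normal_over_def \<chi>_def[symmetric] by blast
  note roots = \<chi>.separable_split_roots[OF p(1,3) xs]
  define rep where "rep a = (SOME g. a = poly (map_poly \<phi> g) \<theta>)" for a
  have rep: "a = poly (map_poly \<phi> (rep a)) \<theta>" for a unfolding rep_def by (rule someI_ex[OF \<theta>])
  define \<sigma> where "\<sigma> i a = poly (map_poly \<chi> (rep a)) (xs ! i)" for i a
  have \<sigma>: "\<sigma> i (poly (map_poly \<phi> g) \<theta>) = poly (map_poly \<chi> g) (xs ! i)" if i: "i < n" for i g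
  proof -
    have "xs ! i \<in> {z. poly (map_poly \<chi> p) z = 0}" using i roots n by (metis nth_mem)
    then have r: "poly (map_poly \<chi> p) (xs ! i) = 0" by simp
    define h where "h = rep (poly (map_poly \<phi> g) \<theta>) - g"
    have "poly (map_poly \<phi> h) \<theta> = 0"
      unfolding h_def \<phi>.poly_map_poly_arith(3) rep[symmetric] by simp
    then have "p dvd h" by (rule \<phi>.root_imp_irreducible_dvd[OF p(1,2)])
    then obtain k where k: "h = p * k" by (rule dvdE)
    have "poly (map_poly \<chi> h) (xs ! i) = 0" unfolding k \<chi>.poly_map_poly_arith(2) r by simp
    then show ?thesis unfolding h_def \<chi>.poly_map_poly_arith(3) \<sigma>_def by simp
  qed
  show thesis
  proof (rule that[OF \<theta> es])
    fix i assume i: "i < n"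
    show st: "\<sigma> i (\<phi> b) = (\<psi> \<circ> \<phi>) b" for b
      using \<sigma>[OF i, of "[:b:]"]
      by (simp add: \<phi>.map_poly_pCons_hom \<chi>.map_poly_pCons_hom \<chi>_apply)
    show "comm_ring_hom (\<sigma> i)"
    proof
      show "\<sigma> i (x + y) = \<sigma> i x + \<sigma> i y" for x y
        using \<sigma>[OF i, of "rep x + rep y"]
        unfolding \<phi>.poly_map_poly_arith(1) \<chi>.poly_map_poly_arith(1) rep[symmetric] by (simp add: \<sigma>_def)
      show "\<sigma> i (x * y) = \<sigma> i x * \<sigma> i y" for x y
        using \<sigma>[OF i, of "rep x * rep y"]
        unfolding \<phi>.poly_map_poly_arith(2) \<chi>.poly_map_poly_arith(2) rep[symmetric] by (simp add: \<sigma>_def)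
      show "\<sigma> i 0 = 0" "\<sigma> i 1 = 1" using st[of 0] st[of 1] by simp_all
    qed
  next
    have at: "\<sigma> i \<theta> = xs ! i" if "i < n" for i
      using \<sigma>[OF that, of "[:0, 1:]"] by (simp add: \<phi>.map_poly_pCons_hom \<chi>.map_poly_pCons_hom)
    show "inj_on (\<lambda>i. \<sigma> i \<theta>) {..<n}"
      using at roots(2,3) n by (auto simp: inj_on_def nth_eq_iff_index_eq)
    have "\<psi> \<theta> \<in> set xs" using root roots(1) by blast
    then obtain i where i: "i < n" "xs ! i = \<psi> \<theta>" using roots(3) n by (metis in_set_conv_nth)
    have "\<sigma> i a = \<psi> a" for a
      using \<sigma>[OF i(1), of "rep a"] unfolding rep[symmetric] i(2) \<chi>\<psi> rep[symmetric] .
    then show "\<exists>i<n. \<sigma> i = \<psi>" using i(1) by blast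
  qed
qed

section \<open>Homomorphisms from a ring that is a type\<close>

lemma type_ring_simps [simp]:
  "carrier ring_of_type_algebra = UNIV" "\<zero>\<^bsub>ring_of_type_algebra\<^esub> = 0" "\<one>\<^bsub>ring_of_type_algebra\<^esub> = 1"
  "x \<oplus>\<^bsub>ring_of_type_algebra\<^esub> y = x + y" "x \<otimes>\<^bsub>ring_of_type_algebra\<^esub> y = x * y"
  by (simp_all add: ring_of_type_algebra_def)

lemma type_ring_homI:
  fixes h :: "'r::comm_ring_1 \<Rightarrow> 'x"
  assumes "\<And>x. h x \<in> carrier Q" "\<And>x y. h (x + y) = h x \<oplus>\<^bsub>Q\<^esub> h y" "\<And>x y. h (x * y) = h x \<otimes>\<^bsub>Q\<^esub> h y"
    "h 1 = \<one>\<^bsub>Q\<^esub>"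
  shows "h \<in> Ring.ring_hom ring_of_type_algebra Q"
  using assms by (intro ring_hom_memI) simp_all

context
  fixes h :: "'r::comm_ring_1 \<Rightarrow> 'x" and Q :: "('x, 'q) ring_scheme"
  assumes h: "h \<in> Ring.ring_hom ring_of_type_algebra Q" and Q: "cring Q"
begin

interpretation Q: cring Q by fact

lemma type_ring_hom:
  "h x \<in> carrier Q" "h (x + y) = h x \<oplus>\<^bsub>Q\<^esub> h y" "h (x * y) = h x \<otimes>\<^bsub>Q\<^esub> h y" "h 1 = \<one>\<^bsub>Q\<^esub>" "h 0 = \<zero>\<^bsub>Q\<^esub>"
  "h (- x) = \<ominus>\<^bsub>Q\<^esub> h x" "h (x - y) = h x \<ominus>\<^bsub>Q\<^esub> h y"
proof -
  show *: "h x \<in> carrier Q" "h (x + y) = h x \<oplus>\<^bsub>Q\<^esub> h y" "h (x * y) = h x \<otimes>\<^bsub>Q\<^esub> h y" for x y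
    using ring_hom_closed[OF h] ring_hom_add[OF h] ring_hom_mult[OF h] by simp_all
  show "h 1 = \<one>\<^bsub>Q\<^esub>" using ring_hom_one[OF h] by simp
  show 0: "h 0 = \<zero>\<^bsub>Q\<^esub>"
    using *(2)[of 0 0] *(1)[of 0] by (metis Q.add.l_cancel_one' add_0)
  show **: "h (- x) = \<ominus>\<^bsub>Q\<^esub> h x" for x
    using *(2)[of "- x" x] *(1) 0 by (simp add: Q.sum_zero_eq_neg)
  show "h (x - y) = h x \<ominus>\<^bsub>Q\<^esub> h y"
    using *(2)[of x "- y"] **[of y] by (simp add: a_minus_def)
qed

lemma type_ring_hom_finsum: "finite I \<Longrightarrow> h (sum f I) = (\<Oplus>\<^bsub>Q\<^esub>i\<in>I. h (f i))"
  by (induction I rule: finite_induct) (simp_all add: type_ring_hom)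

lemma type_ring_hom_finprod: "finite I \<Longrightarrow> h (prod f I) = (\<Otimes>\<^bsub>Q\<^esub>i\<in>I. h (f i))"
  by (induction I rule: finite_induct) (simp_all add: type_ring_hom)

lemma ring_ideal_kernel: "ring_ideal {x. h x = \<zero>\<^bsub>Q\<^esub>}"
  by (simp add: ring_ideal_def type_ring_hom)

lemma type_ring_hom_eq_iff: "h x = h y \<longleftrightarrow> h (x - y) = \<zero>\<^bsub>Q\<^esub>"
  using type_ring_hom(1)[of x] type_ring_hom(1)[of y] by (simp add: type_ring_hom(7) Q.r_right_minus_eq)

text \<open>
  A homomorphism that identifies what a surjection identifies factors through it. This serves for both
  quotient steps in the construction of the \<open>S\<^sub>n\<close>-closure, and for the final isomorphism.
\<close>

lemma factor_through:
  assumes surj: "range h = carrier Q" and g: "g \<in> Ring.ring_hom ring_of_type_algebra U"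
    and wd: "\<And>x y. h x = h y \<Longrightarrow> g x = g y"
  shows "\<exists>k\<in>Ring.ring_hom Q U. \<forall>x. k (h x) = g x"
proof -
  define k where "k Z = g (SOME x. h x = Z)" for Z
  have k: "k (h x) = g x" for x
    unfolding k_def by (rule wd) (rule someI[of "\<lambda>y. h y = h x" x], rule refl)
  have "k \<in> Ring.ring_hom Q U"
  proof (rule ring_hom_memI)
    show "k \<one>\<^bsub>Q\<^esub> = \<one>\<^bsub>U\<^esub>" using k[of 1] ring_hom_one[OF g] by (simp add: type_ring_hom)
    fix Z V assume "Z \<in> carrier Q" "V \<in> carrier Q"
    then obtain x y where xy: "Z = h x" "V = h y" using surj by (metis rangeE)
    show "k Z \<in> carrier U" using ring_hom_closed[OF g] by (simp add: xy k)
    show "k (Z \<otimes>\<^bsub>Q\<^esub> V) = k Z \<otimes>\<^bsub>U\<^esub> k V"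
      using ring_hom_mult[OF g, of x y] k[of "x * y"] by (simp add: xy k type_ring_hom)
    show "k (Z \<oplus>\<^bsub>Q\<^esub> V) = k Z \<oplus>\<^bsub>U\<^esub> k V"
      using ring_hom_add[OF g, of x y] k[of "x + y"] by (simp add: xy k type_ring_hom)
  qed
  then show ?thesis using k by blast
qed

end

lemma quotient_coset_zero_iff:
  assumes "ideal I R" "x \<in> carrier R"
  shows "I +>\<^bsub>R\<^esub> x = \<zero>\<^bsub>R Quot I\<^esub> \<longleftrightarrow> x \<in> I"
proof -
  interpret ideal I R by fact
  show ?thesis using a_rcos_const[of x] a_rcos_self[OF assms(2)] by (auto simp: FactRing_def)
qed

lemma quotient_carrier: "carrier (R Quot I) = (\<lambda>x. I +>\<^bsub>R\<^esub> x) ` carrier R"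
  by (auto simp: FactRing_def A_RCOSETS_def' )

lemma genideal_subset_kernel:
  assumes "cring R" and h: "h \<in> Ring.ring_hom R (ring_of_type_algebra :: 'r::comm_ring_1 ring)"
    and G: "G \<subseteq> carrier R" "\<And>x. x \<in> G \<Longrightarrow> h x = 0"
    and x: "x \<in> Idl\<^bsub>R\<^esub> G"
  shows "h x = 0"
proof -
  interpret R: cring R by fact
  interpret T: cring "ring_of_type_algebra :: 'r ring" by (rule cring_from_type_algebra)
  interpret H: ring_hom_ring R "ring_of_type_algebra :: 'r ring" h
    by (rule ring_hom_ringI2[OF R.ring_axioms T.ring_axioms h])
  have "Idl\<^bsub>R\<^esub> G \<subseteq> a_kernel R ring_of_type_algebra h"
  proof (rule R.genideal_minimal[OF H.kernel_is_ideal])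
    show "G \<subseteq> a_kernel R ring_of_type_algebra h"
      unfolding a_kernel_def' using G by fastforce
  qed
  with x have "x \<in> a_kernel R ring_of_type_algebra h" by blast
  then show ?thesis unfolding a_kernel_def' by simp
qed

section \<open>The monoid algebra of tuples\<close>

text \<open>
  Infinite sequences under componentwise multiplication, written additively. Then
  \<open>'a tuple \<Rightarrow>\<^sub>0 'b\<close> with the convolution product is a commutative ring that is a type; it maps onto
  the algebra of \<open>n\<close>-tuples for every \<open>n\<close> by truncation.
\<close>

datatype 'a tuple = Tuple (entries: "nat \<Rightarrow> 'a")

instantiation tuple :: (comm_monoid_mult) comm_monoid_add
begin

definition "0 = Tuple (\<lambda>_. 1)"
definition "u + v = Tuple (\<lambda>i. entries u i * entries v i)"

instance
  by standard (auto simp: zero_tuple_def plus_tuple_def ac_simps intro: tuple.expand)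

end

lemma entries_simps [simp]: "entries 0 i = 1" "entries (u + v) i = entries u i * entries v i"
  by (simp_all add: zero_tuple_def plus_tuple_def)

definition linear_extension ::
    "('b::comm_ring_1 \<Rightarrow> 'c::comm_ring_1) \<Rightarrow> ('k \<Rightarrow> 'c) \<Rightarrow> ('k \<Rightarrow>\<^sub>0 'b) \<Rightarrow> 'c" where
  "linear_extension \<chi> w x = (\<Sum>u\<in>Poly_Mapping.keys x. \<chi> (Poly_Mapping.lookup x u) * w u)"

context
  fixes \<chi> :: "'b::comm_ring_1 \<Rightarrow> 'c::comm_ring_1"
  assumes \<chi>: "comm_ring_hom \<chi>"
begin

interpretation \<chi>: comm_ring_hom \<chi> by fact

lemma linear_extension_superset:
  assumes "finite U" "Poly_Mapping.keys x \<subseteq> U"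
  shows "linear_extension \<chi> w x = (\<Sum>u\<in>U. \<chi> (Poly_Mapping.lookup x u) * w u)"
  unfolding linear_extension_def using assms
  by (intro sum.mono_neutral_left) (auto simp: in_keys_iff)

lemma linear_extension_single [simp]: "linear_extension \<chi> w (Poly_Mapping.single u b) = \<chi> b * w u"
  by (subst linear_extension_superset[of "{u}"]) auto

lemma linear_extension_add: "linear_extension \<chi> w (x + y) = linear_extension \<chi> w x + linear_extension \<chi> w y"
proof -
  let ?U = "Poly_Mapping.keys x \<union> Poly_Mapping.keys y"
  have "Poly_Mapping.keys (x + y) \<subseteq> ?U" by (rule Poly_Mapping.keys_add)
  then show ?thesis
    by (subst (1 2 3) linear_extension_superset[of ?U])
       (auto simp: lookup_add \<chi>.hom_add distrib_right sum.distrib)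
qed

lemma linear_extension_hom:
  fixes w :: "'k::comm_monoid_add \<Rightarrow> 'c"
  assumes w: "w 0 = 1" "\<And>u v. w (u + v) = w u * w v"
  shows "comm_ring_hom (linear_extension \<chi> w)"
proof
  show zero: "linear_extension \<chi> w 0 = 0" by (simp add: linear_extension_def)
  show "linear_extension \<chi> w 1 = 1"
    using linear_extension_single[of w 0 1] by (simp add: w)
  show "linear_extension \<chi> w (x + y) = linear_extension \<chi> w x + linear_extension \<chi> w y" for x y
    by (rule linear_extension_add)
  show "linear_extension \<chi> w (x * y) = linear_extension \<chi> w x * linear_extension \<chi> w y" for x y
  proof (induction x rule: poly_mapping_additive_induct)
    case (single u a)
    show ?case
      by (induction y rule: poly_mapping_additive_induct)
         (simp_all add: mult_single w \<chi>.hom_mult linear_extension_add zero distrib_left mult.assoc mult.left_commute)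
  qed (simp_all add: linear_extension_add zero distrib_right)
qed

end

definition scalar :: "'b::comm_ring_1 \<Rightarrow> 'k::comm_monoid_add \<Rightarrow>\<^sub>0 'b" where
  "scalar b = Poly_Mapping.single 0 b"

lemma scalar_hom: "comm_ring_hom scalar"
  by standard (simp_all add: scalar_def single_add mult_single)

definition embed :: "nat \<Rightarrow> 'a::comm_ring_1 \<Rightarrow> 'a tuple \<Rightarrow>\<^sub>0 'b::comm_ring_1" where
  "embed i a = Poly_Mapping.single (Tuple ((\<lambda>_. 1)(i := a))) 1"

definition to_tuple_algebra ::
    "nat \<Rightarrow> ('a::comm_ring_1 tuple \<Rightarrow>\<^sub>0 'b::comm_ring_1) \<Rightarrow> ('a list \<Rightarrow>\<^sub>0 'b)" where
  "to_tuple_algebra n x = (\<Sum>u\<in>Poly_Mapping.keys x.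
     Poly_Mapping.single (map (entries u) [0..<n]) (Poly_Mapping.lookup x u))"

lemma to_tuple_algebra_single [simp]:
  "to_tuple_algebra n (Poly_Mapping.single u b) = Poly_Mapping.single (map (entries u) [0..<n]) b"
  by (simp add: to_tuple_algebra_def)

lemma to_tuple_algebra_add: "to_tuple_algebra n (x + y) = to_tuple_algebra n x + to_tuple_algebra n y"
proof -
  let ?U = "Poly_Mapping.keys x \<union> Poly_Mapping.keys y"
  have superset: "to_tuple_algebra n z =
      (\<Sum>u\<in>?U. Poly_Mapping.single (map (entries u) [0..<n]) (Poly_Mapping.lookup z u))"
    if "Poly_Mapping.keys z \<subseteq> ?U" for z :: "'a tuple \<Rightarrow>\<^sub>0 'b"
    unfolding to_tuple_algebra_def using that
    by (intro sum.mono_neutral_left) (auto simp: in_keys_iff)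
  show ?thesis
    using superset[of x] superset[of y] superset[of "x + y"] Poly_Mapping.keys_add[of x y]
    by (simp add: lookup_add single_add sum.distrib)
qed

lemma to_tuple_algebra_zero [simp]: "to_tuple_algebra n 0 = 0"
  by (simp add: to_tuple_algebra_def)

lemma to_tuple_algebra_hom: "to_tuple_algebra n \<in> Ring.ring_hom ring_of_type_algebra (tuple_algebra n)"
proof (rule type_ring_homI)
  have map2: "map (entries (u + v)) [0..<n] = map2 (*) (map (entries u) [0..<n]) (map (entries v) [0..<n])"
    for u v :: "'a tuple" by (intro nth_equalityI) auto
  show "to_tuple_algebra n x \<in> carrier (tuple_algebra n)" for x :: "'a tuple \<Rightarrow>\<^sub>0 'b"
  proof (induction x rule: poly_mapping_additive_induct)
    case (add x y)
    then show ?case using Poly_Mapping.keys_add[of "to_tuple_algebra n x" "to_tuple_algebra n y"]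
      by (auto simp: tuple_algebra_def to_tuple_algebra_add)
  qed (auto simp: tuple_algebra_def)
  show "to_tuple_algebra n (x + y) = to_tuple_algebra n x \<oplus>\<^bsub>tuple_algebra n\<^esub> to_tuple_algebra n y"
    for x y :: "'a tuple \<Rightarrow>\<^sub>0 'b" by (simp add: tuple_algebra_def to_tuple_algebra_add)
  show "to_tuple_algebra n (x * y) = to_tuple_algebra n x \<otimes>\<^bsub>tuple_algebra n\<^esub> to_tuple_algebra n y"
    for x y :: "'a tuple \<Rightarrow>\<^sub>0 'b"
  proof (induction x rule: poly_mapping_additive_induct)
    case (single u a)
    show ?case
      by (induction y rule: poly_mapping_additive_induct)
         (simp_all add: tuple_algebra_def mult_single map2 to_tuple_algebra_add distrib_left
           tuple_times_add_right del: map_map)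
  qed (simp_all add: tuple_algebra_def to_tuple_algebra_add distrib_right tuple_times_add_left)
  have "map (entries (0 :: 'a tuple)) [0..<n] = replicate n 1" by (intro nth_equalityI) auto
  then show "to_tuple_algebra n (1 :: 'a tuple \<Rightarrow>\<^sub>0 'b) = \<one>\<^bsub>tuple_algebra n\<^esub>"
    using to_tuple_algebra_single[of n "0 :: 'a tuple" "1 :: 'b"] by (simp add: tuple_algebra_def)
qed

definition tuple_of_list :: "'a::comm_ring_1 list \<Rightarrow> 'a tuple" where
  "tuple_of_list xs = Tuple (\<lambda>i. if i < length xs then xs ! i else 1)"

lemma map_entries_tuple_of_list [simp]:
  "length xs = n \<Longrightarrow> map (entries (tuple_of_list xs)) [0..<n] = xs"
  by (intro nth_equalityI) (auto simp: tuple_of_list_def)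

lemma to_tuple_algebra_surj: "range (to_tuple_algebra n) = carrier (tuple_algebra n)"
proof
  show "range (to_tuple_algebra n) \<subseteq> carrier (tuple_algebra n :: ('a list \<Rightarrow>\<^sub>0 'b) ring)"
    using ring_hom_closed[OF to_tuple_algebra_hom] by auto
  show "carrier (tuple_algebra n) \<subseteq> range (to_tuple_algebra n :: ('a tuple \<Rightarrow>\<^sub>0 'b) \<Rightarrow> _)"
  proof
    fix f :: "'a list \<Rightarrow>\<^sub>0 'b" assume f: "f \<in> carrier (tuple_algebra n)"
    have sum: "to_tuple_algebra n (sum g I) = (\<Sum>i\<in>I. to_tuple_algebra n (g i))"
      for g :: "'a list \<Rightarrow> 'a tuple \<Rightarrow>\<^sub>0 'b" and I
      by (induction I rule: infinite_finite_induct) (simp_all add: to_tuple_algebra_add)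
    have "to_tuple_algebra n (\<Sum>xs\<in>Poly_Mapping.keys f.
        Poly_Mapping.single (tuple_of_list xs) (Poly_Mapping.lookup f xs))
      = (\<Sum>xs\<in>Poly_Mapping.keys f. Poly_Mapping.single xs (Poly_Mapping.lookup f xs))"
      unfolding sum using f by (intro sum.cong refl) (simp add: tuple_algebra_def)
    then show "f \<in> range (to_tuple_algebra n)" unfolding sum_single_lookup by (metis rangeI)
  qed
qed

section \<open>The closure as a quotient of the monoid algebra\<close>

definition to_tensor_power ::
    "('b::comm_ring_1 \<Rightarrow> 'a::comm_ring_1) \<Rightarrow> nat \<Rightarrow> ('a tuple \<Rightarrow>\<^sub>0 'b) \<Rightarrow> ('a list \<Rightarrow>\<^sub>0 'b) set" where
  "to_tensor_power \<phi> n = (\<lambda>f. tensor_ideal \<phi> n +>\<^bsub>tuple_algebra n\<^esub> f) \<circ> to_tuple_algebra n"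

definition to_Sn_closure ::
    "('b::comm_ring_1 \<Rightarrow> 'a::comm_ring_1) \<Rightarrow> nat \<Rightarrow> ('a tuple \<Rightarrow>\<^sub>0 'b) \<Rightarrow> ('a list \<Rightarrow>\<^sub>0 'b) set set" where
  "to_Sn_closure \<phi> n = (\<lambda>f. Sn_ideal \<phi> n +>\<^bsub>tensor_power \<phi> n\<^esub> f) \<circ> to_tensor_power \<phi> n"

text \<open>
  The \<open>S\<^sub>n\<close>-closure is the monoid algebra modulo this ideal.
\<close>

definition Sn_kernel ::
    "('b::comm_ring_1 \<Rightarrow> 'a::comm_ring_1) \<Rightarrow> nat \<Rightarrow> ('a tuple \<Rightarrow>\<^sub>0 'b) set" where
  "Sn_kernel \<phi> n = {x. to_Sn_closure \<phi> n x = \<zero>\<^bsub>Sn_closure \<phi> n\<^esub>}"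

definition embed_esym :: "nat \<Rightarrow> nat \<Rightarrow> 'a::comm_ring_1 \<Rightarrow> 'a tuple \<Rightarrow>\<^sub>0 'b::comm_ring_1" where
  "embed_esym n j a = (\<Sum>S\<in>{S. S \<subseteq> {..<n} \<and> card S = j}. \<Prod>i\<in>S. embed i a)"

context
  fixes \<phi> :: "'b::comm_ring_1 \<Rightarrow> 'a::comm_ring_1" and n :: nat
begin

lemma to_tensor_power_hom: "to_tensor_power \<phi> n \<in> Ring.ring_hom ring_of_type_algebra (tensor_power \<phi> n)"
  unfolding to_tensor_power_def tensor_power_def
  by (rule ring_hom_trans[OF to_tuple_algebra_hom ideal.rcos_ring_hom[OF ideal_tensor_ideal]])

lemma to_tensor_power_surj: "range (to_tensor_power \<phi> n) = carrier (tensor_power \<phi> n)"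
  unfolding to_tensor_power_def tensor_power_def quotient_carrier to_tuple_algebra_surj[symmetric]
  by (rule image_comp[symmetric])

lemma to_tensor_power_zero_iff:
  "to_tensor_power \<phi> n x = \<zero>\<^bsub>tensor_power \<phi> n\<^esub> \<longleftrightarrow> to_tuple_algebra n x \<in> tensor_ideal \<phi> n"
  unfolding to_tensor_power_def tensor_power_def o_apply
  by (rule quotient_coset_zero_iff[OF ideal_tensor_ideal]) (use to_tuple_algebra_surj in blast)

lemma to_Sn_closure_hom: "to_Sn_closure \<phi> n \<in> Ring.ring_hom ring_of_type_algebra (Sn_closure \<phi> n)"
  unfolding to_Sn_closure_def Sn_closure_def
  by (rule ring_hom_trans[OF to_tensor_power_hom ideal.rcos_ring_hom[OF ideal_Sn_ideal]])

lemma to_Sn_closure_surj: "range (to_Sn_closure \<phi> n) = carrier (Sn_closure \<phi> n)"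
  unfolding to_Sn_closure_def Sn_closure_def quotient_carrier to_tensor_power_surj[symmetric]
  by (rule image_comp[symmetric])

lemma Sn_kernel_iff: "x \<in> Sn_kernel \<phi> n \<longleftrightarrow> to_tensor_power \<phi> n x \<in> Sn_ideal \<phi> n"
  unfolding Sn_kernel_def to_Sn_closure_def Sn_closure_def o_apply mem_Collect_eq
  by (rule quotient_coset_zero_iff[OF ideal_Sn_ideal]) (use to_tensor_power_surj in blast)

lemma ring_ideal_Sn_kernel: "ring_ideal (Sn_kernel \<phi> n)"
  unfolding Sn_kernel_def by (rule ring_ideal_kernel[OF to_Sn_closure_hom cring_Sn_closure])

lemma to_tuple_algebra_diff:
  "to_tuple_algebra n (x - y) = to_tuple_algebra n x - to_tuple_algebra n y"
  using to_tuple_algebra_add[of n "x - y" y] by (simp add: algebra_simps)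

lemma to_tuple_algebra_scalar_mult_single:
  "to_tuple_algebra n (scalar b * Poly_Mapping.single u c) = Poly_Mapping.single (map (entries u) [0..<n]) (b * c)"
  by (simp add: scalar_def mult_single)

lemma to_tuple_algebra_embed:
  "i < n \<Longrightarrow> to_tuple_algebra n (embed i a) = Poly_Mapping.single ((replicate n 1)[i := a]) 1"
  unfolding embed_def to_tuple_algebra_single
  by (rule arg_cong[where f = "\<lambda>xs. Poly_Mapping.single xs 1"]) (auto intro!: nth_equalityI simp: nth_list_update)

lemma to_tensor_power_embed:
  "i < n \<Longrightarrow> to_tensor_power \<phi> n (embed i a) = tensor_embed \<phi> n i a"
  by (simp add: to_tensor_power_def tensor_embed_def pure_tensor_def to_tuple_algebra_embed)

lemma to_tensor_power_scalar: "to_tensor_power \<phi> n (scalar b) = tensor_scalar \<phi> n b"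
proof -
  have "map (entries (0 :: 'a tuple)) [0..<n] = replicate n 1" by (intro nth_equalityI) auto
  then show ?thesis by (simp add: to_tensor_power_def tensor_scalar_def scalar_def)
qed

lemma to_Sn_closure_scalar: "to_Sn_closure \<phi> n (scalar b) = Sn_scalar \<phi> n b"
  by (simp add: to_Sn_closure_def Sn_scalar_def to_tensor_power_scalar)

lemma to_tensor_power_esym: "to_tensor_power \<phi> n (embed_esym n j a) = tensor_esym \<phi> n j a"
proof -
  interpret P: cring "tensor_power \<phi> n" by (rule cring_tensor_power)
  have fin: "finite {S. S \<subseteq> {..<n} \<and> card S = j}" by simp
  show ?thesis
    unfolding embed_esym_def tensor_esym_def
      type_ring_hom_finsum[OF to_tensor_power_hom cring_tensor_power fin]
  proof (rule P.finsum_cong'[OF refl])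
    show "(\<lambda>S. \<Otimes>\<^bsub>tensor_power \<phi> n\<^esub>i\<in>S. tensor_embed \<phi> n i a)
        \<in> {S. S \<subseteq> {..<n} \<and> card S = j} \<rightarrow> carrier (tensor_power \<phi> n)"
      by (intro funcsetI P.finprod_closed) (auto simp: tensor_embed_closed)
    fix S assume S: "S \<in> {S. S \<subseteq> {..<n} \<and> card S = j}"
    then have fS: "finite S" by (auto intro: finite_subset)
    show "to_tensor_power \<phi> n (\<Prod>i\<in>S. embed i a) = (\<Otimes>\<^bsub>tensor_power \<phi> n\<^esub>i\<in>S. tensor_embed \<phi> n i a)"
      unfolding type_ring_hom_finprod[OF to_tensor_power_hom cring_tensor_power fS]
      using S by (intro P.finprod_cong') (auto simp: tensor_embed_closed to_tensor_power_embed)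
  qed
qed

lemma tensor_ideal_imp_Sn_kernel:
  assumes "to_tuple_algebra n x \<in> tensor_ideal \<phi> n"
  shows "x \<in> Sn_kernel \<phi> n"
proof -
  have "to_tensor_power \<phi> n x = \<zero>\<^bsub>tensor_power \<phi> n\<^esub>" using assms by (simp add: to_tensor_power_zero_iff)
  then show ?thesis
    using additive_subgroup.zero_closed[OF ideal.axioms(1)[OF ideal_Sn_ideal]] by (simp add: Sn_kernel_iff)
qed

lemma tensor_relations_in_ideal: "tensor_relations \<phi> n \<subseteq> tensor_ideal \<phi> n"
  unfolding tensor_ideal_def
  by (intro ring.genideal_self cring.axioms cring_tuple_algebra tensor_relations_carrier)

lemma embed_add_mod:
  assumes "i < n"
  shows "embed i (a + a') - (embed i a + embed i a') \<in> Sn_kernel \<phi> n"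
proof (rule tensor_ideal_imp_Sn_kernel)
  have "to_tuple_algebra n (embed i (a + a') - (embed i a + embed i a') :: 'a tuple \<Rightarrow>\<^sub>0 'b)
      \<in> tensor_relations \<phi> n"
    unfolding tensor_relations_def
    by (intro UnI1 CollectI exI[of _ "replicate n 1"] exI[of _ i] exI[of _ a] exI[of _ a'])
       (use assms in \<open>simp add: to_tuple_algebra_diff to_tuple_algebra_add to_tuple_algebra_embed\<close>)
  then show "to_tuple_algebra n (embed i (a + a') - (embed i a + embed i a') :: 'a tuple \<Rightarrow>\<^sub>0 'b) \<in> tensor_ideal \<phi> n"
    using tensor_relations_in_ideal by blast
qed

lemma embed_scale_mod:
  assumes "i < n"
  shows "embed i (\<phi> b * a) - scalar b * embed i a \<in> Sn_kernel \<phi> n"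
proof (rule tensor_ideal_imp_Sn_kernel)
  have "to_tuple_algebra n (scalar b * embed i a) = Poly_Mapping.single ((replicate n 1)[i := a]) b"
    unfolding embed_def to_tuple_algebra_scalar_mult_single mult_1_right using assms
    by (intro arg_cong[where f = "\<lambda>xs. Poly_Mapping.single xs b"]) (auto intro!: nth_equalityI simp: nth_list_update)
  then have "to_tuple_algebra n (embed i (\<phi> b * a) - scalar b * embed i a) \<in> tensor_relations \<phi> n"
    unfolding tensor_relations_def
    by (intro UnI2 CollectI exI[of _ "replicate n 1"] exI[of _ i] exI[of _ a] exI[of _ b])
       (use assms in \<open>simp add: to_tuple_algebra_diff to_tuple_algebra_embed\<close>)
  then show "to_tuple_algebra n (embed i (\<phi> b * a) - scalar b * embed i a) \<in> tensor_ideal \<phi> n"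
    using tensor_relations_in_ideal by blast
qed

lemma prod_embed:
  "(\<Prod>i<k. embed i (f i)) = Poly_Mapping.single (Tuple (\<lambda>i. if i < k then f i else 1)) 1"
proof (induction k)
  case 0
  have "Tuple (\<lambda>_. 1) = (0 :: 'c tuple)" by (simp add: zero_tuple_def)
  then show ?case by simp
next
  case (Suc k)
  then show ?case
    by (simp add: embed_def mult_single plus_tuple_def) (rule arg_cong, auto simp: less_Suc_eq)
qed

text \<open>
  Only the first \<open>n\<close> entries of a tuple survive truncation, and a pure tensor is the product of its
  embedded entries.
\<close>

lemma single_mod:
  "Poly_Mapping.single u b - scalar b * (\<Prod>i<n. embed i (entries u i)) \<in> Sn_kernel \<phi> n"
proof (rule tensor_ideal_imp_Sn_kernel)
  have eq: "map (\<lambda>i. if i < n then entries u i else 1) [0..<n] = map (entries u) [0..<n]"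
    by (intro map_cong) auto
  have "to_tuple_algebra n (Poly_Mapping.single u b - scalar b * (\<Prod>i<n. embed i (entries u i))) = 0"
    unfolding prod_embed to_tuple_algebra_diff to_tuple_algebra_scalar_mult_single to_tuple_algebra_single
      tuple.sel eq by simp
  moreover have "0 \<in> tensor_ideal \<phi> n"
    using additive_subgroup.zero_closed[OF ideal.axioms(1)[OF ideal_tensor_ideal[of \<phi> n]]]
    by (simp add: tuple_algebra_def)
  ultimately show "to_tuple_algebra n (Poly_Mapping.single u b - scalar b * (\<Prod>i<n. embed i (entries u i)))
      \<in> tensor_ideal \<phi> n" by simp
qed

lemma esym_mod:
  assumes "1 \<le> j" "j \<le> n"
  shows "scalar (s_coeff \<phi> n j a) - embed_esym n j a \<in> Sn_kernel \<phi> n"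
proof -
  interpret P: cring "tensor_power \<phi> n" by (rule cring_tensor_power)
  let ?G = "{tensor_scalar \<phi> n (s_coeff \<phi> n j a) \<ominus>\<^bsub>tensor_power \<phi> n\<^esub> tensor_esym \<phi> n j a
        | a j. 1 \<le> j \<and> j \<le> n}"
  note hom = type_ring_hom[OF to_tensor_power_hom cring_tensor_power]
  have "?G \<subseteq> carrier (tensor_power \<phi> n)"
    using hom(1) by (auto simp: tensor_scalar_closed to_tensor_power_esym[symmetric])
  then have "?G \<subseteq> Sn_ideal \<phi> n" unfolding Sn_ideal_def by (rule P.genideal_self)
  then show ?thesis
    using assms unfolding Sn_kernel_iff hom(7) to_tensor_power_scalar to_tensor_power_esym by blast
qed

end

text \<open>
  The universal property of the closure: a product of \<open>n\<close> homomorphisms that satisfies the symmetric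
  function relations kills the multilinear relations, so it descends to the tensor power, and there it
  kills the generators of the second ideal.
\<close>

lemma Sn_kernel_universal:
  fixes \<phi> :: "'b::comm_ring_1 \<Rightarrow> 'a::comm_ring_1" and \<chi> :: "'b \<Rightarrow> 'c::comm_ring_1"
  assumes \<chi>: "comm_ring_hom \<chi>"
    and \<rho>: "\<And>i. i < n \<Longrightarrow> comm_ring_hom (\<rho> i)" "\<And>i b. i < n \<Longrightarrow> \<rho> i (\<phi> b) = \<chi> b"
    and esym: "\<And>j a. 1 \<le> j \<Longrightarrow> j \<le> n \<Longrightarrow>
      \<chi> (s_coeff \<phi> n j a) = (\<Sum>S\<in>{S. S \<subseteq> {..<n} \<and> card S = j}. \<Prod>i\<in>S. \<rho> i a)"
    and x: "x \<in> Sn_kernel \<phi> n"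
  shows "linear_extension \<chi> (\<lambda>u. \<Prod>i<n. \<rho> i (entries u i)) x = 0"
proof -
  interpret \<chi>: comm_ring_hom \<chi> by fact
  have \<rho>_arith: "\<rho> i 1 = 1" "\<rho> i (a * b) = \<rho> i a * \<rho> i b" "\<rho> i (a + b) = \<rho> i a + \<rho> i b" if "i < n" for i a b
  proof -
    interpret comm_ring_hom "\<rho> i" by (rule \<rho>(1)[OF that])
    show "\<rho> i 1 = 1" "\<rho> i (a * b) = \<rho> i a * \<rho> i b" "\<rho> i (a + b) = \<rho> i a + \<rho> i b"
      by (simp_all add: hom_mult hom_add)
  qed
  define w where "w = (\<lambda>u. \<Prod>i<n. \<rho> i (entries u i))"
  define ev where "ev = linear_extension \<chi> w"
  interpret ev: comm_ring_hom ev
    unfolding ev_def by (rule linear_extension_hom[OF \<chi>]) (simp_all add: w_def \<rho>_arith prod.distrib)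
  have ev_single: "ev (Poly_Mapping.single u b) = \<chi> b * w u" for u b
    by (simp add: ev_def linear_extension_single[OF \<chi>])
  have ev_ring: "ev \<in> Ring.ring_hom ring_of_type_algebra (ring_of_type_algebra :: 'c ring)"
    by (rule type_ring_homI) (simp_all add: ev.hom_add ev.hom_mult)
  have T: "cring (ring_of_type_algebra :: 'c ring)" by (rule cring_from_type_algebra)
  define evl where "evl f = linear_extension \<chi> (\<lambda>xs. \<Prod>i<n. \<rho> i (xs ! i)) f" for f
  have evl: "evl (to_tuple_algebra n x) = ev x" for x
  proof (induction x rule: poly_mapping_additive_induct)
    case zero
    show ?case by (simp add: evl_def linear_extension_def)
  next
    case (single u a)
    show ?case by (simp add: evl_def ev_single linear_extension_single[OF \<chi>] w_def)
  next
    case (add x y)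
    then show ?case by (simp add: to_tuple_algebra_add ev.hom_add evl_def linear_extension_add[OF \<chi>])
  qed
  obtain h1 where h1: "h1 \<in> Ring.ring_hom (tuple_algebra n) (ring_of_type_algebra :: 'c ring)"
    "\<And>x. h1 (to_tuple_algebra n x) = ev x"
    using factor_through[OF to_tuple_algebra_hom cring_tuple_algebra to_tuple_algebra_surj ev_ring]
    by (metis evl)
  have h1_eq: "h1 f = evl f" if "f \<in> carrier (tuple_algebra n)" for f
    using that h1(2) evl unfolding to_tuple_algebra_surj[symmetric] by auto
  have evl_single: "evl (Poly_Mapping.single xs b) = \<chi> b * (\<Prod>i<n. \<rho> i (xs ! i))" for xs b
    by (simp add: evl_def linear_extension_single[OF \<chi>])
  have evl_diff: "evl (f - g) = evl f - evl g" for f g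
    using linear_extension_add[OF \<chi>, of "\<lambda>xs. \<Prod>i<n. \<rho> i (xs ! i)" "f - g" g] by (simp add: evl_def algebra_simps)
  have prod_update: "(\<Prod>k<n. \<rho> k (xs[i := c] ! k)) = \<rho> i c * (\<Prod>k\<in>{..<n} - {i}. \<rho> k (xs ! k))"
    if "length xs = n" "i < n" for xs i c
  proof -
    have "(\<Prod>k<n. \<rho> k (xs[i := c] ! k)) = \<rho> i (xs[i := c] ! i) * (\<Prod>k\<in>{..<n} - {i}. \<rho> k (xs[i := c] ! k))"
      using that by (intro prod.remove) auto
    also have "(\<Prod>k\<in>{..<n} - {i}. \<rho> k (xs[i := c] ! k)) = (\<Prod>k\<in>{..<n} - {i}. \<rho> k (xs ! k))"
      by (intro prod.cong) auto
    finally show ?thesis using that by simp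
  qed
  have h1_ideal: "h1 f = 0" if "f \<in> tensor_ideal \<phi> n" for f
  proof (rule genideal_subset_kernel[OF cring_tuple_algebra h1(1) tensor_relations_carrier])
    show "f \<in> Idl\<^bsub>tuple_algebra n\<^esub> tensor_relations \<phi> n" using that by (simp add: tensor_ideal_def)
    fix r assume r: "r \<in> tensor_relations \<phi> n"
    then have "h1 r = evl r" using tensor_relations_carrier by (intro h1_eq) blast
    also have "evl r = 0"
      using r unfolding tensor_relations_def
    proof (elim UnE CollectE exE conjE)
      fix xs i a a'
      assume "r = Poly_Mapping.single (xs[i := a + a']) 1 - Poly_Mapping.single (xs[i := a]) 1
          - Poly_Mapping.single (xs[i := a']) 1" "length xs = n" "i < n"
      then show ?thesis by (simp add: evl_diff evl_single prod_update \<rho>_arith distrib_right)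
    next
      fix xs i b a
      assume "r = Poly_Mapping.single (xs[i := \<phi> b * a]) 1 - Poly_Mapping.single (xs[i := a]) b"
        "length xs = n" "i < n"
      then show ?thesis by (simp add: evl_diff evl_single prod_update \<rho>_arith \<rho>(2) mult.assoc)
    qed
    finally show "h1 r = 0" .
  qed
  have wd1: "ev x = ev y" if "to_tensor_power \<phi> n x = to_tensor_power \<phi> n y" for x y
  proof -
    have "to_tensor_power \<phi> n (x - y) = \<zero>\<^bsub>tensor_power \<phi> n\<^esub>"
      using that type_ring_hom_eq_iff[OF to_tensor_power_hom cring_tensor_power] by blast
    then have "ev (x - y) = 0"
      unfolding to_tensor_power_zero_iff using h1_ideal h1(2) by metis
    then show ?thesis by (simp add: ev.hom_minus)
  qed
  obtain h2 where h2: "h2 \<in> Ring.ring_hom (tensor_power \<phi> n) (ring_of_type_algebra :: 'c ring)"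
    "\<And>x. h2 (to_tensor_power \<phi> n x) = ev x"
    using factor_through[OF to_tensor_power_hom cring_tensor_power to_tensor_power_surj ev_ring wd1]
    by metis
  have "ev x = 0"
  proof -
    note hom = type_ring_hom[OF to_tensor_power_hom cring_tensor_power]
    let ?G = "{tensor_scalar \<phi> n (s_coeff \<phi> n j a) \<ominus>\<^bsub>tensor_power \<phi> n\<^esub> tensor_esym \<phi> n j a
        | a j. 1 \<le> j \<and> j \<le> n}"
    have G: "?G = {to_tensor_power \<phi> n (scalar (s_coeff \<phi> n j a) - embed_esym n j a) | a j. 1 \<le> j \<and> j \<le> n}"
      by (simp add: hom(7) to_tensor_power_scalar to_tensor_power_esym)
    have "h2 (to_tensor_power \<phi> n x) = 0"
    proof (rule genideal_subset_kernel[OF cring_tensor_power h2(1)])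
      show "?G \<subseteq> carrier (tensor_power \<phi> n)" unfolding G using hom(1) by blast
      show "to_tensor_power \<phi> n x \<in> Idl\<^bsub>tensor_power \<phi> n\<^esub> ?G"
        using x unfolding Sn_kernel_iff Sn_ideal_def .
      fix r assume "r \<in> ?G"
      then obtain a j where r: "r = to_tensor_power \<phi> n (scalar (s_coeff \<phi> n j a) - embed_esym n j a)"
        and j: "1 \<le> j" "j \<le> n" unfolding G by blast
      have w_embed: "w (Tuple ((\<lambda>_. 1)(i := a))) = \<rho> i a" if "i < n" for i
      proof -
        have "w (Tuple ((\<lambda>_. 1)(i := a))) = (\<Prod>k<n. if k = i then \<rho> i a else 1)"
          unfolding w_def by (intro prod.cong) (auto simp: \<rho>_arith)
        then show ?thesis using that by simp
      qed
      have "ev (embed_esym n j a) = (\<Sum>S\<in>{S. S \<subseteq> {..<n} \<and> card S = j}. \<Prod>i\<in>S. \<rho> i a)"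
        unfolding embed_esym_def ev.hom_sum ev.hom_prod
        by (intro sum.cong prod.cong refl) (auto simp: embed_def ev_single w_embed)
      moreover have "w 0 = 1" by (simp add: w_def \<rho>_arith)
      ultimately show "h2 r = 0"
        unfolding r h2(2) using esym[OF j] by (simp add: ev.hom_minus scalar_def ev_single)
    qed
    then show ?thesis unfolding h2(2) .
  qed
  then show ?thesis by (simp add: ev_def w_def)
qed

section \<open>A spanning set with n! elements\<close>

lemma degree_prod_linear:
  fixes x :: "'i \<Rightarrow> 'c::comm_ring_1"
  assumes "finite A"
  shows "degree (\<Prod>i\<in>A. [:- x i, 1:]) = card A" "lead_coeff (\<Prod>i\<in>A. [:- x i, 1:]) = 1"
proof -
  have "{S. S \<subseteq> A \<and> S = {}} = {{}}" by auto
  then have *: "coeff (\<Prod>i\<in>A. [:- x i, 1:]) (card A) = 1"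
    using coeff_prod_linear[OF assms, of 0 x] assms by (simp add: finite_subset cong: conj_cong)
  have "degree (\<Prod>i\<in>A. [:- x i, 1:]) \<le> (\<Sum>i\<in>A. degree [:- x i, 1:])"
    by (rule degree_prod_sum_le[OF assms, unfolded o_def])
  then have "degree (\<Prod>i\<in>A. [:- x i, 1:]) \<le> card A" by simp
  moreover have "card A \<le> degree (\<Prod>i\<in>A. [:- x i, 1:])" by (rule le_degree) (simp add: *)
  ultimately show "degree (\<Prod>i\<in>A. [:- x i, 1:]) = card A" by simp
  then show "lead_coeff (\<Prod>i\<in>A. [:- x i, 1:]) = 1" using * by simp
qed

text \<open>
  Division by \<open>Y - x\<close> determines the coefficients of the quotient from the top downwards.
\<close>

lemma coeff_cofactor_closed:
  fixes q :: "'r::comm_ring_1 poly"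
  assumes \<iota>: "comm_ring_hom \<iota>" and S: "is_subalgebra \<iota> S" "x \<in> S" "\<And>l. coeff ([:- x, 1:] * q) l \<in> S"
  shows "coeff q l \<in> S"
proof (cases "l \<le> Suc (degree q)")
  case True
  then show ?thesis
  proof (induction rule: inc_induct)
    case base
    show ?case using subalgebraD(4)[OF \<iota> S(1)] by (simp add: coeff_eq_0)
  next
    case (step l)
    have "coeff q l = coeff ([:- x, 1:] * q) (Suc l) + x * coeff q (Suc l)" by simp
    also have "\<dots> \<in> S" by (intro subalgebraD[OF \<iota> S(1)] S step)
    finally show ?case .
  qed
next
  case False
  then show ?thesis using subalgebraD(4)[OF \<iota> S(1)] by (simp add: coeff_eq_0)
qed

text \<open>
  If \<open>\<Prod> (Y - x\<^sub>i)\<close> has coefficients in the base ring modulo \<open>K\<close>, adjoin \<open>x\<^sub>0, x\<^sub>1, \<dots>\<close> successively. The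
  cofactor \<open>F k = \<Prod>\<^bsub>i \<ge> k\<^esub> (Y - x\<^sub>i)\<close> has its coefficients in the algebra generated by \<open>x\<^sub>0, \<dots>, x\<^sub>k\<^sub>-\<^sub>1\<close>, and
  \<open>x\<^sub>k\<close> is one of its roots, so the \<open>k\<close>-th step multiplies the size of the spanning set by \<open>n - k\<close>.
\<close>

lemma splitting_algebra_span:
  fixes \<iota> :: "'b::comm_ring_1 \<Rightarrow> 'r::comm_ring_1" and x :: "nat \<Rightarrow> 'r"
  assumes \<iota>: "comm_ring_hom \<iota>" and K: "ring_ideal K"
    and coeffs: "\<And>l. \<exists>b. coeff (\<Prod>i<n. [:- x i, 1:]) l - \<iota> b \<in> K"
  shows "\<exists>S m. is_subalgebra \<iota> S \<and> K \<subseteq> S \<and> (\<forall>i<n. x i \<in> S) \<and> spanned_mod \<iota> K (fact n) m S"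
proof -
  define F where "F k = (\<Prod>i\<in>{k..<n}. [:- x i, 1:])" for k
  have "\<exists>S m. is_subalgebra \<iota> S \<and> K \<subseteq> S \<and> (\<forall>i<k. x i \<in> S) \<and>
      spanned_mod \<iota> K (\<Prod>i<k. n - i) m S \<and> (\<forall>l. coeff (F k) l \<in> S)" if "k \<le> n" for k
    using that
  proof (induction k)
    case 0
    obtain S where S: "is_subalgebra \<iota> S" "K \<subseteq> S" "spanned_mod \<iota> K 1 (\<lambda>_. 1) S"
      "S = {\<iota> b + k |b k. k \<in> K}" using subalgebra_base[OF \<iota> K] by blast
    have "coeff (F 0) l \<in> S" for l
    proof -
      obtain b where b: "coeff (F 0) l - \<iota> b \<in> K" using coeffs[of l] by (auto simp: F_def atLeast0LessThan)
      have "coeff (F 0) l = \<iota> b + (coeff (F 0) l - \<iota> b)" by simp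
      then show ?thesis using b unfolding S(4) by blast
    qed
    then show ?case using S by auto
  next
    case (Suc k)
    then obtain S m where S: "is_subalgebra \<iota> S" "K \<subseteq> S" "\<forall>i<k. x i \<in> S"
      "spanned_mod \<iota> K (\<Prod>i<k. n - i) m S" "\<forall>l. coeff (F k) l \<in> S" by auto
    have "{k..<n} = insert k {Suc k..<n}" using Suc.prems by auto
    then have Fk: "F k = [:- x k, 1:] * F (Suc k)" by (simp add: F_def)
    have deg: "degree (F k) = n - k" "lead_coeff (F k) = 1"
      unfolding F_def using degree_prod_linear[of "{k..<n}" x] by simp_all
    have "poly (F k) (x k) \<in> K" using ring_idealD(1)[OF K] by (simp add: Fk)
    then obtain S' m' where S': "is_subalgebra \<iota> S'" "S \<subseteq> S'" "x k \<in> S'"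
      "spanned_mod \<iota> K ((\<Prod>i<k. n - i) * degree (F k)) m' S'"
      using adjoin_root[OF \<iota> S(1) K S(2,4) deg(2), of "x k"] S(5) deg(1) Suc.prems by auto
    have "coeff (F (Suc k)) l \<in> S'" for l
      using coeff_cofactor_closed[OF \<iota> S'(1,3)] S(5) S'(2) unfolding Fk by blast
    then show ?case
      using S S' deg by (intro exI[of _ S'] exI[of _ m']) (auto simp: less_Suc_eq)
  qed
  from this[of n] show ?thesis
    by (auto simp: fact_prod_rev atLeast0LessThan)
qed

text \<open>
  The relations for \<open>a = \<theta>\<close> are the hypothesis of \<open>splitting_algebra_span\<close> for \<open>x\<^sub>i = 1 \<otimes> \<dots> \<theta> \<dots> \<otimes> 1\<close>.
  The algebra generated by the \<open>x\<^sub>i\<close> contains every tensor, since \<open>A\<close> consists of polynomials in \<open>\<theta>\<close>.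
\<close>

lemma Sn_closure_span:
  fixes \<phi> :: "'b::field \<Rightarrow> 'a::field"
  assumes gen: "\<And>a. \<exists>g. a = poly (map_poly \<phi> g) \<theta>" and \<phi>: "comm_ring_hom \<phi>"
    and P: "degree (mult_char_poly \<phi> n \<theta>) = n" "lead_coeff (mult_char_poly \<phi> n \<theta>) = 1"
  shows "\<exists>m. spanned_mod scalar (Sn_kernel \<phi> n) (fact n) m UNIV"
proof -
  interpret \<phi>: comm_ring_hom \<phi> by fact
  interpret scalar: comm_ring_hom "scalar :: 'b \<Rightarrow> 'a tuple \<Rightarrow>\<^sub>0 'b" by (rule scalar_hom)
  note K = ring_ideal_Sn_kernel[of \<phi> n]
  define x where "x = (\<lambda>i. embed i \<theta> :: 'a tuple \<Rightarrow>\<^sub>0 'b)"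
  have "\<exists>b. coeff (\<Prod>i<n. [:- x i, 1:]) l - scalar b \<in> Sn_kernel \<phi> n" for l
  proof (cases "l < n")
    case True
    define j where "j = n - l"
    have j: "1 \<le> j" "j \<le> n" "l = n - j" using True by (auto simp: j_def)
    have "coeff (\<Prod>i<n. [:- x i, 1:]) l = (-1) ^ j * embed_esym n j \<theta>"
      using coeff_prod_linear[of "{..<n}" j x] j by (simp add: embed_esym_def x_def)
    moreover have "scalar ((-1) ^ j * s_coeff \<phi> n j \<theta>) = (-1) ^ j * (scalar (s_coeff \<phi> n j \<theta>) :: 'a tuple \<Rightarrow>\<^sub>0 'b)"
      by (simp add: scalar.hom_mult scalar.hom_power scalar.hom_uminus)
    ultimately have "coeff (\<Prod>i<n. [:- x i, 1:]) l - scalar ((-1) ^ j * s_coeff \<phi> n j \<theta>)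
        = - ((-1) ^ j * (scalar (s_coeff \<phi> n j \<theta>) - embed_esym n j \<theta>))"
      by (simp add: right_diff_distrib)
    also have "\<dots> \<in> Sn_kernel \<phi> n" by (intro ring_idealD[OF K] esym_mod j)
    finally show ?thesis by blast
  next
    case False
    have "coeff (\<Prod>i<n. [:- x i, 1:]) l = (if l = n then 1 else 0)"
    proof (cases "l = n")
      case True
      then show ?thesis using degree_prod_linear[of "{..<n}" x] by simp
    next
      case False
      then show ?thesis using degree_prod_linear[of "{..<n}" x] \<open>\<not> l < n\<close> by (simp add: coeff_eq_0)
    qed
    then have "coeff (\<Prod>i<n. [:- x i, 1:]) l - scalar (if l = n then 1 else 0) = 0" by simp
    then show ?thesis using ring_idealD(1)[OF K] by metis
  qed
  then obtain S m where S: "is_subalgebra scalar S" "Sn_kernel \<phi> n \<subseteq> S" "\<forall>i<n. x i \<in> S"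
      "spanned_mod scalar (Sn_kernel \<phi> n) (fact n) m S"
    using splitting_algebra_span[OF scalar_hom K] by blast
  note S_closed = subalgebraD[OF scalar_hom S(1)]
  have mod: "y \<in> S" if "y - z \<in> Sn_kernel \<phi> n" "z \<in> S" for y z
    using S_closed(2)[of "y - z" z] that S(2) by auto
  have embed_S: "embed i a \<in> S" if i: "i < n" for i a
  proof -
    have one: "embed i 1 = (1 :: 'a tuple \<Rightarrow>\<^sub>0 'b)"
    proof -
      have "Tuple ((\<lambda>_. 1)(i := 1)) = (0 :: 'a tuple)" by (simp add: zero_tuple_def fun_eq_iff)
      then show ?thesis by (simp add: embed_def)
    qed
    have base: "embed i (\<phi> c) \<in> S" for c
    proof -
      have "embed i (\<phi> c * 1) - scalar c * embed i 1 \<in> Sn_kernel \<phi> n" by (rule embed_scale_mod[OF i])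
      then have "embed i (\<phi> c) - scalar c \<in> Sn_kernel \<phi> n" unfolding one by simp
      then show ?thesis using S_closed(1) by (rule mod)
    qed
    have mult: "embed i (a * b) = embed i a * (embed i b :: 'a tuple \<Rightarrow>\<^sub>0 'b)" for a b
      by (simp add: embed_def mult_single plus_tuple_def) (rule arg_cong, auto)
    have "embed i (poly (map_poly \<phi> g) \<theta>) \<in> S" for g
    proof (induction g)
      case 0
      show ?case using base[of 0] by simp
    next
      case (pCons c g)
      have "embed i (\<theta> * poly (map_poly \<phi> g) \<theta>) \<in> S"
        unfolding mult using S(3) i by (intro S_closed(3) pCons) (auto simp: x_def)
      then have "embed i (\<phi> c) + embed i (\<theta> * poly (map_poly \<phi> g) \<theta>) \<in> S" by (intro S_closed(2) base)
      then have "embed i (\<phi> c + \<theta> * poly (map_poly \<phi> g) \<theta>) \<in> S" by (rule mod[OF embed_add_mod[OF i]])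
      then show ?case by (simp add: \<phi>.map_poly_pCons_hom)
    qed
    then show ?thesis using gen by metis
  qed
  have "y \<in> S" for y
  proof (induction y rule: poly_mapping_additive_induct)
    case zero
    show ?case by (rule S_closed(4))
  next
    case (single u b)
    show ?case
      by (rule mod[OF single_mod]) (intro S_closed(1,3) subalgebra_prod[OF scalar_hom S(1)] embed_S, simp)
  next
    case (add f g)
    then show ?case by (rule S_closed(2))
  qed
  then have "S = UNIV" by blast
  then show ?thesis using S(4) by blast
qed

section \<open>The dimension of a power of a field\<close>

text \<open>
  The hypotheses say that the vectors \<open>g i\<close> form a basis of \<open>'c\<close> to the power \<open>r\<close> over \<open>'b\<close>. Another
  basis of the same space consists of the vectors with a single nonzero entry, taken from a basis \<open>B\<close> of
  \<open>'c\<close>. With \<open>r > 0\<close>, the entries \<open>g i 0\<close> span \<open>'c\<close>, which is therefore finite-dimensional.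
\<close>

lemma power_dimension:
  fixes \<chi> :: "'b::field \<Rightarrow> 'c::field" and g :: "nat \<Rightarrow> nat \<Rightarrow> 'c"
  assumes \<chi>: "field_hom \<chi>"
    and indep: "\<And>b i. (\<And>k. k < r \<Longrightarrow> (\<Sum>i<N. \<chi> (b i) * g i k) = 0) \<Longrightarrow> i < N \<Longrightarrow> b i = 0"
    and span: "\<And>v. \<exists>b. \<forall>k<r. v k = (\<Sum>i<N. \<chi> (b i) * g i k)"
    and r: "r > 0"
  shows "N = r * extension_degree \<chi>"
proof -
  interpret \<chi>: field_hom \<chi> by fact
  interpret C: vector_space "alg_scale \<chi>" by (rule \<chi>.vector_space_alg_scale)
  define scale where "scale b f = (\<lambda>k :: nat. \<chi> b * f k)" for b f
  interpret V: vector_space scale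
    by unfold_locales (simp_all add: scale_def fun_eq_iff algebra_simps \<chi>.hom_add \<chi>.hom_mult)
  \<comment> \<open>vectors of length \<open>r\<close> are extended by zero\<close>
  define Z where "Z = {f :: nat \<Rightarrow> 'c. \<forall>k\<ge>r. f k = 0}"
  define G where "G i = (\<lambda>k. if k < r then g i k else 0)" for i
  have sum_scale: "(\<Sum>i\<in>I. scale (b i) (f i)) k = (\<Sum>i\<in>I. \<chi> (b i) * f i k)"
    for I :: "'i set" and b f k
    by (simp add: sum_fun_apply scale_def)
  have G_indep: "b i = 0" if "(\<Sum>i<N. scale (b i) (G i)) = 0" "i < N" for b i
  proof (rule indep[OF _ that(2)])
    fix k assume "k < r"
    then show "(\<Sum>i<N. \<chi> (b i) * g i k) = 0"
      using fun_cong[OF that(1), of k] by (simp add: sum_scale G_def)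
  qed
  have inj: "inj_on G {..<N}"
  proof (rule inj_onI, rule ccontr)
    fix i j assume ij: "i \<in> {..<N}" "j \<in> {..<N}" "G i = G j" "i \<noteq> j"
    have "(\<Sum>k<N. scale (if k = i then 1 else if k = j then -1 else 0) (G k))
        = (\<Sum>k<N. (if k = i then G i else 0) - (if k = j then G j else 0))"
      using ij by (intro sum.cong) (auto simp: scale_def fun_eq_iff \<chi>.hom_uminus)
    also have "\<dots> = 0" using ij by (simp add: sum_subtractf)
    finally show False using G_indep[of "\<lambda>k. if k = i then 1 else if k = j then -1 else 0" i] ij by auto
  qed
  have "card (G ` {..<N}) = V.dim Z"
  proof (rule V.basis_card_eq_dim)
    show "G ` {..<N} \<subseteq> Z" by (auto simp: G_def Z_def)
    show "Z \<subseteq> V.span (G ` {..<N})"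
    proof
      fix v assume v: "v \<in> Z"
      obtain b where b: "\<forall>k<r. v k = (\<Sum>i<N. \<chi> (b i) * g i k)" using span by blast
      have "v = (\<Sum>i<N. scale (b i) (G i))"
      proof
        fix k
        show "v k = (\<Sum>i<N. scale (b i) (G i)) k"
          using b v by (cases "k < r") (simp_all add: sum_scale G_def Z_def)
      qed
      also have "\<dots> \<in> V.span (G ` {..<N})" by (intro V.span_sum V.span_scale V.span_base) auto
      finally show "v \<in> V.span (G ` {..<N})" .
    qed
    show "\<not> V.dependent (G ` {..<N})"
    proof (rule V.independent_if_scalars_zero)
      fix f x assume f: "(\<Sum>x\<in>G ` {..<N}. scale (f x) x) = 0" and "x \<in> G ` {..<N}"
      then obtain k where k: "k < N" "x = G k" by blast
      have "(\<Sum>i<N. scale (f (G i)) (G i)) = 0" using f inj by (simp add: sum.reindex)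
      then show "f x = 0" using G_indep[of "\<lambda>i. f (G i)" k] k by simp
    qed simp
  qed
  then have N: "N = V.dim Z" using inj by (simp add: card_image)
  define F where "F = (\<lambda>i. g i 0) ` {..<N}"
  obtain B where B: "B \<subseteq> F" "\<not> C.dependent B" "F \<subseteq> C.span B"
    using C.maximal_independent_subset[of F] by blast
  have finB: "finite B" using B(1) by (rule finite_subset) (simp add: F_def)
  have "c \<in> C.span B" for c
  proof -
    obtain b where "\<forall>k<r. c = (\<Sum>i<N. \<chi> (b i) * g i k)" using span[of "\<lambda>_. c"] by blast
    then have "c = (\<Sum>i<N. alg_scale \<chi> (b i) (g i 0))" using r by (simp add: alg_scale_def)
    also have "\<dots> \<in> C.span B"
      using B(3) by (intro C.span_sum C.span_scale) (auto simp: F_def)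
    finally show ?thesis .
  qed
  then have spanB: "C.span B = UNIV" by blast
  then have cardB: "card B = extension_degree \<chi>"
    unfolding extension_degree_def using B(2) by (intro C.basis_card_eq_dim) auto
  define D where "D = (\<lambda>(l :: nat, c) k. if k = l then c else (0 :: 'c))"
  have B0: "c \<noteq> 0" if "c \<in> B" for c using that B(2) C.dependent_zero by blast
  have injD: "inj_on D ({..<r} \<times> B)"
  proof (rule inj_onI)
    fix p q assume p: "p \<in> {..<r} \<times> B" and q: "q \<in> {..<r} \<times> B" and eq: "D p = D q"
    obtain l c l' c' where pq: "p = (l, c)" "q = (l', c')" by fastforce
    have "D p l = c" by (simp add: D_def pq)
    then have "D q l = c" using eq by simp
    then show "p = q" using B0[of c] p by (auto simp: D_def pq split: if_splits)
  qed
  have "card (D ` ({..<r} \<times> B)) = V.dim Z"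
  proof (rule V.basis_card_eq_dim)
    show "D ` ({..<r} \<times> B) \<subseteq> Z" by (auto simp: D_def Z_def)
    show "Z \<subseteq> V.span (D ` ({..<r} \<times> B))"
    proof
      fix v assume v: "v \<in> Z"
      have "\<exists>u. c = (\<Sum>e\<in>B. \<chi> (u e) * e)" for c
      proof -
        have "c \<in> range (\<lambda>u. \<Sum>e\<in>B. alg_scale \<chi> (u e) e)"
          unfolding C.span_finite[OF finB, symmetric] spanB by (rule UNIV_I)
        then show ?thesis unfolding alg_scale_def by (rule rangeE) (rule exI)
      qed
      then obtain u where u: "\<And>c. c = (\<Sum>e\<in>B. \<chi> (u c e) * e)" by metis
      have "v = (\<Sum>l<r. \<Sum>e\<in>B. scale (u (v l) e) (D (l, e)))"
      proof
        fix k
        have "(\<Sum>l<r. \<Sum>e\<in>B. scale (u (v l) e) (D (l, e))) k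
            = (\<Sum>l<r. \<Sum>e\<in>B. \<chi> (u (v l) e) * (if k = l then e else 0))"
          by (simp add: sum_fun_apply scale_def D_def)
        also have "\<dots> = (\<Sum>l<r. if k = l then v l else 0)"
          by (intro sum.cong refl) (auto simp: u[symmetric])
        also have "\<dots> = v k" using v by (auto simp: Z_def)
        finally show "v k = (\<Sum>l<r. \<Sum>e\<in>B. scale (u (v l) e) (D (l, e))) k" by simp
      qed
      also have "\<dots> \<in> V.span (D ` ({..<r} \<times> B))"
        by (intro V.span_sum V.span_scale V.span_base) auto
      finally show "v \<in> V.span (D ` ({..<r} \<times> B))" .
    qed
    show "\<not> V.dependent (D ` ({..<r} \<times> B))"
    proof (rule V.independent_if_scalars_zero)
      fix f x assume f: "(\<Sum>x\<in>D ` ({..<r} \<times> B). scale (f x) x) = 0" and "x \<in> D ` ({..<r} \<times> B)"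
      then obtain l c where x: "l < r" "c \<in> B" "x = D (l, c)" by blast
      have "0 = (\<Sum>p\<in>{..<r} \<times> B. scale (f (D p)) (D p)) l"
        using f injD by (simp add: sum.reindex)
      also have "\<dots> = (\<Sum>k<r. \<Sum>e\<in>B. \<chi> (f (D (k, e))) * (if l = k then e else 0))"
        unfolding sum_scale sum.cartesian_product by (intro sum.cong refl) (auto simp: D_def)
      also have "\<dots> = (\<Sum>k<r. if l = k then \<Sum>e\<in>B. \<chi> (f (D (k, e))) * e else 0)"
        by (intro sum.cong) auto
      also have "\<dots> = (\<Sum>e\<in>B. \<chi> (f (D (l, e))) * e)" using x by simp
      finally have "(\<Sum>e\<in>B. alg_scale \<chi> (f (D (l, e))) e) = 0" by (simp add: alg_scale_def)
      then show "f x = 0"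
        using C.independentD[OF B(2) finB subset_refl, of "\<lambda>e. f (D (l, e))"] x by simp
    qed (simp add: finB)
  qed
  then have "r * card B = V.dim Z" using injD finB by (simp add: card_image card_cartesian_product)
  then show ?thesis using N cardB by simp
qed

section \<open>The points of the closure and the Galois closure\<close>

locale conjugate_system =
  base: field_hom \<phi> + top: field_hom \<chi>
  for \<phi> :: "'b::field \<Rightarrow> 'a::field" and \<chi> :: "'b \<Rightarrow> 'c::field" +
  fixes n :: nat and \<theta> :: 'a and \<sigma> :: "nat \<Rightarrow> 'a \<Rightarrow> 'c"
  assumes gen: "\<exists>g. a = poly (map_poly \<phi> g) \<theta>"
    and basis: "\<exists>es. length es = n \<and> algebra_basis \<phi> es"
    and \<sigma>_hom: "i < n \<Longrightarrow> comm_ring_hom (\<sigma> i)" and \<sigma>_base: "i < n \<Longrightarrow> \<sigma> i (\<phi> b) = \<chi> b"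
    and \<sigma>_inj: "inj_on (\<lambda>i. \<sigma> i \<theta>) {..<n}"
begin

definition perms where "perms = {\<pi>. \<pi> permutes {..<n}}"

definition ev :: "(nat \<Rightarrow> nat) \<Rightarrow> ('a tuple \<Rightarrow>\<^sub>0 'b) \<Rightarrow> 'c" where
  "ev \<pi> = linear_extension \<chi> (\<lambda>u. \<Prod>i<n. \<sigma> (\<pi> i) (entries u i))"

lemma perm_less: "\<pi> \<in> perms \<Longrightarrow> i < n \<Longrightarrow> \<pi> i < n"
  using permutes_in_image[of \<pi> "{..<n}" i] by (simp add: perms_def)

lemma \<sigma>_arith:
  assumes i: "i < n"
  shows "\<sigma> i 1 = 1" "\<sigma> i (a * b) = \<sigma> i a * \<sigma> i b"
proof -
  interpret comm_ring_hom "\<sigma> i" by (rule \<sigma>_hom[OF i])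
  show "\<sigma> i 1 = 1" "\<sigma> i (a * b) = \<sigma> i a * \<sigma> i b" by (simp_all add: hom_mult)
qed

lemma ev_single: "ev \<pi> (Poly_Mapping.single u b) = \<chi> b * (\<Prod>i<n. \<sigma> (\<pi> i) (entries u i))"
  by (simp add: ev_def linear_extension_single[OF top.comm_ring_hom_axioms])

lemma ev_hom: "\<pi> \<in> perms \<Longrightarrow> comm_ring_hom (ev \<pi>)"
  unfolding ev_def
  by (rule linear_extension_hom[OF top.comm_ring_hom_axioms]) (simp_all add: \<sigma>_arith perm_less prod.distrib)

lemma ev_scalar: "\<pi> \<in> perms \<Longrightarrow> ev \<pi> (scalar b) = \<chi> b"
  by (simp add: scalar_def ev_single \<sigma>_arith perm_less)

lemma ev_embed:
  assumes "\<pi> \<in> perms" "i < n"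
  shows "ev \<pi> (embed i a) = \<sigma> (\<pi> i) a"
proof -
  have "(\<Prod>k<n. \<sigma> (\<pi> k) (entries (Tuple ((\<lambda>_. 1)(i := a))) k)) = (\<Prod>k<n. if k = i then \<sigma> (\<pi> i) a else 1)"
    using assms by (intro prod.cong) (auto simp: \<sigma>_arith perm_less)
  then show ?thesis using assms by (simp add: embed_def ev_single)
qed

lemma \<sigma>_distinct: "i < n \<Longrightarrow> j < n \<Longrightarrow> i \<noteq> j \<Longrightarrow> \<exists>a. \<sigma> i a \<noteq> \<sigma> j a"
  using \<sigma>_inj by (auto simp: inj_on_def)

lemmas mult_char_poly = mult_char_poly_conjugates[OF base.field_hom_axioms top.field_hom_axioms basis
    \<sigma>_hom \<sigma>_base \<sigma>_distinct]

text \<open>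
  The \<open>\<sigma> (\<pi> i) a\<close> are a rearrangement of the roots \<open>\<sigma> i a\<close> of the characteristic polynomial, hence
  have the same elementary symmetric functions.
\<close>

lemma ev_kernel:
  assumes \<pi>: "\<pi> \<in> perms" and x: "x \<in> Sn_kernel \<phi> n"
  shows "ev \<pi> x = 0"
  unfolding ev_def
proof (rule Sn_kernel_universal[OF top.comm_ring_hom_axioms _ _ _ x])
  fix j a assume j: "1 \<le> j" "j \<le> n"
  have "\<chi> (s_coeff \<phi> n j a) = (-1) ^ j * coeff (map_poly \<chi> (mult_char_poly \<phi> n a)) (n - j)"
    by (simp add: s_coeff_def top.hom_mult top.hom_power top.hom_uminus)
  also have "map_poly \<chi> (mult_char_poly \<phi> n a) = (\<Prod>i<n. [:- \<sigma> i a, 1:])" by (rule mult_char_poly)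
  also have "\<dots> = (\<Prod>i<n. [:- \<sigma> (\<pi> i) a, 1:])"
    using prod.permute[of \<pi> "{..<n}" "\<lambda>i. [:- \<sigma> i a, 1:]"] \<pi> by (simp add: o_def perms_def)
  also have "coeff \<dots> (n - j) = (-1) ^ j * (\<Sum>S\<in>{S. S \<subseteq> {..<n} \<and> card S = j}. \<Prod>i\<in>S. \<sigma> (\<pi> i) a)"
    using coeff_prod_linear[of "{..<n}" j] j by simp
  finally show "\<chi> (s_coeff \<phi> n j a) = (\<Sum>S\<in>{S. S \<subseteq> {..<n} \<and> card S = j}. \<Prod>i\<in>S. \<sigma> (\<pi> i) a)"
    by (simp add: mult.assoc[symmetric] power_mult_distrib[symmetric])
qed (use \<pi> \<sigma>_hom \<sigma>_base perm_less in auto)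

definition generators where
  "generators = (SOME m. spanned_mod scalar (Sn_kernel \<phi> n) (fact n) m UNIV)"

lemma card_perms: "finite perms" "card perms = fact n"
  using finite_permutations[of "{..<n}"] card_permutations[of "{..<n}" n] by (simp_all add: perms_def)

text \<open>
  The images of \<open>\<theta>\<close> in the tensor factors tell the permutations apart, as the \<open>\<sigma> i \<theta>\<close> are distinct. There
  are \<open>n!\<close> of them, which matches the spanning set.
\<close>

sublocale sep: separated_algebra \<chi> scalar "Sn_kernel \<phi> n" UNIV perms ev generators
proof (intro separated_algebra.intro separated_algebra_axioms.intro)
  show "\<exists>y\<in>UNIV. ev \<pi> y \<noteq> ev \<tau> y" if "\<pi> \<in> perms" "\<tau> \<in> perms" "\<pi> \<noteq> \<tau>" for \<pi> \<tau>
  proof -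
    obtain i where i: "\<pi> i \<noteq> \<tau> i" using \<open>\<pi> \<noteq> \<tau>\<close> by blast
    have "\<pi> i = i" "\<tau> i = i" if "\<not> i < n"
      using \<open>\<pi> \<in> perms\<close> \<open>\<tau> \<in> perms\<close> that by (simp_all add: perms_def permutes_not_in)
    then have "i < n" using i by metis
    then have "\<sigma> (\<pi> i) \<theta> \<noteq> \<sigma> (\<tau> i) \<theta>"
      using i \<sigma>_inj perm_less that unfolding inj_on_def by blast
    then show ?thesis using that \<open>i < n\<close> by (metis UNIV_I ev_embed)
  qed
  have "\<exists>m. spanned_mod scalar (Sn_kernel \<phi> n) (fact n) m UNIV"
    by (rule Sn_closure_span[OF gen base.comm_ring_hom_axioms mult_char_poly(2,3)])
  then show "spanned_mod scalar (Sn_kernel \<phi> n) (card perms) generators UNIV"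
    unfolding generators_def card_perms by (rule someI_ex)
qed (use top.field_hom_axioms scalar_hom card_perms ev_hom ev_scalar ev_kernel in \<open>auto simp: is_subalgebra_def\<close>)

text \<open>
  The field generated by all conjugates of \<open>A\<close>.
\<close>

definition closure_field :: "'c set" where "closure_field = range (ev id)"

lemma id_perm: "id \<in> perms"
  using permutes_id by (simp add: perms_def)

text \<open>
  Permuting the tensor factors turns one point into another; so all points have the same image.
\<close>

lemma ev_reorder:
  assumes \<pi>: "\<pi> \<in> perms" and \<tau>: "\<tau> \<in> perms"
  shows "\<exists>y'. ev \<tau> y' = ev \<pi> y"
proof (induction y rule: poly_mapping_additive_induct)
  case zero
  show ?case using sep.ev_arith(1)[OF \<pi>] sep.ev_arith(1)[OF \<tau>] by metis
next
  case (single u b)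
  define \<rho> where "\<rho> = inv_into UNIV \<pi> \<circ> \<tau>"
  have "inv_into UNIV \<pi> permutes {..<n}" using \<pi> permutes_inv by (auto simp: perms_def)
  then have \<rho>: "\<rho> permutes {..<n}" unfolding \<rho>_def using \<tau> permutes_compose by (auto simp: perms_def)
  have \<pi>\<rho>: "\<pi> (\<rho> i) = \<tau> i" for i
    using \<pi> by (simp add: \<rho>_def perms_def permutes_inverses)
  have "(\<Prod>i<n. \<sigma> (\<pi> i) (entries u i)) = (\<Prod>i<n. \<sigma> (\<pi> (\<rho> i)) (entries u (\<rho> i)))"
    using prod.permute[OF \<rho>, of "\<lambda>i. \<sigma> (\<pi> i) (entries u i)"] by (simp add: o_def)
  then have "ev \<tau> (Poly_Mapping.single (Tuple (\<lambda>i. entries u (\<rho> i))) b) = ev \<pi> (Poly_Mapping.single u b)"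
    by (simp add: ev_single \<pi>\<rho>)
  then show ?case by blast
next
  case (add x y)
  then show ?case using sep.ev_arith(3)[OF \<pi>] sep.ev_arith(3)[OF \<tau>] by metis
qed

lemma range_ev: "\<pi> \<in> perms \<Longrightarrow> range (ev \<pi>) = closure_field"
proof (intro subset_antisym subsetI)
  fix z assume \<pi>: "\<pi> \<in> perms" and "z \<in> range (ev \<pi>)"
  then obtain y where "z = ev \<pi> y" by blast
  then show "z \<in> closure_field"
    using ev_reorder[OF \<pi> id_perm, of y] unfolding closure_field_def by (metis rangeI)
next
  fix z assume \<pi>: "\<pi> \<in> perms" and "z \<in> closure_field"
  then obtain y where "z = ev id y" unfolding closure_field_def by blast
  then show "z \<in> range (ev \<pi>)" using ev_reorder[OF id_perm \<pi>, of y] by (metis rangeI)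
qed

lemma subalgebra_closure_field: "is_subalgebra \<chi> closure_field"
  unfolding is_subalgebra_def closure_field_def
proof (intro conjI ballI)
  show "range \<chi> \<subseteq> range (ev id)" using ev_scalar[OF id_perm] by (metis image_subsetI rangeI)
  fix x y assume "x \<in> range (ev id)" "y \<in> range (ev id)"
  then obtain u v where "x = ev id u" "y = ev id v" by blast
  then show "x + y \<in> range (ev id)" "x * y \<in> range (ev id)"
    by (metis sep.ev_arith(3)[OF id_perm] rangeI, metis sep.ev_arith(4)[OF id_perm] rangeI)
qed

lemmas closure_field_closed = subalgebraD[OF top.comm_ring_hom_axioms subalgebra_closure_field]

lemma \<sigma>_in_closure_field: "i < n \<Longrightarrow> \<sigma> i a \<in> closure_field"
  using ev_embed[OF id_perm, of i a] unfolding closure_field_def by (metis id_apply rangeI)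

text \<open>
  The constant term \<open>c\<close> of the irreducible polynomial \<open>p\<close> of \<open>z\<close> is nonzero. Solving
  \<open>c + z * q(z) = 0\<close> for the inverse of \<open>z\<close> gives a polynomial expression in \<open>z\<close>.
\<close>

lemma closure_field_inverse:
  assumes p: "irreducible p" "poly (map_poly \<chi> p) z = 0" and z: "z \<in> closure_field" "z \<noteq> 0"
  shows "inverse z \<in> closure_field"
proof -
  obtain c q where pq: "p = pCons c q" by (cases p) 
  have val: "\<chi> c + z * poly (map_poly \<chi> q) z = 0" using p(2) by (simp add: pq top.map_poly_pCons_hom)
  have "c \<noteq> 0"
  proof
    assume c: "c = 0"
    then have "poly (map_poly \<chi> q) z = 0" using val z by simp
    then have "p dvd q" by (rule top.root_imp_irreducible_dvd[OF p])
    moreover have "q \<noteq> 0" using p(1) pq c by (metis not_irreducible_zero pCons_0_0)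
    ultimately have "degree p \<le> degree q" by (intro dvd_imp_degree_le)
    then show False using \<open>q \<noteq> 0\<close> by (simp add: pq)
  qed
  have "poly (map_poly \<chi> g) z \<in> closure_field" for g
    by (induction g) (auto simp: top.map_poly_pCons_hom intro!: closure_field_closed z)
  then have "\<chi> (- inverse c) * poly (map_poly \<chi> q) z \<in> closure_field"
    by (intro closure_field_closed(1,3))
  also have "\<chi> (- inverse c) * poly (map_poly \<chi> q) z = inverse z"
  proof -
    have "\<chi> c \<noteq> 0" using \<open>c \<noteq> 0\<close> by simp
    have "z * poly (map_poly \<chi> q) z = - \<chi> c" using val by (simp add: add_eq_0_iff)
    then have "poly (map_poly \<chi> q) z = - \<chi> c / z" using z(2) by (simp add: field_simps)
    moreover have "\<chi> (- inverse c) = - inverse (\<chi> c)" by (simp only: top.hom_uminus top.hom_inverse)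
    ultimately show ?thesis using \<open>\<chi> c \<noteq> 0\<close> by (simp add: field_simps)
  qed
  finally show ?thesis .
qed

text \<open>
  Normality: if \<open>z = ev id y\<close> is a root of the irreducible polynomial \<open>p\<close>, then \<open>p\<close> divides the
  polynomial over the base field whose roots are the values of \<open>y\<close> at all points. Since the points have
  a common image, all roots of \<open>p\<close> belong to it.
\<close>

lemma closure_field_galois:
  assumes galois: "galois_over \<chi> UNIV"
  shows "galois_over \<chi> closure_field"
  unfolding galois_over_def intermediate_field_def
proof (intro conjI)
  let ?C = "ring_of_type_algebra :: 'c ring"
  interpret F: Ring.field ?C by (rule field_from_type_algebra)
  have separable: "separable_over \<chi> UNIV" and normal: "normal_over \<chi> UNIV"
    using galois by (simp_all add: galois_over_def)
  show "range \<chi> \<subseteq> closure_field" using closure_field_closed(1) by blast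
  show "separable_over \<chi> closure_field" using separable by (auto simp: separable_over_def)
  have minus: "\<ominus>\<^bsub>?C\<^esub> x = - x" for x by (rule F.minus_equality) simp_all
  show "subfield closure_field ?C"
  proof (rule F.subfieldI')
    show "subring closure_field ?C"
      by (rule F.subringI) (auto simp: minus intro: closure_field_closed)
    fix k assume "k \<in> closure_field - {\<zero>\<^bsub>?C\<^esub>}"
    then have k: "k \<in> closure_field" "k \<noteq> 0" by simp_all
    obtain p where "irreducible p" "poly (map_poly \<chi> p) k = 0"
      using separable unfolding separable_over_def by blast
    then have "inverse k \<in> closure_field" using closure_field_inverse k by blast
    moreover have "inv\<^bsub>?C\<^esub> k = inverse k" by (rule F.comm_inv_char) (use k in simp_all)
    ultimately show "inv\<^bsub>?C\<^esub> k \<in> closure_field" by simp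
  qed
  show "normal_over \<chi> closure_field"
    unfolding normal_over_def
  proof (intro conjI ballI allI impI)
    show "\<exists>p. p \<noteq> 0 \<and> poly (map_poly \<chi> p) x = 0" for x
      using normal unfolding normal_over_def by blast
    fix p assume "irreducible p \<and> (\<exists>x\<in>closure_field. poly (map_poly \<chi> p) x = 0)"
    then obtain z where p: "irreducible p" and z: "z \<in> closure_field" "poly (map_poly \<chi> p) z = 0" by blast
    obtain c xs where xs: "map_poly \<chi> p = smult c (\<Prod>x\<leftarrow>xs. [:- x, 1:])"
      using normal p z unfolding normal_over_def by blast
    obtain y where y: "z = ev id y" using z(1) unfolding closure_field_def by blast
    obtain h where h: "map_poly \<chi> h = (\<Prod>\<pi>\<in>perms. [:- ev \<pi> y, 1:])" using sep.ex_poly_eq_prod[of y] by auto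
    have h_root: "poly (map_poly \<chi> h) x = 0 \<longleftrightarrow> (\<exists>\<pi>\<in>perms. x = ev \<pi> y)" for x
      unfolding h by (auto simp: poly_prod prod_zero_iff card_perms(1))
    have "p dvd h" using top.root_imp_irreducible_dvd[OF p z(2)] h_root id_perm y by blast
    then obtain k where k: "h = p * k" by (rule dvdE)
    have "set xs \<subseteq> closure_field"
    proof
      fix x assume "x \<in> set xs"
      then have "poly (\<Prod>x\<leftarrow>xs. [:- x, 1:]) x = 0" by (induction xs) auto
      then have "poly (map_poly \<chi> h) x = 0"
        unfolding k top.poly_map_poly_arith(2) xs by simp
      then show "x \<in> closure_field" using h_root range_ev by blast
    qed
    then show "\<exists>c xs. set xs \<subseteq> closure_field \<and> map_poly \<chi> p = smult c (\<Prod>x\<leftarrow>xs. [:- x, 1:])"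
      using xs by blast
  qed
qed

text \<open>
  One point is chosen for each kernel. The chosen points have pairwise distinct kernels and are
  surjective, so \<open>separating_deltas\<close> makes their joint map \<open>\<Phi>\<close> surjective. An element killed by them is
  killed by all points, and thus zero in the closure. The spanning set becomes a basis of the power,
  which determines \<open>r\<close>.
\<close>

lemma Sn_closure_isomorphic_power:
  assumes surj: "closure_field = UNIV"
  shows "\<exists>r. fact n = r * extension_degree \<chi> \<and>
    alg_isomorphic (Sn_closure \<phi> n) (Sn_scalar \<phi> n)
      (power_ring (ring_of_type_algebra :: 'c ring) r) (power_scalar \<chi> r)"
proof -
  let ?C = "ring_of_type_algebra :: 'c ring"
  note K = ring_ideal_Sn_kernel[of \<phi> n]
  define ker where "ker \<pi> = {y. ev \<pi> y = 0}" for \<pi>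
  obtain reps where reps: "reps \<subseteq> perms" "inj_on ker reps" "ker ` perms = ker ` reps"
    using subset_image_inj[of "ker ` perms" ker perms] by auto
  define r where "r = card reps"
  have fin_reps: "finite reps" using reps(1) card_perms(1) by (rule finite_subset)
  then obtain e where e: "bij_betw e {..<r} reps"
    using ex_bij_betw_nat_finite[of reps] by (auto simp: r_def atLeast0LessThan)
  have e_perm: "e k \<in> perms" if "k < r" for k
    using e reps(1) that by (auto simp: bij_betw_def)
  have rep_ex: "\<exists>k<r. ker (e k) = ker \<pi>" if "\<pi> \<in> perms" for \<pi>
  proof -
    have "ker \<pi> \<in> ker ` reps" using that reps(3) by blast
    then obtain \<rho> where "\<rho> \<in> reps" "ker \<pi> = ker \<rho>" by blast
    moreover have "\<rho> \<in> e ` {..<r}" using e \<open>\<rho> \<in> reps\<close> by (simp add: bij_betw_def)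
    ultimately show ?thesis by auto
  qed
  have all_zero: "ev \<pi> y = 0" if "\<And>k. k < r \<Longrightarrow> ev (e k) y = 0" "\<pi> \<in> perms" for \<pi> y
    using rep_ex[OF that(2)] that(1) unfolding ker_def by blast
  have ev_surj: "\<exists>y. ev (e k) y = c" if "k < r" for k c
    using range_ev[OF e_perm[OF that]] surj by (metis UNIV_I rangeE)
  have deltas: "\<exists>y. ev (e k) y = 1 \<and> (\<forall>l<r. l \<noteq> k \<longrightarrow> ev (e l) y = 0)" if k: "k < r" for k
  proof -
    define W where "W = {f. \<exists>y. \<forall>k<r. f k = ev (e k) y}"
    have W: "(\<lambda>k. ev (e k) y) \<in> W" for y by (auto simp: W_def)
    have "\<exists>f\<in>W. f k = 1 \<and> (\<forall>l\<in>{..<r} - {k}. f l = 0)"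
    proof (rule separating_deltas)
      show "(\<lambda>_. 1) \<in> W" unfolding W_def
        by (intro CollectI exI[of _ 1]) (simp add: sep.ev_arith e_perm)
      fix f g assume "f \<in> W" "g \<in> W"
      then obtain y z where "\<forall>k<r. f k = ev (e k) y" "\<forall>k<r. g k = ev (e k) z" unfolding W_def by blast
      then have "\<forall>k<r. f k - g k = ev (e k) (y - z)" "\<forall>k<r. f k * g k = ev (e k) (y * z)"
        by (simp_all add: sep.ev_arith e_perm)
      then show "(\<lambda>k. f k - g k) \<in> W" "(\<lambda>k. f k * g k) \<in> W" unfolding W_def by blast+
    next
      fix f :: "nat \<Rightarrow> 'c" and k assume k: "k \<in> {..<r}" "f k \<noteq> 0"
      then obtain y where "ev (e k) y = inverse (f k)" using ev_surj by blast
      then show "\<exists>g\<in>W. g k * f k = 1" using k W[of y] by (intro bexI[of _ "\<lambda>k. ev (e k) y"]) simp_all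
    next
      fix k l assume kl: "k \<in> {..<r}" "l \<in> {..<r}" "k \<noteq> l"
      have "e k \<noteq> e l" using kl e by (auto simp: bij_betw_def inj_on_def)
      moreover have "e k \<in> reps" "e l \<in> reps" using kl e by (auto simp: bij_betw_def)
      ultimately have "ker (e k) \<noteq> ker (e l)" using reps(2) by (auto simp: inj_on_def)
      then obtain y where "(ev (e k) y = 0) \<noteq> (ev (e l) y = 0)" unfolding ker_def by blast
      then show "\<exists>f\<in>W. (f k = 0) \<noteq> (f l = 0)" using W by (intro bexI[of _ "\<lambda>k. ev (e k) y"])
    qed (use k in auto)
    then obtain f where f: "f \<in> W" "f k = 1" "\<forall>l\<in>{..<r} - {k}. f l = 0" by blast
    then obtain y where "\<forall>k<r. f k = ev (e k) y" unfolding W_def by blast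
    then show ?thesis using f k by (intro exI[of _ y]) auto
  qed
  have onto: "\<exists>y. \<forall>k<r. ev (e k) y = v k" for v
  proof -
    have "\<forall>k. \<exists>y. k < r \<longrightarrow> ev (e k) y = 1 \<and> (\<forall>l<r. l \<noteq> k \<longrightarrow> ev (e l) y = 0)" using deltas by blast
    then obtain d where d: "\<And>k. k < r \<Longrightarrow> ev (e k) (d k) = 1"
      "\<And>k l. k < r \<Longrightarrow> l < r \<Longrightarrow> l \<noteq> k \<Longrightarrow> ev (e l) (d k) = 0" by metis
    have "\<forall>k. \<exists>y. k < r \<longrightarrow> ev (e k) y = v k" using ev_surj by blast
    then obtain z where z: "\<And>k. k < r \<Longrightarrow> ev (e k) (z k) = v k" by metis
    have "ev (e l) (\<Sum>k<r. d k * z k) = v l" if l: "l < r" for l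
    proof -
      have "ev (e l) (\<Sum>k<r. d k * z k) = (\<Sum>k<r. ev (e l) (d k) * ev (e l) (z k))"
        by (simp add: sep.ev_arith e_perm[OF l])
      also have "\<dots> = (\<Sum>k<r. if k = l then v l else 0)"
        using d l z by (intro sum.cong) auto
      also have "\<dots> = v l" using l by simp
      finally show ?thesis .
    qed
    then show ?thesis by blast
  qed
  have r: "r > 0" using rep_ex[OF id_perm] by auto
  have degree: "fact n = r * extension_degree \<chi>"
    unfolding card_perms(2)[symmetric]
  proof (rule power_dimension[OF top.field_hom_axioms _ _ r, where g = "\<lambda>i k. ev (e k) (generators i)"])
    fix b i assume b: "\<And>k. k < r \<Longrightarrow> (\<Sum>i<card perms. \<chi> (b i) * ev (e k) (generators i)) = 0"
      and i: "i < card perms"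
    have ev_sum: "ev \<pi> (\<Sum>i<card perms. scalar (b i) * generators i)
        = (\<Sum>i<card perms. \<chi> (b i) * ev \<pi> (generators i))" if "\<pi> \<in> perms" for \<pi>
      by (simp add: sep.ev_arith[OF that] ev_scalar[OF that])
    have "\<chi> (b i) = 0"
    proof (rule sep.m_independent[OF _ i, of "\<lambda>i. \<chi> (b i)"])
      fix \<pi> assume \<pi>: "\<pi> \<in> perms"
      have "ev \<pi> (\<Sum>i<card perms. scalar (b i) * generators i) = 0"
        by (rule all_zero[OF _ \<pi>]) (simp add: ev_sum[OF e_perm] b)
      then show "(\<Sum>i<card perms. \<chi> (b i) * ev \<pi> (generators i)) = 0" by (simp add: ev_sum[OF \<pi>])
    qed
    then show "b i = 0" by simp
  next
    fix v
    obtain y where y: "\<forall>k<r. ev (e k) y = v k" using onto by blast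
    obtain b where b: "y - (\<Sum>i<card perms. scalar (b i) * generators i) \<in> Sn_kernel \<phi> n"
      using sep.coords[of y] by auto
    have "\<forall>k<r. v k = (\<Sum>i<card perms. \<chi> (b i) * ev (e k) (generators i))"
      using y sep.ev_coords[OF b e_perm] by simp
    then show "\<exists>b. \<forall>k<r. v k = (\<Sum>i<card perms. \<chi> (b i) * ev (e k) (generators i))" by blast
  qed
  define \<Phi> where "\<Phi> y = (\<lambda>k\<in>{..<r}. ev (e k) y)" for y
  have \<Phi>_hom: "\<Phi> \<in> Ring.ring_hom ring_of_type_algebra (power_ring ?C r)"
  proof (rule type_ring_homI)
    show "\<Phi> x \<in> carrier (power_ring ?C r)" for x by (simp add: \<Phi>_def power_ring_def)
  qed (auto simp: \<Phi>_def power_ring_def fun_eq_iff restrict_def sep.ev_arith e_perm)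
  have \<Phi>_eq: "\<Phi> x = \<Phi> y \<longleftrightarrow> to_Sn_closure \<phi> n x = to_Sn_closure \<phi> n y" for x y
  proof -
    have "\<Phi> x = \<Phi> y \<longleftrightarrow> (\<forall>k<r. ev (e k) (x - y) = 0)"
      by (auto simp: \<Phi>_def fun_eq_iff restrict_def sep.ev_arith e_perm)
    also have "\<dots> \<longleftrightarrow> x - y \<in> Sn_kernel \<phi> n"
      using all_zero sep.joint_kernel[of "x - y"] ev_kernel e_perm by (metis UNIV_I)
    also have "\<dots> \<longleftrightarrow> to_Sn_closure \<phi> n x = to_Sn_closure \<phi> n y"
      unfolding Sn_kernel_def mem_Collect_eq
      by (rule type_ring_hom_eq_iff[OF to_Sn_closure_hom cring_Sn_closure, symmetric])
    finally show ?thesis .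
  qed
  obtain h where h: "h \<in> Ring.ring_hom (Sn_closure \<phi> n) (power_ring ?C r)"
    "\<And>x. h (to_Sn_closure \<phi> n x) = \<Phi> x"
    using factor_through[OF to_Sn_closure_hom cring_Sn_closure to_Sn_closure_surj \<Phi>_hom] \<Phi>_eq by metis
  have "bij_betw h (carrier (Sn_closure \<phi> n)) (carrier (power_ring ?C r))"
    unfolding bij_betw_def
  proof
    show "inj_on h (carrier (Sn_closure \<phi> n))"
      unfolding to_Sn_closure_surj[symmetric] by (auto simp: inj_on_def h(2) \<Phi>_eq)
    have "range \<Phi> = carrier (power_ring ?C r)"
    proof
      show "range \<Phi> \<subseteq> carrier (power_ring ?C r)" using ring_hom_closed[OF \<Phi>_hom] by auto
      show "carrier (power_ring ?C r) \<subseteq> range \<Phi>"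
      proof
        fix v assume v: "v \<in> carrier (power_ring ?C r)"
        obtain y where "\<forall>k<r. ev (e k) y = v k" using onto by blast
        then have "\<Phi> y = v" using v by (intro ext) (auto simp: \<Phi>_def power_ring_def PiE_def extensional_def)
        then show "v \<in> range \<Phi>" by blast
      qed
    qed
    then show "h ` carrier (Sn_closure \<phi> n) = carrier (power_ring ?C r)"
      unfolding to_Sn_closure_surj[symmetric] by (simp add: image_image h(2))
  qed
  then have "h \<in> ring_iso (Sn_closure \<phi> n) (power_ring ?C r)" using h(1) by (simp add: ring_iso_def)
  moreover have "h (Sn_scalar \<phi> n b) = power_scalar \<chi> r b" for b
    unfolding to_Sn_closure_scalar[symmetric] h(2)
    by (auto simp: \<Phi>_def power_scalar_def restrict_def ev_scalar e_perm fun_eq_iff)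
  ultimately show ?thesis using degree unfolding alg_isomorphic_def by blast
qed

end

theorem theorem2:
  fixes \<phi> :: "'b::field \<Rightarrow> 'a::field"
    and \<psi> :: "'a \<Rightarrow> 'c::field"
    and n :: nat
  assumes "comm_ring_hom \<phi>"
    and "finite_extension \<phi>" and "extension_degree \<phi> = n"
    and "separable_over \<phi> UNIV"
    and "galois_closure \<phi> \<psi>"
  shows "extension_degree (\<psi> \<circ> \<phi>) dvd fact n \<and>
    (let r = fact n div extension_degree (\<psi> \<circ> \<phi>) in
      alg_isomorphic
        (Sn_closure \<phi> n) (Sn_scalar \<phi> n)
        (power_ring (ring_of_type_algebra :: 'c ring) r) (power_scalar (\<psi> \<circ> \<phi>) r))"
proof -
  define \<chi> where "\<chi> = \<psi> \<circ> \<phi>"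
  interpret \<phi>: comm_ring_hom \<phi> by fact
  interpret \<psi>: comm_ring_hom \<psi> using assms(5) by (simp add: galois_closure_def)
  interpret \<phi>: field_hom \<phi> ..
  interpret \<psi>: field_hom \<psi> ..
  interpret \<chi>: field_hom \<chi>
    by unfold_locales (simp_all add: \<chi>_def \<phi>.hom_add \<psi>.hom_add \<phi>.hom_mult \<psi>.hom_mult)
  have galois: "galois_over \<chi> UNIV" and minimal: "\<And>E. galois_over \<chi> E \<Longrightarrow> range \<psi> \<subseteq> E \<Longrightarrow> E = UNIV"
    using assms(5) by (auto simp: galois_closure_def \<chi>_def)
  have normal: "normal_over (\<psi> \<circ> \<phi>) UNIV" using galois by (simp add: galois_over_def \<chi>_def)
  obtain \<theta> \<sigma> where *: "\<And>a. \<exists>g. a = poly (map_poly \<phi> g) \<theta>" "\<exists>es. length es = n \<and> algebra_basis \<phi> es"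
    "\<And>i. i < n \<Longrightarrow> comm_ring_hom (\<sigma> i)" "\<And>i b. i < n \<Longrightarrow> \<sigma> i (\<phi> b) = \<chi> b"
    "inj_on (\<lambda>i. \<sigma> i \<theta>) {..<n}" "\<exists>i<n. \<sigma> i = \<psi>"
    by (rule conjugate_embeddings[OF \<phi>.field_hom_axioms \<psi>.field_hom_axioms assms(2) normal assms(4),
          unfolded assms(3), folded \<chi>_def]) (rule that; assumption)
  interpret conjugate_system \<phi> \<chi> n \<theta> \<sigma>
    by (intro conjugate_system.intro conjugate_system_axioms.intro \<phi>.field_hom_axioms \<chi>.field_hom_axioms *(1-5))
  \<comment> \<open>one of the conjugate embeddings is \<open>\<psi>\<close>, so the field of all conjugates contains \<open>A\<close>\<close>
  have "closure_field = UNIV"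
  proof (rule minimal[OF closure_field_galois[OF galois]])
    show "range \<psi> \<subseteq> closure_field" using *(6) \<sigma>_in_closure_field by blast
  qed
  then obtain r where r: "fact n = r * extension_degree \<chi>"
    "alg_isomorphic (Sn_closure \<phi> n) (Sn_scalar \<phi> n)
      (power_ring (ring_of_type_algebra :: 'c ring) r) (power_scalar \<chi> r)"
    using Sn_closure_isomorphic_power by blast
  have "extension_degree \<chi> \<noteq> 0" using r(1) fact_nonzero[of n] by (metis mult_0_right)
  then have "fact n div extension_degree \<chi> = r" using r(1) by simp
  then show ?thesis using r unfolding \<chi>_def[symmetric] Let_def by simp
qed

end
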